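(* Let $\mathbb K$ be $\mathbb R$ or $\mathbb C$. If $\Gamma\subset\mathsf{PGL}(d,\mathbb K)$ is $P_{k,d-k}$-transverse, then $$\dim_H\big(\Lambda_{k,d-k,c}(\Gamma)\big)\le\delta^{\alpha_k}(\Gamma).$$ In particular, $\dim_H\big(\Lambda_{k,c}(\Gamma)\big)\le\delta^{\alpha_k}(\Gamma)$.
   Context: For $g\in\mathsf{PGL}(d,\mathbb K)$ let $\sigma_1(g)\ge\dots\ge\sigma_d(g)>0$ be the singular values of a lift with determinant of modulus $1$, $\kappa(g)=\mathrm{diag}(\log\sigma_1(g),\dots,\log\sigma_d(g))$ and $\alpha_k(\kappa(g))=\log\frac{\sigma_k(g)}{\sigma_{k+1}(g)}$. Write $g=\ell am$ with $\ell,m$ in the maximal compact subgroup ($\mathsf{PO}(d)$ or $\mathsf{PU}(d)$) and $a$ diagonal with entries $\sigma_1(g),\dots,\sigma_d(g)$; if $\alpha_k(\kappa(g))>0$, $U_k(g)=\ell(\langle e_1,\dots,e_k\rangle)$ is well defined. Let $\theta=\{k,d-k\}$ and let $\mathcal F_\theta$ be the space of partial flags in $\mathbb K^d$ with one subspace $F^j$ of each dimension $j\in\theta$. A subset $X\subset\mathcal F_\theta$ is transverse if for all distinct $F,G\in X$ and all $j\in\theta$, $F^j$ and $G^{d-j}$ are transverse. A subgroup $\Gamma$ is $P_j$-divergent if $\alpha_j(\kappa(\gamma_n))\to\infty$ for every sequence of pairwise distinct elements of $\Gamma$. If $\Gamma$ is $P_j$-divergent for all $j\in\theta$, then $U_\theta(\gamma)=(U_j(\gamma))_{j\in\theta}$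 is defined for all but finitely many $\gamma$, and $\Lambda_\theta(\Gamma)\subset\mathcal F_\theta$ is the set of all limits of $U_\theta(\gamma_n)$ along sequences of pairwise distinct elements. $\Gamma$ is $P_{k,d-k}$-transverse if it is $P_j$-divergent for all $j\in\theta$ and $\Lambda_\theta(\Gamma)$ is a transverse subset. A $P_\theta$-transverse group acts on $\Lambda_\theta(\Gamma)$ as a convergence group. A point $x\in\Lambda_\theta(\Gamma)$ is a conical limit point if there are distinct $a,b\in\Lambda_\theta(\Gamma)$ and a sequence $\{\gamma_n\}$ of distinct elements of $\Gamma$ such that $\gamma_n(x)\to a$ and $\gamma_n(y)\to b$ for all $y\in\Lambda_\theta(\Gamma)\setminus\{x\}$. $\Lambda_{k,d-k,c}(\Gamma)$ is the set of conical limit points in $\Lambda_\theta(\Gamma)$, and $\Lambda_{k,c}(\Gamma)=\pi_k(\Lambda_{k,d-k,c}(\Gamma))$ where $\pi_k:\mathcal F_\theta\to\mathrm{Gr}_k(\mathbb K^d)$ is the projection. The critical exponent is $\delta^{\alpha_k}(\Gamma)=\inf\{s:\sum_{\gamma\in\Gamma}e^{-s\alpha_k(\kappa(\gamma))}<\infty\}$. $\dim_H$ is Hausdorff dimension with respect to (the distance of) any Riemannian metric on $\mathcal F_\theta$, respectively $\mathrm{Gr}_k(\mathbb K^d)$. *)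

theory Defs
  imports "HOL-Analysis.Analysis" "HOL-Algebra.Coset"
begin

section \<open>The scalar fields R and C\<close>

text \<open>
  The class only serves to treat the real and the complex case by the same definitions: it provides
  the conjugation (the identity on the reals) needed for adjoint matrices.
\<close>

class real_or_complex = real_normed_field + euclidean_space +
  fixes cnjg :: "'a \<Rightarrow> 'a"
  assumes cnjg_add: "cnjg (x + y) = cnjg x + cnjg y"
    and cnjg_mult_self: "cnjg x * x = (norm x)\<^sup>2 *\<^sub>R 1"

instantiation real :: real_or_complex
begin

definition cnjg_real :: "real \<Rightarrow> real" where "cnjg_real x = x"

instance
  by standard (simp_all add: cnjg_real_def power2_eq_square)

end

instantiation complex :: real_or_complex
begin

definition cnjg_complex :: "complex \<Rightarrow> complex" where "cnjg_complex = cnj"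

instance
  by standard
    (simp_all add: cnjg_complex_def complex_norm_square[symmetric] mult.commute[of "cnj _"] scaleR_conv_of_real)

end


section \<open>The projective linear group\<close>

definition GL :: "('k::real_or_complex ^ 'n ^ 'n) monoid" where
  "GL = \<lparr>carrier = {A. invertible A}, mult = (**), one = mat 1\<rparr>"

definition scalar_matrices :: "('k::real_or_complex ^ 'n ^ 'n) set" where
  "scalar_matrices = {mat c | c. c \<noteq> 0}"

text \<open>An element of \<open>PGL\<close> is the set of all its lifts to \<open>GL\<close>.\<close>

definition PGL :: "('k::real_or_complex ^ 'n ^ 'n) set monoid" where
  "PGL = GL Mod scalar_matrices"

definition pgl_act :: "('k::real_or_complex ^ 'n ^ 'n) set \<Rightarrow> ('k ^ 'n) set \<Rightarrow> ('k ^ 'n) set" where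
  "pgl_act \<gamma> V = {A *v v | A v. A \<in> \<gamma> \<and> v \<in> V}"


section \<open>Singular values and the Cartan projection\<close>

definition adj :: "'k::real_or_complex ^ 'n ^ 'n \<Rightarrow> 'k ^ 'n ^ 'n" where
  "adj A = (\<chi> i j. cnjg (A $ j $ i))"

definition unitary :: "'k::real_or_complex ^ 'n ^ 'n \<Rightarrow> bool" where
  "unitary A \<longleftrightarrow> adj A ** A = mat 1 \<and> A ** adj A = mat 1"

text \<open>
  The standard basis is numbered \<open>e\<^sub>1, \<dots>, e\<^sub>d\<close> by an arbitrary but fixed enumeration of the index
  type; another enumeration conjugates everything by a permutation matrix, which is unitary.
\<close>

definition coord_pos :: "'n::finite \<Rightarrow> nat" where
  "coord_pos i = Suc (to_nat_on (UNIV :: 'n set) i)"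

definition diag_matrix :: "(nat \<Rightarrow> real) \<Rightarrow> 'k::real_or_complex ^ 'n ^ 'n" where
  "diag_matrix s = (\<chi> i j. if i = j then of_real (s (coord_pos i)) else 0)"

text \<open>Only the values of \<open>s\<close> on \<open>{1..d}\<close>, where \<open>d = CARD('n)\<close>, are meaningful.\<close>

definition svd :: "'k::real_or_complex ^ 'n ^ 'n \<Rightarrow> 'k ^ 'n ^ 'n \<Rightarrow> (nat \<Rightarrow> real) \<Rightarrow> 'k ^ 'n ^ 'n \<Rightarrow> bool" where
  "svd A L s M \<longleftrightarrow>
     unitary L \<and> unitary M \<and> A = L ** diag_matrix s ** M \<and>
     (\<forall>i\<in>{1..CARD('n)}. 0 < s i) \<and>
     (\<forall>i\<in>{1..CARD('n)}. \<forall>j\<in>{1..CARD('n)}. i \<le> j \<longrightarrow> s j \<le> s i)"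

definition pgl_svd :: "('k::real_or_complex ^ 'n ^ 'n) set \<Rightarrow> 'k ^ 'n ^ 'n \<Rightarrow> (nat \<Rightarrow> real) \<Rightarrow> 'k ^ 'n ^ 'n \<Rightarrow> bool" where
  "pgl_svd \<gamma> L s M \<longleftrightarrow> (\<exists>A\<in>\<gamma>. norm (det A) = 1 \<and> svd A L s M)"

definition sigma :: "nat \<Rightarrow> ('k::real_or_complex ^ 'n ^ 'n) set \<Rightarrow> real" where
  "sigma j \<gamma> = (THE x. \<exists>L s M. pgl_svd \<gamma> L s M \<and> x = s j)"

text \<open>\<open>alpha_kappa j \<gamma>\<close> is the simple root \<open>\<alpha>\<^sub>j\<close> evaluated on the Cartan projection of \<open>\<gamma>\<close>.\<close>

definition alpha_kappa :: "nat \<Rightarrow> ('k::real_or_complex ^ 'n ^ 'n) set \<Rightarrow> real" where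
  "alpha_kappa j \<gamma> = ln (sigma j \<gamma> / sigma (Suc j) \<gamma>)"

text \<open>Meaningful only if \<open>alpha_kappa j \<gamma> > 0\<close>.\<close>

definition U_space :: "nat \<Rightarrow> ('k::real_or_complex ^ 'n ^ 'n) set \<Rightarrow> ('k ^ 'n) set" where
  "U_space j \<gamma> = (THE V. \<exists>L s M. pgl_svd \<gamma> L s M \<and>
     V = (\<lambda>v. L *v v) ` vec.span {axis i 1 | i. coord_pos i \<le> j})"


section \<open>Grassmannians and flags\<close>

definition Gr :: "nat \<Rightarrow> ('k::real_or_complex ^ 'n) set set" where
  "Gr j = {V. vec.subspace V \<and> vec.dim V = j}"

type_synonym ('k, 'n) flag = "('k ^ 'n) set \<times> ('k ^ 'n) set"

text \<open>
  A flag of type \<open>{k, d - k}\<close> is the pair of its components of dimension \<open>k\<close> and \<open>d - k\<close>, in this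
  order. Either inclusion may occur, since \<open>k \<le> d - k\<close> is not required; if \<open>k = d - k\<close> the two
  components coincide.
\<close>

definition Flags :: "nat \<Rightarrow> ('k::real_or_complex, 'n::finite) flag set" where
  "Flags k = {(V, W). V \<in> Gr k \<and> W \<in> Gr (CARD('n) - k) \<and> (V \<subseteq> W \<or> W \<subseteq> V)}"

definition flag_act :: "('k::real_or_complex ^ 'n ^ 'n) set \<Rightarrow> ('k, 'n) flag \<Rightarrow> ('k, 'n) flag" where
  "flag_act \<gamma> F = (pgl_act \<gamma> (fst F), pgl_act \<gamma> (snd F))"

definition U_flag :: "nat \<Rightarrow> ('k::real_or_complex ^ 'n ^ 'n) set \<Rightarrow> ('k, 'n) flag" where
  "U_flag k \<gamma> = (U_space k \<gamma>, U_space (CARD('n) - k) \<gamma>)"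

definition transverse_subspaces :: "('k::real_or_complex ^ 'n) set \<Rightarrow> ('k ^ 'n) set \<Rightarrow> bool" where
  "transverse_subspaces V W \<longleftrightarrow> V \<inter> W = {0} \<and> {v + w | v w. v \<in> V \<and> w \<in> W} = UNIV"

definition transverse_subset :: "('k::real_or_complex, 'n::finite) flag set \<Rightarrow> bool" where
  "transverse_subset X \<longleftrightarrow> (\<forall>F\<in>X. \<forall>G\<in>X. F \<noteq> G \<longrightarrow>
     transverse_subspaces (fst F) (snd G) \<and> transverse_subspaces (snd F) (fst G))"

text \<open>
  Grassmannians and flag manifolds carry the topology and the smooth structure given by the usual
  embedding that sends a subspace to its orthogonal projection.
\<close>

definition proj_matrix :: "('k::real_or_complex ^ 'n) set \<Rightarrow> 'k ^ 'n ^ 'n" where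
  "proj_matrix V = (THE P. adj P = P \<and> P ** P = P \<and> range (\<lambda>v. P *v v) = V)"

definition flag_embedding :: "('k::real_or_complex, 'n::finite) flag \<Rightarrow> ('k ^ 'n ^ 'n) \<times> ('k ^ 'n ^ 'n)" where
  "flag_embedding F = (proj_matrix (fst F), proj_matrix (snd F))"

definition flag_tendsto :: "(nat \<Rightarrow> ('k::real_or_complex, 'n::finite) flag) \<Rightarrow> ('k, 'n) flag \<Rightarrow> bool" where
  "flag_tendsto F G \<longleftrightarrow> (\<lambda>n. flag_embedding (F n)) \<longlonglongrightarrow> flag_embedding G"


section \<open>Transverse groups and their limit sets\<close>

definition P_divergent :: "nat \<Rightarrow> ('k::real_or_complex ^ 'n ^ 'n) set set \<Rightarrow> bool" where
  "P_divergent j \<Gamma> \<longleftrightarrow> (\<forall>\<gamma> :: nat \<Rightarrow> _. inj \<gamma> \<and> range \<gamma> \<subseteq> \<Gamma> \<longrightarrow>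
     filterlim (\<lambda>n. alpha_kappa j (\<gamma> n)) at_top sequentially)"

definition limit_set :: "nat \<Rightarrow> ('k::real_or_complex ^ 'n ^ 'n) set set \<Rightarrow> ('k, 'n) flag set" where
  "limit_set k \<Gamma> = {F \<in> Flags k. \<exists>\<gamma> :: nat \<Rightarrow> _. inj \<gamma> \<and> range \<gamma> \<subseteq> \<Gamma> \<and>
     flag_tendsto (\<lambda>n. U_flag k (\<gamma> n)) F}"

definition transverse_group :: "nat \<Rightarrow> ('k::real_or_complex ^ 'n ^ 'n) set set \<Rightarrow> bool" where
  "transverse_group k \<Gamma> \<longleftrightarrow> subgroup \<Gamma> PGL \<and>
     P_divergent k \<Gamma> \<and> P_divergent (CARD('n) - k) \<Gamma> \<and> transverse_subset (limit_set k \<Gamma>)"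

definition conical_limit_set :: "nat \<Rightarrow> ('k::real_or_complex ^ 'n ^ 'n) set set \<Rightarrow> ('k, 'n) flag set" where
  "conical_limit_set k \<Gamma> = {x \<in> limit_set k \<Gamma>.
     \<exists>a\<in>limit_set k \<Gamma>. \<exists>b\<in>limit_set k \<Gamma>. a \<noteq> b \<and>
     (\<exists>\<gamma> :: nat \<Rightarrow> _. inj \<gamma> \<and> range \<gamma> \<subseteq> \<Gamma> \<and>
        flag_tendsto (\<lambda>n. flag_act (\<gamma> n) x) a \<and>
        (\<forall>y\<in>limit_set k \<Gamma> - {x}. flag_tendsto (\<lambda>n. flag_act (\<gamma> n) y) b))}"

text \<open>
  For infinite \<open>\<Gamma>\<close> the series diverges at every \<open>s \<le> 0\<close>, so the restriction to \<open>s \<ge> 0\<close>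
  only fixes the convention that finite groups have critical exponent \<open>0\<close>. The value is \<open>\<infinity>\<close> if
  the series never converges.
\<close>

definition critical_exponent :: "nat \<Rightarrow> ('k::real_or_complex ^ 'n ^ 'n) set set \<Rightarrow> ennreal" where
  "critical_exponent k \<Gamma> =
     (INF s\<in>{s::real. 0 \<le> s \<and> (\<lambda>\<gamma>. exp (- s * alpha_kappa k \<gamma>)) summable_on \<Gamma>}. ennreal s)"


section \<open>Hausdorff dimension\<close>

definition ediam :: "('a \<Rightarrow> 'a \<Rightarrow> real) \<Rightarrow> 'a set \<Rightarrow> ennreal" where
  "ediam d U = (SUP x\<in>U. SUP y\<in>U. ennreal (d x y))"

definition hausdorff_measure :: "'a set \<Rightarrow> ('a \<Rightarrow> 'a \<Rightarrow> real) \<Rightarrow> real \<Rightarrow> 'a set \<Rightarrow> ennreal" where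
  "hausdorff_measure X d s A = (SUP \<epsilon>\<in>{0::real<..}.
     INF U\<in>{U :: nat \<Rightarrow> 'a set. (\<forall>i. U i \<subseteq> X \<and> ediam d (U i) \<le> ennreal \<epsilon>) \<and> A \<subseteq> (\<Union>i. U i)}.
       \<Sum>i. ennreal (enn2real (ediam d (U i)) powr s))"

text \<open>
  Excluding \<open>s = 0\<close> does not change the infimum and avoids the convention \<open>0 powr 0 = 0\<close>.
\<close>

definition hausdorff_dim :: "'a set \<Rightarrow> ('a \<Rightarrow> 'a \<Rightarrow> real) \<Rightarrow> 'a set \<Rightarrow> ennreal" where
  "hausdorff_dim X d A = (INF s\<in>{s::real. 0 < s \<and> hausdorff_measure X d s A = 0}. ennreal s)"


section \<open>Riemannian metrics on embedded manifolds\<close>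

primrec Ck_on :: "nat \<Rightarrow> 'e::euclidean_space set \<Rightarrow> ('e \<Rightarrow> real) \<Rightarrow> bool" where
  "Ck_on 0 S f \<longleftrightarrow> continuous_on S f"
| "Ck_on (Suc m) S f \<longleftrightarrow> f differentiable_on S \<and>
     (\<forall>v. Ck_on m S (\<lambda>x. frechet_derivative f (at x) v))"

text \<open>
  A Riemannian metric on a compact submanifold \<open>N\<close> of a Euclidean space is given here by a smooth
  family of inner products on the ambient space, defined near \<open>N\<close>. Only the restrictions to the
  tangent spaces of \<open>N\<close> matter for the distance, and every Riemannian metric on \<open>N\<close> is such a
  restriction: extend it orthogonally by the Euclidean inner product on the normal spaces, and then
  smoothly to a neighbourhood of \<open>N\<close>.
\<close>

definition riemannian_metric :: "'e::euclidean_space set \<Rightarrow> ('e \<Rightarrow> 'e \<Rightarrow> 'e \<Rightarrow> real) \<Rightarrow> bool" where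
  "riemannian_metric N g \<longleftrightarrow>
     (\<forall>p\<in>N. bilinear (g p) \<and> (\<forall>u v. g p u v = g p v u) \<and> (\<forall>u. u \<noteq> 0 \<longrightarrow> 0 < g p u u)) \<and>
     (\<exists>S. open S \<and> N \<subseteq> S \<and> (\<forall>u v m. Ck_on m S (\<lambda>p. g p u v)))"

definition riemannian_speed :: "('e::euclidean_space \<Rightarrow> 'e \<Rightarrow> 'e \<Rightarrow> real) \<Rightarrow> (real \<Rightarrow> 'e) \<Rightarrow> real \<Rightarrow> real" where
  "riemannian_speed g c t = sqrt (g (c t) (vector_derivative c (at t)) (vector_derivative c (at t)))"

text \<open>
  Integrability of the speed is demanded because \<open>valid_path\<close> (piecewise continuously differentiable
  on \<open>{0..1}\<close>) allows an unbounded derivative at the break points, hence curves of infinite length,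
  for which \<open>integral\<close> would return \<open>0\<close>.
\<close>

definition riemannian_dist :: "'e::euclidean_space set \<Rightarrow> ('e \<Rightarrow> 'e \<Rightarrow> 'e \<Rightarrow> real) \<Rightarrow> 'e \<Rightarrow> 'e \<Rightarrow> real" where
  "riemannian_dist N g p q =
     Inf {integral {0..1} (riemannian_speed g c) | c.
       valid_path c \<and> path_image c \<subseteq> N \<and> pathstart c = p \<and> pathfinish c = q \<and>
       riemannian_speed g c integrable_on {0..1}}"

text \<open>
  Hausdorff dimension of a subset \<open>A\<close> of a manifold \<open>X\<close> embedded by \<open>\<iota>\<close>, for the Riemannian
  metric \<open>g\<close> on \<open>\<iota> ` X\<close>.
\<close>

definition riemannian_hausdorff_dim ::
    "('x \<Rightarrow> 'e::euclidean_space) \<Rightarrow> 'x set \<Rightarrow> ('e \<Rightarrow> 'e \<Rightarrow> 'e \<Rightarrow> real) \<Rightarrow> 'x set \<Rightarrow> ennreal" where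
  "riemannian_hausdorff_dim \<iota> X g A =
     hausdorff_dim X (\<lambda>x y. riemannian_dist (\<iota> ` X) g (\<iota> x) (\<iota> y)) A"

end

theory Submission
  imports Defs
begin

text \<open>
  Conical limit points are well approximated by the attracting flags of group elements. The basic
  estimate is \<open>contraction\<close>: if each vector \<open>v\<close> of a subspace \<open>V\<close> of dimension \<open>j\<close> is at distance
  at least \<open>\<epsilon> * norm v\<close> from the repelling space \<open>U_space (d - j) (inv \<gamma>)\<close>, then the distance from
  \<open>\<gamma> V\<close> to the attracting space \<open>U_space j \<gamma>\<close> is at most a constant times
  \<open>exp (- \<alpha>\<^sub>j \<gamma>) / \<epsilon>\<close>.

  A finite limit set has dimension 0, so let the limit set be infinite. Let \<open>x\<close> be conical, with
  \<open>\<gamma>\<^sub>n x \<rightarrow> a\<close> and \<open>\<gamma>\<^sub>n y \<rightarrow> b\<close> for the other limit points \<open>y\<close>. Pass to a subsequence along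
  which the repelling flags of \<open>\<gamma>\<^sub>n\<close> converge, to \<open>x'\<close> say. A limit point \<open>y\<close> other than \<open>x\<close> and
  \<open>x'\<close> is transverse to \<open>x'\<close>, so the estimate shows that the attracting flags of \<open>\<gamma>\<^sub>n\<close> converge to
  \<open>b\<close>, too. These are the repelling flags of the inverses \<open>\<beta>\<^sub>n\<close>. Since \<open>a\<close> and \<open>b\<close> are
  transverse, \<open>\<gamma>\<^sub>n x\<close> is uniformly transverse to them, and the estimate for \<open>\<beta>\<^sub>n\<close> places
  \<open>x = \<beta>\<^sub>n (\<gamma>\<^sub>n x)\<close> within \<open>m exp (- \<alpha>\<^sub>j \<beta>\<^sub>n)\<close> of the attracting flag of \<open>\<beta>\<^sub>n\<close>, in both
  components \<open>j\<close> and with \<open>m\<close> independent of \<open>n\<close> (\<open>conical_near_centres\<close>).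

  So the conical limit set is a countable union, over \<open>m\<close>, of sets of points that lie in infinitely many
  of the balls of radius \<open>m (exp (- \<alpha>\<^sub>k \<beta>) + exp (- \<alpha>\<^sub>d\<^sub>-\<^sub>k \<beta>))\<close> around the attracting flags. Since
  \<open>\<alpha>\<^sub>d\<^sub>-\<^sub>k \<beta> = \<alpha>\<^sub>k (inv \<beta>)\<close>, the \<open>s\<close>-th powers of these radii are summable whenever the series that
  defines the critical exponent converges at \<open>s > 0\<close>, and then such a set has \<open>s\<close>-dimensional
  Hausdorff measure 0 (\<open>hausdorff_null_limsup\<close>).

  The balls are taken with respect to the norm of projection matrices. To pass to a Riemannian distance it
  suffices that it is locally at most a constant times the norm distance (\<open>dominated_near_Flags\<close>,
  \<open>dominated_near_Gr\<close>). Explicit paths show this: the flags near a given one are its images under matrices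
  \<open>G\<close> near the identity, and the matrices \<open>1 + t (G - 1)\<close> connect them inside the flag manifold.

  The existence of singular value decompositions and the independence of the singular values and of the
  attracting spaces from the decomposition are proved first, as the Cartan projection and the attracting
  spaces are defined through them.
\<close>

section \<open>Conjugation, adjoint matrices and the Frobenius norm\<close>

lemma cnjg_zero [simp]: "cnjg (0::'a::real_or_complex) = 0"
proof -
  have "cnjg (0 + 0 :: 'a) = cnjg 0 + cnjg 0" by (rule cnjg_add)
  thus ?thesis by simp
qed

lemma cnjg_mult_self': "cnjg x * x = of_real ((norm (x::'a::real_or_complex))\<^sup>2)"
  by (simp add: cnjg_mult_self scaleR_conv_of_real)

text \<open>
  The class axioms give only additivity and the value of \<open>cnjg x * x\<close>. In a field the second one
  determines \<open>cnjg\<close>, and multiplicativity and involutivity follow.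
\<close>

lemma cnjg_eq: "(x::'a::real_or_complex) \<noteq> 0 \<Longrightarrow> cnjg x = of_real ((norm x)\<^sup>2) / x"
  using cnjg_mult_self'[of x] by (simp add: field_simps)

lemma norm_cnjg [simp]: "norm (cnjg (x::'a::real_or_complex)) = norm x"
  by (cases "x = 0") (simp_all add: cnjg_eq norm_divide norm_mult power2_eq_square)

lemma cnjg_mult [simp]: "cnjg (x * y :: 'a::real_or_complex) = cnjg x * cnjg y"
  by (cases "x = 0 \<or> y = 0") (auto simp: cnjg_eq norm_mult power_mult_distrib)

lemma cnjg_of_real [simp]: "cnjg (of_real r :: 'a::real_or_complex) = of_real r"
  by (cases "r = 0") (simp_all add: cnjg_eq power2_eq_square)

lemma cnjg_one [simp]: "cnjg (1 :: 'a::real_or_complex) = 1"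
  using cnjg_of_real[of 1] by simp

lemma cnjg_cnjg [simp]: "cnjg (cnjg x) = (x :: 'a::real_or_complex)"
proof (cases "x = 0")
  case False
  hence "cnjg x \<noteq> 0" using norm_cnjg[of x] by (metis norm_eq_zero)
  have "cnjg (cnjg x) = of_real ((norm (cnjg x))\<^sup>2) / cnjg x"
    by (rule cnjg_eq) fact
  also have "\<dots> = of_real ((norm x)\<^sup>2) / cnjg x"
    by simp
  also have "\<dots> = x" using False by (simp add: cnjg_eq)
  finally show ?thesis .
qed simp

lemma cnjg_minus [simp]: "cnjg (- x :: 'a::real_or_complex) = - cnjg x"
  using cnjg_mult[of "-1" x] cnjg_of_real[of "-1", where 'a='a] by simp

lemma cnjg_diff: "cnjg (x - y :: 'a::real_or_complex) = cnjg x - cnjg y"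
  using cnjg_add[of x "-y"] by simp

lemma cnjg_scaleR [simp]: "cnjg (r *\<^sub>R x :: 'a::real_or_complex) = r *\<^sub>R cnjg x"
  by (simp add: scaleR_conv_of_real)

lemma cnjg_sum: "cnjg (\<Sum>i\<in>S. f i :: 'a::real_or_complex) = (\<Sum>i\<in>S. cnjg (f i))"
  by (induction S rule: infinite_finite_induct) (simp_all add: cnjg_add)

lemma cnjg_inner:
  "cnjg x * y + cnjg y * x = of_real (2 * ((x :: 'a::real_or_complex) \<bullet> y))"
proof -
  have "of_real ((norm (x + y))\<^sup>2) = cnjg (x + y) * (x + y)" by (simp only: cnjg_mult_self')
  also have "\<dots> = cnjg x * x + cnjg y * y + (cnjg x * y + cnjg y * x)"
    by (simp add: cnjg_add algebra_simps)
  also have "\<dots> = of_real ((norm x)\<^sup>2 + (norm y)\<^sup>2) + (cnjg x * y + cnjg y * x)"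
    by (simp only: cnjg_mult_self' of_real_add)
  finally have "cnjg x * y + cnjg y * x
      = of_real ((norm (x + y))\<^sup>2 - ((norm x)\<^sup>2 + (norm y)\<^sup>2))"
    by (simp only: of_real_diff) (simp add: algebra_simps)
  thus ?thesis
    by (simp add: power2_norm_eq_inner inner_add inner_commute)
qed

lemma inner_mult_cnjg: "(c * x) \<bullet> y = (x :: 'a::real_or_complex) \<bullet> (cnjg c * y)"
proof -
  have "(of_real (2 * ((c * x) \<bullet> y)) :: 'a) = of_real (2 * (x \<bullet> (cnjg c * y)))"
    by (simp only: cnjg_inner[symmetric]) (simp add: algebra_simps)
  thus ?thesis by (simp only: of_real_eq_iff)
qed

text \<open>
  The conjugate transpose is also the adjoint for the real inner product. Projections, norms and angles
  can therefore be handled with the real Euclidean structure, for both scalar fields at once.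
\<close>

lemma inner_adj: "(A *v x) \<bullet> y = x \<bullet> (adj A *v (y :: 'k::real_or_complex ^ 'n))"
proof -
  have "(A *v x) \<bullet> y = (\<Sum>i\<in>UNIV. \<Sum>j\<in>UNIV. (A$i$j * x$j) \<bullet> y$i)"
    by (simp add: inner_vec_def matrix_vector_mult_def inner_sum_left)
  also have "\<dots> = (\<Sum>j\<in>UNIV. \<Sum>i\<in>UNIV. x$j \<bullet> (cnjg (A$i$j) * y$i))"
    by (subst sum.swap) (simp add: inner_mult_cnjg)
  also have "\<dots> = x \<bullet> (adj A *v y)"
    by (simp add: inner_vec_def matrix_vector_mult_def inner_sum_right adj_def)
  finally show ?thesis .
qed

lemma adj_mult: "adj (A ** B) = adj B ** adj (A :: 'k::real_or_complex ^ 'n ^ 'n)"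
  by (simp add: adj_def matrix_matrix_mult_def vec_eq_iff cnjg_sum mult.commute)

lemma adj_add: "adj (A + B) = adj A + adj (B :: 'k::real_or_complex ^ 'n ^ 'n)"
  by (simp add: adj_def vec_eq_iff cnjg_add)

lemma adj_diff: "adj (A - B) = adj A - adj (B :: 'k::real_or_complex ^ 'n ^ 'n)"
  by (simp add: adj_def vec_eq_iff cnjg_diff)

lemma adj_adj [simp]: "adj (adj A) = (A :: 'k::real_or_complex ^ 'n ^ 'n)"
  by (simp add: adj_def vec_eq_iff)

lemma adj_mat: "adj (mat c) = (mat (cnjg c) :: 'k::real_or_complex ^ 'n ^ 'n)"
  by (simp add: adj_def mat_def vec_eq_iff)

lemma adj_one [simp]: "adj (mat 1) = (mat 1 :: 'k::real_or_complex ^ 'n ^ 'n)"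
  by (simp add: adj_mat)

lemma adj_scaleR: "adj (r *\<^sub>R A) = r *\<^sub>R adj (A :: 'k::real_or_complex ^ 'n ^ 'n)"
  by (simp add: adj_def vec_eq_iff)

lemma adj_component: "adj A $ i $ j = cnjg (A $ j $ i)"
  by (simp add: adj_def)

lemma norm_vec_sq: "(norm (x :: 'a::real_normed_vector ^ 'n))\<^sup>2 = (\<Sum>i\<in>UNIV. (norm (x$i))\<^sup>2)"
  by (simp add: norm_vec_def L2_set_def sum_nonneg)

lemma norm_mat_sq: "(norm (A :: 'a::real_normed_vector ^ 'n ^ 'm))\<^sup>2
    = (\<Sum>i\<in>UNIV. \<Sum>j\<in>UNIV. (norm (A$i$j))\<^sup>2)"
  by (simp add: norm_vec_sq)

lemma norm_adj [simp]: "norm (adj (A :: 'k::real_or_complex ^ 'n ^ 'n)) = norm A"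
proof -
  have "(norm (adj A))\<^sup>2 = (norm A)\<^sup>2"
    unfolding norm_mat_sq adj_component by (subst sum.swap) simp
  thus ?thesis by simp
qed

lemma bounded_linear_adj: "bounded_linear (adj :: 'k::real_or_complex ^ 'n ^ 'n \<Rightarrow> _)"
  by (rule bounded_linear_intro[where K = 1]) (simp_all add: adj_add adj_scaleR)

lemma norm_mv_le: "norm (A *v x) \<le> norm A * norm x"
  for A :: "'k::real_or_complex ^ 'n ^ 'm"
proof -
  have "(norm (A *v x))\<^sup>2 = (\<Sum>i\<in>UNIV. (norm (\<Sum>j\<in>UNIV. A$i$j * x$j))\<^sup>2)"
    by (simp add: norm_vec_sq matrix_vector_mult_def)
  also have "\<dots> \<le> (\<Sum>i\<in>UNIV. (norm (A$i))\<^sup>2 * (norm x)\<^sup>2)"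
  proof (rule sum_mono)
    fix i
    have "norm (\<Sum>j\<in>UNIV. A$i$j * x$j) \<le> (\<Sum>j\<in>UNIV. norm (A$i$j) * norm (x$j))"
      by (rule order_trans[OF norm_sum]) (simp add: norm_mult)
    also have "\<dots> \<le> norm (A$i) * norm x"
      using L2_set_mult_ineq[of "\<lambda>j. norm (A$i$j)" "\<lambda>j. norm (x$j)" UNIV]
      by (simp add: norm_vec_def)
    finally show "(norm (\<Sum>j\<in>UNIV. A$i$j * x$j))\<^sup>2 \<le> (norm (A$i))\<^sup>2 * (norm x)\<^sup>2"
      by (metis norm_ge_zero power_mono power_mult_distrib)
  qed
  also have "\<dots> = (norm A * norm x)\<^sup>2"
    by (simp add: norm_vec_sq[of A] power_mult_distrib sum_distrib_right)
  finally show ?thesis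
    by (rule power2_le_imp_le) simp
qed

lemma mv_axis: "(A *v axis j 1) $ i = A $ i $ j" for A :: "'k::real_or_complex ^ 'n ^ 'm"
  by (simp add: matrix_vector_mult_def axis_def if_distrib cong: if_cong)

lemma norm_mat_columns:
  "(norm (A :: 'k::real_or_complex ^ 'n ^ 'm))\<^sup>2 = (\<Sum>j\<in>UNIV. (norm (A *v axis j 1))\<^sup>2)"
  unfolding norm_mat_sq
  by (subst sum.swap) (simp add: norm_vec_sq mv_axis)

text \<open>
  The norm of a matrix is its Frobenius norm, which is submultiplicative; it makes the trace identities
  for projections below exact.
\<close>

lemma norm_mm_le: "norm (A ** B) \<le> norm A * norm B"
  for A :: "'k::real_or_complex ^ 'm ^ 'l" and B :: "'k ^ 'n ^ 'm"
proof -
  have "(norm (A ** B))\<^sup>2 = (\<Sum>j\<in>UNIV. (norm (A *v (B *v axis j 1)))\<^sup>2)"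
    by (simp add: norm_mat_columns matrix_vector_mul_assoc)
  also have "\<dots> \<le> (\<Sum>j\<in>UNIV. (norm A * norm (B *v axis j 1))\<^sup>2)"
    by (intro sum_mono power_mono norm_mv_le) simp
  also have "\<dots> = (norm A * norm B)\<^sup>2"
    by (simp add: norm_mat_columns[of B] power_mult_distrib sum_distrib_left)
  finally show ?thesis
    by (rule power2_le_imp_le) simp
qed

lemma mat_scaleR_left: "(r *\<^sub>R A) ** B = r *\<^sub>R (A ** (B :: 'k::real_or_complex ^ 'n ^ 'm))"
  by (simp add: matrix_matrix_mult_def vec_eq_iff scaleR_sum_right)

lemma mat_scaleR_right: "A ** (r *\<^sub>R B) = r *\<^sub>R (A ** (B :: 'k::real_or_complex ^ 'n ^ 'm))"
  by (simp add: matrix_matrix_mult_def vec_eq_iff scaleR_sum_right)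

lemma bounded_bilinear_mm:
  "bounded_bilinear ((**) :: 'k::real_or_complex ^ 'm ^ 'l \<Rightarrow> 'k ^ 'n ^ 'm \<Rightarrow> 'k ^ 'n ^ 'l)"
proof
  show "\<exists>K. \<forall>A B. norm ((A :: 'k ^ 'm ^ 'l) ** (B :: 'k ^ 'n ^ 'm)) \<le> norm A * norm B * K"
    by (rule exI[of _ 1]) (simp add: norm_mm_le)
qed (simp_all add: matrix_add_ldistrib mat_scaleR_left mat_scaleR_right
    matrix_matrix_mult_def vec_eq_iff distrib_right distrib_left sum.distrib scaleR_sum_right)

lemma bounded_bilinear_mv:
  "bounded_bilinear ((*v) :: 'k::real_or_complex ^ 'm ^ 'l \<Rightarrow> 'k ^ 'm \<Rightarrow> 'k ^ 'l)"
proof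
  show "\<exists>K. \<forall>A x. norm ((A :: 'k ^ 'm ^ 'l) *v x) \<le> norm A * norm x * K"
    by (rule exI[of _ 1]) (simp add: norm_mv_le)
qed (simp_all add: matrix_vector_mult_def vec_eq_iff distrib_right distrib_left sum.distrib
    scaleR_sum_right)

interpretation mm: bounded_bilinear "(**) :: 'k::real_or_complex ^ 'm ^ 'l \<Rightarrow> 'k ^ 'n ^ 'm \<Rightarrow> 'k ^ 'n ^ 'l"
  by (rule bounded_bilinear_mm)

interpretation mv: bounded_bilinear "(*v) :: 'k::real_or_complex ^ 'm ^ 'l \<Rightarrow> 'k ^ 'm \<Rightarrow> 'k ^ 'l"
  by (rule bounded_bilinear_mv)

lemma trace_adj_mult_self:
  "trace (adj A ** A) = of_real ((norm (A :: 'k::real_or_complex ^ 'n ^ 'n))\<^sup>2)"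
proof -
  have "trace (adj A ** A) = (\<Sum>i\<in>UNIV. \<Sum>j\<in>UNIV. cnjg (A$j$i) * A$j$i)"
    by (simp add: trace_def matrix_matrix_mult_def adj_def)
  also have "\<dots> = of_real (\<Sum>i\<in>UNIV. \<Sum>j\<in>UNIV. (norm (A$j$i))\<^sup>2)"
    by (simp only: cnjg_mult_self' of_real_sum)
  also have "\<dots> = of_real ((norm A)\<^sup>2)"
    unfolding norm_mat_sq by (subst sum.swap) simp
  finally show ?thesis .
qed

lemma matrix_eqI: "(\<And>x. A *v x = B *v x) \<Longrightarrow> A = (B :: 'k::real_or_complex ^ 'n ^ 'm)"
  by (simp add: matrix_eq)

section \<open>Orthonormal families, Grassmannians and orthogonal projections\<close>

lemma bij_coord_pos: "bij_betw (coord_pos :: 'n::finite \<Rightarrow> nat) UNIV {1..CARD('n)}"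
proof -
  have "bij_betw (to_nat_on (UNIV :: 'n set)) UNIV {..<CARD('n)}"
    by (rule to_nat_on_finite) simp
  moreover have "bij_betw Suc {..<CARD('n)} {1..CARD('n)}"
    by (rule bij_betw_byWitness[where f' = "\<lambda>n. n - 1"]) auto
  ultimately have "bij_betw (Suc \<circ> to_nat_on (UNIV :: 'n set)) UNIV {1..CARD('n)}"
    by (rule bij_betw_trans)
  thus ?thesis by (simp add: coord_pos_def[abs_def] comp_def)
qed

lemma coord_pos_in [simp]: "coord_pos (i :: 'n::finite) \<in> {1..CARD('n)}"
  using bij_betwE[OF bij_coord_pos] by blast

lemma coord_pos_ge [simp]: "Suc 0 \<le> coord_pos (i :: 'n::finite)"
  and coord_pos_le [simp]: "coord_pos (i :: 'n::finite) \<le> CARD('n)"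
  using coord_pos_in[of i] by auto

lemma coord_pos_eq_iff [simp]: "coord_pos i = coord_pos j \<longleftrightarrow> i = (j :: 'n::finite)"
  using bij_coord_pos[where 'n='n] by (auto simp: bij_betw_def inj_on_def)

lemma coord_pos_surj:
  assumes "m \<in> {1..CARD('n)}" obtains i :: "'n::finite" where "coord_pos i = m"
proof -
  have "m \<in> range (coord_pos :: 'n \<Rightarrow> nat)"
    using assms bij_coord_pos[where 'n='n] by (simp add: bij_betw_def)
  thus thesis using that by blast
qed

lemma card_coord_pos_le:
  assumes "j \<le> CARD('n)" shows "card {i :: 'n::finite. coord_pos i \<le> j} = j"
proof -
  have "bij_betw coord_pos {i :: 'n. coord_pos i \<le> j} {1..j}"
    unfolding bij_betw_def
  proof
    show "inj_on coord_pos {i :: 'n. coord_pos i \<le> j}" by (auto simp: inj_on_def)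
    show "coord_pos ` {i :: 'n. coord_pos i \<le> j} = {1..j}"
    proof
      show "{1..j} \<subseteq> coord_pos ` {i :: 'n. coord_pos i \<le> j}"
      proof
        fix m assume m: "m \<in> {1..j}"
        then obtain i :: 'n where "coord_pos i = m"
          using assms by (metis coord_pos_surj atLeastAtMost_iff order_trans)
        thus "m \<in> coord_pos ` {i :: 'n. coord_pos i \<le> j}" using m by auto
      qed
    qed auto
  qed
  from bij_betw_same_card[OF this] show ?thesis by simp
qed

definition hinner :: "'k::real_or_complex ^ 'n \<Rightarrow> 'k ^ 'n \<Rightarrow> 'k" where
  "hinner x y = (\<Sum>i\<in>UNIV. cnjg (x $ i) * y $ i)"

lemma hinner_add_right: "hinner x (y + z) = hinner x y + hinner x z"
  and hinner_diff_right: "hinner x (y - z) = hinner x y - hinner x z"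
  and hinner_scale_right: "hinner x (c *s y) = c * hinner x y"
  and hinner_scale_left: "hinner (c *s x) y = cnjg c * hinner x y"
  and hinner_zero_right [simp]: "hinner x 0 = 0"
  and hinner_commute: "hinner x y = cnjg (hinner y x)"
  by (simp_all add: hinner_def sum.distrib sum_subtractf sum_distrib_left algebra_simps cnjg_sum)

lemma hinner_sum_right: "hinner x (\<Sum>i\<in>S. f i) = (\<Sum>i\<in>S. hinner x (f i))"
  by (induction S rule: infinite_finite_induct) (simp_all add: hinner_add_right)

lemma hinner_self: "hinner x x = of_real ((norm x)\<^sup>2)"
  by (simp only: hinner_def cnjg_mult_self' norm_vec_sq of_real_sum)

lemma hinner_re: "hinner x y + hinner y x = of_real (2 * (x \<bullet> y))"
proof -
  have "hinner x y + hinner y x = (\<Sum>i\<in>UNIV. cnjg (x $ i) * y $ i + cnjg (y $ i) * x $ i)"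
    by (simp add: hinner_def sum.distrib)
  also have "\<dots> = of_real (2 * (x \<bullet> y))"
    by (simp only: cnjg_inner of_real_sum[symmetric] sum_distrib_left[symmetric] inner_vec_def)
  finally show ?thesis .
qed

lemma norm_scale: "norm (c *s x) = norm c * norm (x :: 'k::real_or_complex ^ 'n)"
proof -
  have "(norm (c *s x))\<^sup>2 = (norm c * norm x)\<^sup>2"
    by (simp add: norm_vec_sq power_mult_distrib norm_mult sum_distrib_left)
  thus ?thesis by simp
qed

lemma scale_of_real: "of_real r *s x = r *\<^sub>R (x :: 'k::real_or_complex ^ 'n)"
  by (simp add: vec_eq_iff) (simp add: scaleR_conv_of_real)

text \<open>
  Orthonormality of \<open>v 1, \<dots>, v m\<close>. Families are numbered from 1 so that they match the positions of
  the coordinates.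
\<close>

definition onf :: "nat \<Rightarrow> (nat \<Rightarrow> 'k::real_or_complex ^ 'n) \<Rightarrow> bool" where
  "onf m v \<longleftrightarrow> (\<forall>i\<in>{1..m}. \<forall>j\<in>{1..m}. hinner (v i) (v j) = (if i = j then 1 else 0))"

lemma onf_Suc:
  assumes "onf m v" and "norm w = 1" and "\<forall>i\<in>{1..m}. hinner (v i) w = 0"
  shows "onf (Suc m) (v(Suc m := w))"
proof -
  have "hinner w w = 1" using assms(2) by (simp add: hinner_self)
  moreover have "hinner w (v i) = 0" if "i \<in> {1..m}" for i
    using assms(3) that by (subst hinner_commute) simp
  ultimately show ?thesis
    using assms(1,3) unfolding onf_def by (auto simp: le_Suc_eq)
qed

text \<open>
  One step of the Gram-Schmidt process: subtract from a vector outside the span its expansion in the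
  family.
\<close>

lemma onf_extend:
  fixes v :: "nat \<Rightarrow> 'k::real_or_complex ^ 'n"
  assumes v: "onf m v" "\<And>i. i \<in> {1..m} \<Longrightarrow> v i \<in> V" and V: "vec.subspace V" "m < vec.dim V"
  obtains w where "w \<in> V" "norm w = 1" "\<forall>i\<in>{1..m}. hinner (v i) w = 0"
proof -
  let ?S = "vec.span (v ` {1..m})"
  have "\<not> V \<subseteq> ?S"
  proof
    assume "V \<subseteq> ?S"
    hence "vec.dim V \<le> card (v ` {1..m})" by (rule vec.dim_le_card) simp
    also have "\<dots> \<le> m" using card_image_le[of "{1..m}" v] by simp
    finally show False using V(2) by simp
  qed
  then obtain x where x: "x \<in> V" "x \<notin> ?S" by blast
  define p where "p = (\<Sum>i\<in>{1..m}. hinner (v i) x *s v i)"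
  define y where "y = x - p"
  have p: "p \<in> ?S" "p \<in> V"
    unfolding p_def
    by (intro vec.span_sum vec.span_scale vec.span_base imageI, assumption)
      (intro vec.subspace_sum[OF V(1)] vec.subspace_scale[OF V(1)] v(2), assumption)
  have "y \<noteq> 0" using x p by (auto simp: y_def)
  have yV: "y \<in> V" unfolding y_def by (rule vec.subspace_diff[OF V(1) x(1) p(2)])
  have perp: "hinner (v i) y = 0" if "i \<in> {1..m}" for i
  proof -
    have "hinner (v i) p = (\<Sum>j\<in>{1..m}. if i = j then hinner (v j) x else 0)"
      unfolding p_def hinner_sum_right
      by (rule sum.cong) (use v(1) that in \<open>auto simp: onf_def hinner_scale_right\<close>)
    also have "\<dots> = hinner (v i) x" using that by simp
    finally show ?thesis by (simp add: y_def hinner_diff_right)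
  qed
  let ?w = "of_real (1 / norm y) *s y"
  show thesis
  proof
    show "?w \<in> V" by (rule vec.subspace_scale[OF V(1) yV])
    show "norm ?w = 1" unfolding scale_of_real using \<open>y \<noteq> 0\<close> by simp
    show "\<forall>i\<in>{1..m}. hinner (v i) ?w = 0" using perp by (simp add: hinner_scale_right)
  qed
qed

lemma onf_extend_to:
  fixes v :: "nat \<Rightarrow> 'k::real_or_complex ^ 'n"
  assumes v: "onf m v" "\<And>i. i \<in> {1..m} \<Longrightarrow> v i \<in> V" and V: "vec.subspace V"
    and "m \<le> n" "n \<le> vec.dim V"
  obtains w where "onf n w" "\<And>i. i \<in> {1..m} \<Longrightarrow> w i = v i" "\<And>i. i \<in> {1..n} \<Longrightarrow> w i \<in> V"
proof -
  have "n \<le> vec.dim V \<longrightarrow>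
    (\<exists>w. onf n w \<and> (\<forall>i\<in>{1..m}. w i = v i) \<and> (\<forall>i\<in>{1..n}. w i \<in> V))"
    using \<open>m \<le> n\<close>
  proof (induction n rule: dec_induct)
    case base thus ?case using v by auto
  next
    case (step n)
    show ?case
    proof
      assume n: "Suc n \<le> vec.dim V"
      then obtain w where w: "onf n w" "\<forall>i\<in>{1..m}. w i = v i" "\<forall>i\<in>{1..n}. w i \<in> V"
        using step by auto
      obtain u where u: "u \<in> V" "norm u = 1" "\<forall>i\<in>{1..n}. hinner (w i) u = 0"
        using onf_extend[OF w(1) _ V] w(3) n by (metis Suc_le_eq)
      show "\<exists>w. onf (Suc n) w \<and> (\<forall>i\<in>{1..m}. w i = v i) \<and> (\<forall>i\<in>{1..Suc n}. w i \<in> V)"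
        by (rule exI[of _ "w(Suc n := u)"])
          (use w u step onf_Suc[OF w(1) u(2,3)] in \<open>auto simp: le_Suc_eq\<close>)
    qed
  qed
  thus thesis using that \<open>n \<le> vec.dim V\<close> by blast
qed

definition column_matrix :: "(nat \<Rightarrow> 'k ^ 'n) \<Rightarrow> 'k ^ 'n ^ 'n" where
  "column_matrix v = (\<chi> a i. v (coord_pos i) $ a)"

lemma column_matrix_mv:
  "column_matrix v *v x = (\<Sum>i\<in>UNIV. x $ i *s v (coord_pos i))"
  for v :: "nat \<Rightarrow> 'k::real_or_complex ^ 'n"
  by (simp add: vec_eq_iff column_matrix_def matrix_vector_mult_def mult.commute)

lemma unitaryI: "adj U ** U = mat 1 \<Longrightarrow> unitary (U :: 'k::real_or_complex ^ 'n ^ 'n)"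
  using matrix_left_right_inverse[of "adj U" U] by (simp add: unitary_def)

lemma unitary_column_matrix:
  fixes v :: "nat \<Rightarrow> 'k::real_or_complex ^ 'n"
  assumes "onf CARD('n) v" shows "unitary (column_matrix v)"
proof (rule unitaryI)
  have "(adj (column_matrix v) ** column_matrix v) $ i $ j
      = hinner (v (coord_pos i)) (v (coord_pos j))" for i j
    by (simp add: adj_def column_matrix_def matrix_matrix_mult_def hinner_def)
  thus "adj (column_matrix v) ** column_matrix v = mat 1"
    using assms unfolding onf_def by (simp add: vec_eq_iff mat_def)
qed

lemma unitary_adj: "unitary U \<Longrightarrow> unitary (adj U)"
  by (simp add: unitary_def)

lemma unitary_cancel [simp]:
  assumes "unitary U"
  shows "adj U ** U = mat 1" "U ** adj U = mat 1"
    "adj U ** (U ** A) = A" "U ** (adj U ** A) = A"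
    "adj U *v (U *v x) = x" "U *v (adj U *v x) = x"
  using assms by (simp_all add: unitary_def matrix_mul_assoc matrix_vector_mul_assoc)

lemma unitary_mult: "unitary U \<Longrightarrow> unitary W \<Longrightarrow> unitary (U ** W)"
  by (rule unitaryI) (simp add: adj_mult matrix_mul_assoc[symmetric])

lemma norm_unitary [simp]: "unitary U \<Longrightarrow> norm (U *v x) = norm x"
  by (simp add: norm_eq_sqrt_inner inner_adj)

lemma unitary_inj: "unitary U \<Longrightarrow> inj ((*v) U)"
  by (metis injI unitary_cancel(5))

lemma diag_matrix_mult_component: "(diag_matrix s ** A) $ i $ j = of_real (s (coord_pos i)) * A $ i $ j"
  for A :: "'k::real_or_complex ^ 'n ^ 'n"
proof -
  have "(diag_matrix s ** A) $ i $ j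
      = (\<Sum>l\<in>UNIV. if i = l then of_real (s (coord_pos i)) * A $ l $ j else 0)"
    unfolding diag_matrix_def matrix_matrix_mult_def vec_lambda_beta by (rule sum.cong) auto
  thus ?thesis by simp
qed

lemma diag_mv: "(diag_matrix s *v x) $ i = of_real (s (coord_pos i)) * x $ i"
  for x :: "'k::real_or_complex ^ 'n"
proof -
  have "(diag_matrix s *v x) $ i
      = (\<Sum>l\<in>UNIV. if i = l then of_real (s (coord_pos i)) * x $ l else 0)"
    unfolding diag_matrix_def matrix_vector_mult_def vec_lambda_beta by (rule sum.cong) auto
  thus ?thesis by simp
qed

lemma diag_mm: "diag_matrix s ** diag_matrix t
    = (diag_matrix (\<lambda>i. s i * t i) :: 'k::real_or_complex ^ 'n ^ 'n)"
  unfolding vec_eq_iff diag_matrix_mult_component by (simp add: diag_matrix_def)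

lemma adj_diag: "adj (diag_matrix s) = diag_matrix s"
  by (auto simp: vec_eq_iff diag_matrix_def adj_def)

abbreviation std_proj :: "nat \<Rightarrow> 'k::real_or_complex ^ 'n ^ 'n" where
  "std_proj j \<equiv> diag_matrix (\<lambda>i. if i \<le> j then 1 else 0)"

abbreviation std_space :: "nat \<Rightarrow> ('k::real_or_complex ^ 'n) set" where
  "std_space j \<equiv> vec.span {axis i 1 | i. coord_pos i \<le> j}"

lemma std_proj_idem: "std_proj j ** std_proj j = std_proj j"
  unfolding diag_mm by (rule arg_cong[where f = diag_matrix]) auto

lemma trace_std_proj:
  "j \<le> CARD('n) \<Longrightarrow> trace (std_proj j :: 'k::real_or_complex ^ 'n ^ 'n) = of_nat j"
proof -
  assume "j \<le> CARD('n)"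
  have "trace (std_proj j :: 'k ^ 'n ^ 'n) = (\<Sum>i\<in>UNIV. if coord_pos (i :: 'n) \<le> j then 1 else 0)"
    unfolding trace_def diag_matrix_def by (intro sum.cong) auto
  also have "\<dots> = of_nat (card {i :: 'n. coord_pos i \<le> j})"
    by (subst sum.If_cases) simp_all
  finally show ?thesis using card_coord_pos_le[OF \<open>j \<le> CARD('n)\<close>] by simp
qed

lemma std_space_eq: "std_space j = {x :: 'k::real_or_complex ^ 'n. \<forall>i. j < coord_pos i \<longrightarrow> x $ i = 0}"
proof
  show "std_space j \<subseteq> {x :: 'k ^ 'n. \<forall>i. j < coord_pos i \<longrightarrow> x $ i = 0}"
    by (rule vec.span_minimal) (auto simp: axis_def vec.subspace_def)
  show "{x :: 'k ^ 'n. \<forall>i. j < coord_pos i \<longrightarrow> x $ i = 0} \<subseteq> std_space j"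
  proof
    fix x :: "'k ^ 'n" assume x: "x \<in> {x. \<forall>i. j < coord_pos i \<longrightarrow> x $ i = 0}"
    have "(\<Sum>i\<in>UNIV. x $ i *s axis i 1) \<in> std_space j"
    proof (rule vec.span_sum)
      fix i :: 'n
      show "x $ i *s axis i 1 \<in> std_space j"
      proof (cases "coord_pos i \<le> j")
        case True thus ?thesis by (intro vec.span_scale vec.span_base) auto
      next
        case False thus ?thesis using x by (simp add: vec.span_zero)
      qed
    qed
    thus "x \<in> std_space j" by (simp add: basis_expansion)
  qed
qed

lemma range_std_proj: "range ((*v) (std_proj j)) = (std_space j :: ('k::real_or_complex ^ 'n) set)"
proof
  show "range ((*v) (std_proj j)) \<subseteq> (std_space j :: ('k ^ 'n) set)"
    unfolding std_space_eq by (auto simp: diag_mv)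
  show "(std_space j :: ('k ^ 'n) set) \<subseteq> range ((*v) (std_proj j))"
  proof
    fix x :: "'k ^ 'n" assume "x \<in> std_space j"
    hence "x = std_proj j *v x" unfolding std_space_eq by (auto simp: vec_eq_iff diag_mv)
    thus "x \<in> range ((*v) (std_proj j))" by blast
  qed
qed

lemma dim_std_space:
  assumes "j \<le> CARD('n)" shows "vec.dim (std_space j :: ('k::real_or_complex ^ 'n) set) = j"
proof -
  let ?B = "{axis i 1 | i. coord_pos i \<le> j} :: ('k ^ 'n) set"
  have "vec.independent ?B"
    by (rule vec.independent_mono[OF independent_cart_basis]) (auto simp: cart_basis_def)
  moreover have "card ?B = j"
  proof -
    have "?B = (\<lambda>i. axis i 1) ` {i. coord_pos i \<le> j}" by auto
    moreover have "inj_on (\<lambda>i. axis i 1 :: 'k ^ 'n) {i. coord_pos i \<le> j}"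
      by (auto simp: inj_on_def axis_eq_axis)
    ultimately show ?thesis using card_coord_pos_le[OF assms] by (simp add: card_image)
  qed
  ultimately show ?thesis by (simp add: vec.dim_eq_card_independent)
qed

lemma dim_image_inj: "inj ((*v) A) \<Longrightarrow> vec.dim ((*v) A ` V) = vec.dim V"
  for A :: "'k::real_or_complex ^ 'n ^ 'n"
  by (rule vec.dim_image_eq[OF matrix_vector_mul_linear_gen]) (auto simp: inj_on_def)

lemma Gr_le: "V \<in> Gr j \<Longrightarrow> j \<le> CARD('n)" for V :: "('k::real_or_complex ^ 'n) set"
  using vec.dim_subset[of V UNIV] unfolding vec_dim_card by (auto simp: Gr_def)

lemma Gr_image: "inj ((*v) A) \<Longrightarrow> V \<in> Gr j \<Longrightarrow> (*v) A ` V \<in> Gr j"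
  for A :: "'k::real_or_complex ^ 'n ^ 'n"
  unfolding Gr_def by (simp add: dim_image_inj vec.subspace_image)

lemma std_space_Gr: "j \<le> CARD('n) \<Longrightarrow> (std_space j :: ('k::real_or_complex ^ 'n) set) \<in> Gr j"
  unfolding Gr_def by (simp add: dim_std_space del: vec.dim_span)

text \<open>
  The unitary group acts transitively on each Grassmannian. Every statement about the projection onto a
  subspace thus reduces to the coordinate projections.
\<close>

lemma Gr_unitary_std:
  fixes V :: "('k::real_or_complex ^ 'n) set"
  assumes V: "V \<in> Gr j"
  obtains L where "unitary L" "V = (*v) L ` std_space j"
proof -
  have sub: "vec.subspace V" and dim: "vec.dim V = j" using V by (auto simp: Gr_def)
  obtain v where v: "onf j v" "\<And>i. i \<in> {1..j} \<Longrightarrow> v i \<in> V"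
    using onf_extend_to[of 0 "\<lambda>_. 0" V j] sub dim by (auto simp: onf_def)
  obtain w where w: "onf CARD('n) w" "\<And>i. i \<in> {1..j} \<Longrightarrow> w i = v i"
    using onf_extend_to[OF v(1), of UNIV "CARD('n)"] Gr_le[OF V] unfolding vec_dim_card by auto
  let ?L = "column_matrix w"
  have L: "unitary ?L" by (rule unitary_column_matrix) fact
  have LG: "(*v) ?L ` std_space j \<in> Gr j"
    by (rule Gr_image[OF unitary_inj[OF L] std_space_Gr[OF Gr_le[OF V]]])
  have "(*v) ?L ` std_space j \<subseteq> V"
  proof safe
    fix x :: "'k ^ 'n" assume x: "x \<in> std_space j"
    show "?L *v x \<in> V"
      unfolding column_matrix_mv
    proof (rule vec.subspace_sum[OF sub])
      fix i :: 'n
      show "x $ i *s w (coord_pos i) \<in> V"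
      proof (cases "coord_pos i \<le> j")
        case True
        hence "w (coord_pos i) \<in> V" using w(2)[of "coord_pos i"] v(2)[of "coord_pos i"] by simp
        thus ?thesis by (rule vec.subspace_scale[OF sub])
      next
        case False thus ?thesis using x sub by (simp add: std_space_eq vec.subspace_0)
      qed
    qed
  qed
  hence "(*v) ?L ` std_space j = V"
    using LG V by (intro vec.subspace_dim_equal) (auto simp: Gr_def)
  thus thesis using that L by blast
qed

definition orth_proj :: "'k::real_or_complex ^ 'n ^ 'n \<Rightarrow> bool" where
  "orth_proj P \<longleftrightarrow> adj P = P \<and> P ** P = P"

lemma orth_proj_adj: "orth_proj P \<Longrightarrow> adj P = P"
  and orth_proj_idem: "orth_proj P \<Longrightarrow> P ** P = P"
  and orth_proj_idem2: "orth_proj P \<Longrightarrow> P ** (P ** A) = P ** A"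
  and orth_proj_idem_mv: "orth_proj P \<Longrightarrow> P *v (P *v x) = P *v x"
  by (simp_all add: orth_proj_def matrix_vector_mul_assoc matrix_mul_assoc)

lemma range_orth_proj_iff: "orth_proj P \<Longrightarrow> x \<in> range ((*v) P) \<longleftrightarrow> P *v x = x"
  by (metis orth_proj_idem_mv rangeE rangeI)

lemma orth_proj_unique:
  assumes "orth_proj P" "orth_proj Q" "range ((*v) P) = range ((*v) Q)"
  shows "P = Q"
proof -
  have "P ** Q = Q"
  proof (rule matrix_eqI)
    fix x
    show "P ** Q *v x = Q *v x"
      using assms range_orth_proj_iff[OF assms(1), of "Q *v x"] by (auto simp: matrix_vector_mul_assoc)
  qed
  moreover have "Q ** P = P"
  proof (rule matrix_eqI)
    fix x
    show "Q ** P *v x = P *v x"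
      using assms range_orth_proj_iff[OF assms(2), of "P *v x"] by (auto simp: matrix_vector_mul_assoc)
  qed
  ultimately show ?thesis
    by (metis adj_mult assms(1,2) orth_proj_adj)
qed

lemma proj_matrix_eqI:
  assumes "orth_proj P" "range ((*v) P) = V" shows "proj_matrix V = P"
  unfolding proj_matrix_def
proof (rule the_equality)
  show "adj P = P \<and> P ** P = P \<and> range ((*v) P) = V" using assms by (simp add: orth_proj_def)
next
  fix Q assume "adj Q = Q \<and> Q ** Q = Q \<and> range ((*v) Q) = V"
  thus "Q = P" using orth_proj_unique[of Q P] assms by (simp add: orth_proj_def)
qed

lemma orth_proj_std: "orth_proj (std_proj j)"
  by (simp add: orth_proj_def adj_diag std_proj_idem)

lemma orth_proj_conj: "unitary L \<Longrightarrow> orth_proj P \<Longrightarrow> orth_proj (L ** P ** adj L)"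
  unfolding orth_proj_def[of "L ** P ** adj L"]
  by (simp add: adj_mult matrix_mul_assoc[symmetric] orth_proj_adj orth_proj_idem2)

lemma range_conj: "unitary L \<Longrightarrow> range ((*v) (L ** P ** adj L)) = (*v) L ` range ((*v) P)"
proof -
  assume L: "unitary L"
  have "range ((*v) (adj L)) = UNIV"
    by (rule surjI[where f = "(*v) L"]) (simp add: L)
  hence "(*v) L ` (range ((*v) P)) = (*v) L ` ((*v) P ` range ((*v) (adj L)))" by simp
  also have "\<dots> = range ((*v) (L ** P ** adj L))"
    by (auto simp: matrix_vector_mul_assoc image_image matrix_mul_assoc)
  finally show ?thesis by simp
qed

lemma trace_conj: "unitary L \<Longrightarrow> trace (L ** P ** adj L) = trace P"
  by (subst trace_mul_sym) simp

lemma proj_matrix_unitary_std: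
  "unitary L \<Longrightarrow> proj_matrix ((*v) L ` std_space j) = L ** std_proj j ** adj L"
  by (rule proj_matrix_eqI) (simp_all add: orth_proj_conj orth_proj_std range_conj range_std_proj)

lemma
  fixes V :: "('k::real_or_complex ^ 'n) set"
  assumes V: "V \<in> Gr j"
  shows orth_proj_proj_matrix: "orth_proj (proj_matrix V)"
    and range_proj_matrix: "range ((*v) (proj_matrix V)) = V"
    and trace_proj_matrix: "trace (proj_matrix V) = of_nat j"
proof -
  obtain L where L: "unitary L" "V = (*v) L ` std_space j" using Gr_unitary_std[OF V] .
  have eq: "proj_matrix V = L ** std_proj j ** adj L"
    unfolding L(2) by (rule proj_matrix_unitary_std) fact
  show "orth_proj (proj_matrix V)" unfolding eq by (intro orth_proj_conj L orth_proj_std)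
  show "range ((*v) (proj_matrix V)) = V"
    unfolding eq range_conj[OF L(1)] range_std_proj by (simp add: L(2))
  show "trace (proj_matrix V) = of_nat j"
    unfolding eq trace_conj[OF L(1)] by (rule trace_std_proj[OF Gr_le[OF V]])
qed

lemma proj_matrix_mv_iff: "V \<in> Gr j \<Longrightarrow> x \<in> V \<longleftrightarrow> proj_matrix V *v x = x"
  using range_orth_proj_iff[OF orth_proj_proj_matrix, of V j x] range_proj_matrix[of V j] by simp

text \<open>
  The trace recovers the dimension, so that a Grassmannian is cut out by closed conditions on matrices.
\<close>

lemma orth_proj_range_Gr:
  fixes P :: "'k::real_or_complex ^ 'n ^ 'n"
  assumes P: "orth_proj P" "trace P = of_nat j"
  shows "range ((*v) P) \<in> Gr j" "proj_matrix (range ((*v) P)) = P"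
proof -
  show eq: "proj_matrix (range ((*v) P)) = P" by (rule proj_matrix_eqI) (simp_all add: P)
  have "range ((*v) P) \<in> Gr (vec.dim (range ((*v) P)))"
    unfolding Gr_def by (simp add: vec.subspace_image)
  moreover from trace_proj_matrix[OF this] have "vec.dim (range ((*v) P)) = j"
    using P(2) eq by simp
  ultimately show "range ((*v) P) \<in> Gr j" by simp
qed

text \<open>
  Both sides equal \<open>2 (trace Q - trace (P ** Q))\<close>. Hence it is enough to show that one of two subspaces
  of equal dimension is close to the other, which is a one-sided condition.
\<close>

lemma norm_proj_diff:
  fixes P Q :: "'k::real_or_complex ^ 'n ^ 'n"
  assumes P: "orth_proj P" and Q: "orth_proj Q" and tr: "trace P = trace Q"
  shows "(norm (Q - P))\<^sup>2 = 2 * (norm (Q - P ** Q))\<^sup>2"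
proof -
  note s = orth_proj_adj[OF P] orth_proj_idem[OF P] orth_proj_idem2[OF P]
    orth_proj_adj[OF Q] orth_proj_idem[OF Q] orth_proj_idem2[OF Q]
  have "of_real ((norm (Q - P))\<^sup>2) = trace (adj (Q - P) ** (Q - P))"
    by (rule trace_adj_mult_self[symmetric])
  also have "adj (Q - P) ** (Q - P) = Q - P ** Q - (Q ** P - P)"
    by (simp add: s adj_diff mm.diff_left mm.diff_right)
  also have "trace \<dots> = 2 * (trace Q - trace (P ** Q))"
    using tr trace_mul_sym[of Q P] by (simp add: trace_sub)
  finally have 1: "of_real ((norm (Q - P))\<^sup>2) = 2 * (trace Q - trace (P ** Q))" .
  have "of_real ((norm (Q - P ** Q))\<^sup>2) = trace (adj (Q - P ** Q) ** (Q - P ** Q))"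
    by (rule trace_adj_mult_self[symmetric])
  also have "adj (Q - P ** Q) ** (Q - P ** Q) = Q - Q ** (P ** Q)"
    by (simp add: s adj_diff adj_mult mm.diff_left mm.diff_right matrix_mul_assoc[symmetric])
  also have "trace \<dots> = trace Q - trace (P ** Q)"
    using trace_mul_sym[of Q "P ** Q"] by (simp add: s trace_sub matrix_mul_assoc[symmetric])
  finally have "(of_real ((norm (Q - P))\<^sup>2) :: 'k) = of_real (2 * (norm (Q - P ** Q))\<^sup>2)"
    using 1 by simp
  thus ?thesis by (simp only: of_real_eq_iff)
qed

lemma norm_orth_proj_pyth:
  assumes "orth_proj P" shows "(norm x)\<^sup>2 = (norm (P *v x))\<^sup>2 + (norm (x - P *v x))\<^sup>2"
proof -
  have "(P *v x) \<bullet> (x - P *v x) = 0"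
    by (simp add: inner_adj orth_proj_adj[OF assms] mv.diff_right orth_proj_idem_mv[OF assms])
  thus ?thesis
    using norm_add_Pythagorean[of "P *v x" "x - P *v x"] by (simp add: orthogonal_def)
qed

lemma norm_orth_proj_le: "orth_proj P \<Longrightarrow> norm (P *v x) \<le> norm x"
  using norm_orth_proj_pyth[of P x] by (simp add: power2_le_imp_le)

lemma norm_le_of_mv:
  fixes A :: "'k::real_or_complex ^ 'n ^ 'n"
  assumes "\<And>x. norm (A *v x) \<le> c * norm x" "0 \<le> c"
  shows "norm A \<le> sqrt CARD('n) * c"
proof (rule power2_le_imp_le)
  have "(norm A)\<^sup>2 \<le> (\<Sum>j\<in>(UNIV::'n set). c\<^sup>2)"
    unfolding norm_mat_columns
  proof (intro sum_mono power_mono)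
    fix j :: 'n
    have "(norm (axis j 1 :: 'k ^ 'n))\<^sup>2 = (\<Sum>i\<in>(UNIV::'n set). if i = j then 1 else 0)"
      unfolding norm_vec_sq by (rule sum.cong) (auto simp: axis_def)
    hence "norm (axis j 1 :: 'k ^ 'n) = 1" by (simp add: abs_square_eq_1)
    with assms(1)[of "axis j 1"] show "norm (A *v axis j 1) \<le> c" by simp
  qed simp
  thus "(norm A)\<^sup>2 \<le> (sqrt CARD('n) * c)\<^sup>2" by (simp add: power_mult_distrib)
qed (simp add: assms)

lemma norm_orth_proj: "orth_proj P \<Longrightarrow> norm P \<le> sqrt CARD('n)"
  for P :: "'k::real_or_complex ^ 'n ^ 'n"
  using norm_le_of_mv[of P 1] norm_orth_proj_le[of P] by simp

lemma orth_proj_compl: "orth_proj P \<Longrightarrow> orth_proj (mat 1 - P)"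
  by (simp add: orth_proj_def adj_diff mm.diff_left mm.diff_right)

section \<open>Singular value decompositions\<close>

lemma norm_add_sq: "(norm (a + b))\<^sup>2 = (norm a)\<^sup>2 + (norm b)\<^sup>2 + 2 * (a \<bullet> b)"
  by (simp add: power2_norm_eq_inner inner_add inner_commute)

text \<open>
  The first order condition at a maximum of \<open>norm (A *v w) / norm w\<close>: if the two images were not
  orthogonal, then a small step from \<open>v\<close> in the direction of \<open>y\<close>, with a suitable phase, would
  increase the quotient.
\<close>

lemma hinner_zero_of_maximal:
  fixes A :: "'k::real_or_complex ^ 'n ^ 'n"
  assumes v: "norm v = 1" and y: "norm y = 1" and vy: "hinner v y = 0"
    and max: "\<And>c. norm (A *v (v + c *s y)) \<le> norm (A *v v) * norm (v + c *s y)"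
  shows "hinner (A *v v) (A *v y) = 0"
proof (rule ccontr)
  define h where "h = hinner (A *v v) (A *v y)"
  define s where "s = (norm (A *v v))\<^sup>2"
  assume "hinner (A *v v) (A *v y) \<noteq> 0"
  hence h: "norm h > 0" by (simp add: h_def)
  have s: "s \<ge> 0" by (simp add: s_def)
  have dot: "u \<bullet> (cnjg (hinner u w) *s w) = (norm (hinner u w))\<^sup>2" for u w :: "'k ^ 'n"
  proof -
    have "of_real (2 * (u \<bullet> (cnjg (hinner u w) *s w)))
        = cnjg (hinner u w) * hinner u w + hinner u w * hinner w u"
      by (simp only: hinner_re[symmetric] hinner_scale_left hinner_scale_right cnjg_cnjg)
    also have "\<dots> = cnjg (hinner u w) * hinner u w + cnjg (hinner u w) * hinner u w"
      by (simp add: hinner_commute[of w u] mult.commute)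
    also have "\<dots> = of_real (2 * (norm (hinner u w))\<^sup>2)"
      by (simp only: cnjg_mult_self' of_real_add[symmetric]) simp
    finally show ?thesis by (simp only: of_real_eq_iff)
  qed
  have vy': "v \<bullet> (c *s y) = 0" for c
  proof -
    have "of_real (2 * (v \<bullet> (c *s y))) = (0::'k)"
      unfolding hinner_re[symmetric] hinner_scale_left hinner_scale_right
      using vy hinner_commute[of y v] by simp
    thus ?thesis by (simp only: of_real_eq_0_iff)
  qed
  \<comment> \<open>Any positive \<open>t\<close> with \<open>s * t < 2\<close> contradicts maximality below.\<close>
  define t where "t = 1 / (s + 1)"
  have t: "t > 0" using s by (simp add: t_def)
  \<comment> \<open>The phase makes the cross term of the expanded square positive.\<close>
  define c where "c = of_real t * cnjg h"
  have nc: "(norm c)\<^sup>2 = t\<^sup>2 * (norm h)\<^sup>2" by (simp add: c_def norm_mult power_mult_distrib)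
  have "s + 2 * (t * (norm h)\<^sup>2) \<le> (norm (A *v (v + c *s y)))\<^sup>2"
  proof -
    have "A *v (v + c *s y) = A *v v + c *s (A *v y)"
      by (simp add: mv.add_right vec.scale)
    also have "(norm \<dots>)\<^sup>2 = s + (norm (c *s (A *v y)))\<^sup>2 + 2 * ((A *v v) \<bullet> (c *s (A *v y)))"
      unfolding norm_add_sq s_def ..
    also have "(A *v v) \<bullet> (c *s (A *v y)) = t * (norm h)\<^sup>2"
    proof -
      have "c *s (A *v y) = t *\<^sub>R (cnjg h *s (A *v y))"
        by (simp add: c_def scale_of_real[symmetric])
      thus ?thesis using dot[of "A *v v" "A *v y"] by (simp add: h_def)
    qed
    finally show ?thesis by simp
  qed
  also have "\<dots> \<le> (norm (A *v v) * norm (v + c *s y))\<^sup>2"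
    by (intro power_mono max) simp
  also have "\<dots> = s * (1 + t\<^sup>2 * (norm h)\<^sup>2)"
  proof -
    have "(norm (v + c *s y))\<^sup>2 = 1 + (norm c)\<^sup>2"
      unfolding norm_add_sq using v y vy'[of c] by (simp add: norm_scale)
    thus ?thesis by (simp add: power_mult_distrib s_def nc)
  qed
  finally have "2 * t * (norm h)\<^sup>2 \<le> (s * t) * t * (norm h)\<^sup>2"
    by (simp add: algebra_simps power2_eq_square)
  hence "2 * t \<le> (s * t) * t" by (rule mult_right_le_imp_le) (use h in simp)
  hence "2 \<le> s * t" using t by simp
  thus False using s by (simp add: t_def field_simps)
qed

text \<open>
  Successive maximisation over the unit spheres of the remaining orthogonal complements produces right
  singular vectors.
\<close>

lemma greedy_onf:
  fixes A :: "'k::real_or_complex ^ 'n ^ 'n"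
  assumes "m \<le> CARD('n)"
  obtains v where "onf m v"
    "\<And>i w. \<lbrakk>i \<in> {1..m}; norm w = 1; \<forall>l\<in>{1..<i}. hinner (v l) w = 0\<rbrakk> \<Longrightarrow> norm (A *v w) \<le> norm (A *v v i)"
proof -
  have "m \<le> CARD('n) \<longrightarrow> (\<exists>v. onf m v \<and> (\<forall>i\<in>{1..m}. \<forall>w. norm w = 1 \<and> (\<forall>l\<in>{1..<i}. hinner (v l) w = 0)
      \<longrightarrow> norm (A *v w) \<le> norm (A *v v i)))"
  proof (induction m)
    case 0 show ?case by (simp add: onf_def)
  next
    case (Suc m)
    show ?case
    proof
      assume m: "Suc m \<le> CARD('n)"
      with Suc obtain v where v: "onf m v" and mx: "\<forall>i\<in>{1..m}. \<forall>w. norm w = 1 \<and>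
          (\<forall>l\<in>{1..<i}. hinner (v l) w = 0) \<longrightarrow> norm (A *v w) \<le> norm (A *v v i)"
        by auto
      define S where "S = sphere 0 1 \<inter> (\<Inter>l\<in>{1..m}. {w. hinner (v l) w = 0})"
      have "compact S"
        unfolding S_def hinner_def
        by (intro compact_Int_closed compact_sphere closed_INT ballI closed_Collect_eq continuous_intros)
      moreover have "S \<noteq> {}"
      proof -
        have "m < vec.dim (UNIV :: ('k ^ 'n) set)" using m unfolding vec_dim_card by simp
        then obtain w where "norm w = 1" "\<forall>i\<in>{1..m}. hinner (v i) w = 0"
          using onf_extend[OF v, of UNIV] vec.subspace_UNIV by (metis UNIV_I)
        hence "w \<in> S" unfolding S_def by simp
        thus ?thesis by blast
      qed
      moreover have "continuous_on S (\<lambda>w. norm (A *v w))"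
        by (intro continuous_on_norm mv.continuous_on continuous_on_const continuous_on_id)
      ultimately obtain u where u: "u \<in> S" "\<And>w. w \<in> S \<Longrightarrow> norm (A *v w) \<le> norm (A *v u)"
        using continuous_attains_sup[of S "\<lambda>w. norm (A *v w)"] by blast
      have uS: "norm u = 1" "\<forall>i\<in>{1..m}. hinner (v i) u = 0" using u(1) by (auto simp: S_def)
      have "norm (A *v w) \<le> norm (A *v ((v(Suc m := u)) i))"
        if i: "i \<in> {1..Suc m}" and w: "norm w = 1" "\<forall>l\<in>{1..<i}. hinner ((v(Suc m := u)) l) w = 0" for i w
      proof (cases "i = Suc m")
        case True
        hence "w \<in> S" using w unfolding S_def by auto
        thus ?thesis using u(2) True by simp
      next
        case False
        thus ?thesis using mx i w by auto
      qed
      thus "\<exists>v. onf (Suc m) v \<and> (\<forall>i\<in>{1..Suc m}. \<forall>w. norm w = 1 \<and> (\<forall>l\<in>{1..<i}. hinner (v l) w = 0)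
          \<longrightarrow> norm (A *v w) \<le> norm (A *v v i))"
        using onf_Suc[OF v uS] by blast
    qed
  qed
  thus thesis using that assms by blast
qed

lemma invertible_inj: "invertible A \<Longrightarrow> A *v x = 0 \<Longrightarrow> x = 0" for A :: "'k::real_or_complex ^ 'n ^ 'n"
  using matrix_left_invertible_ker[of A] invertible_left_inverse[of A] by simp

text \<open>
  The images of the greedily chosen vectors are pairwise orthogonal, and normalising them gives the left
  singular vectors.
\<close>

lemma svd_exists:
  fixes A :: "'k::real_or_complex ^ 'n ^ 'n"
  assumes A: "invertible A"
  obtains L s M where "svd A L s M"
proof -
  obtain v where v: "onf CARD('n) v" and mx: "\<And>i w. \<lbrakk>i \<in> {1..CARD('n)}; norm w = 1;
      \<forall>l\<in>{1..<i}. hinner (v l) w = 0\<rbrakk> \<Longrightarrow> norm (A *v w) \<le> norm (A *v v i)"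
    using greedy_onf[of "CARD('n)" A] by blast
  define s where "s i = norm (A *v v i)" for i
  have nv: "norm (v i) = 1" if "i \<in> {1..CARD('n)}" for i
  proof -
    have "hinner (v i) (v i) = 1" using v that unfolding onf_def by auto
    hence "(of_real ((norm (v i))\<^sup>2) :: 'k) = of_real 1" unfolding hinner_self by simp
    hence "(norm (v i))\<^sup>2 = 1" by (simp only: of_real_eq_iff)
    thus ?thesis by (simp add: abs_square_eq_1)
  qed
  have perp: "hinner (v i) (v j) = 0" if "i \<in> {1..CARD('n)}" "j \<in> {1..CARD('n)}" "i \<noteq> j" for i j
    using v that unfolding onf_def by auto
  have pos: "s i > 0" if "i \<in> {1..CARD('n)}" for i
    using nv[OF that] invertible_inj[OF A, of "v i"] by (auto simp: s_def)
  have dec: "s j \<le> s i" if "i \<in> {1..CARD('n)}" "j \<in> {1..CARD('n)}" "i \<le> j" for i j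
    unfolding s_def using that by (intro mx nv) (auto intro!: perp)
  have mx': "norm (A *v w) \<le> norm (A *v v i) * norm w"
    if i: "i \<in> {1..CARD('n)}" and w: "\<forall>l\<in>{1..<i}. hinner (v l) w = 0" for i w
  proof (cases "w = 0")
    case False
    define u where "u = of_real (1 / norm w) *s w"
    have "norm u = 1" unfolding u_def scale_of_real using False by simp
    moreover have "\<forall>l\<in>{1..<i}. hinner (v l) u = 0"
      using w by (simp add: u_def hinner_scale_right)
    ultimately have "norm (A *v u) \<le> norm (A *v v i)" by (rule mx[OF i])
    moreover have "A *v u = (1 / norm w) *\<^sub>R (A *v w)"
      unfolding u_def scale_of_real by (rule mv.scaleR_right)
    ultimately show ?thesis using False by (simp add: field_simps)
  qed simp
  have Aperp: "hinner (A *v v i) (A *v v j) = 0"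
    if "i \<in> {1..CARD('n)}" "j \<in> {1..CARD('n)}" "i < j" for i j
  proof (rule hinner_zero_of_maximal)
    fix c
    show "norm (A *v (v i + c *s v j)) \<le> norm (A *v v i) * norm (v i + c *s v j)"
      by (rule mx') (use that in \<open>auto simp: hinner_add_right hinner_scale_right perp\<close>)
  qed (use that in \<open>auto simp: nv perp\<close>)
  have Aperp': "hinner (A *v v i) (A *v v j) = (if i = j then of_real ((s i)\<^sup>2) else 0)"
    if "i \<in> {1..CARD('n)}" "j \<in> {1..CARD('n)}" for i j
  proof -
    consider "i < j" | "j < i" | "i = j" by linarith
    thus ?thesis
    proof cases
      case 1 thus ?thesis using Aperp that by simp
    next
      case 2 thus ?thesis using Aperp[OF that(2,1)] hinner_commute[of "A *v v i" "A *v v j"] by simp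
    next
      case 3 thus ?thesis by (simp only: hinner_self s_def) simp
    qed
  qed
  define u where "u i = of_real (1 / s i) *s (A *v v i)" for i
  have u: "onf CARD('n) u"
    unfolding onf_def
  proof (intro ballI)
    fix i j assume ij: "i \<in> {1..CARD('n)}" "j \<in> {1..CARD('n)}"
    have "hinner (u i) (u j) = of_real (1 / s i * (1 / s j)) * hinner (A *v v i) (A *v v j)"
      by (simp only: u_def hinner_scale_left hinner_scale_right cnjg_of_real of_real_mult mult_ac)
    also have "\<dots> = (if i = j then 1 else 0)"
      using pos[OF ij(1)] unfolding Aperp'[OF ij] by (auto simp: power2_eq_square)
    finally show "hinner (u i) (u j) = (if i = j then 1 else 0)" .
  qed
  let ?L = "column_matrix u" and ?V = "column_matrix v"
  have L: "unitary ?L" and V: "unitary ?V" by (rule unitary_column_matrix, fact)+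
  have "A ** ?V = ?L ** diag_matrix s"
  proof (rule matrix_eqI)
    fix x
    have "A ** ?V *v x = (\<Sum>i\<in>UNIV. x $ i *s (A *v v (coord_pos i)))"
      by (simp add: matrix_vector_mul_assoc[symmetric] column_matrix_mv vec.scale mv.sum_right)
    also have "\<dots> = (\<Sum>i\<in>UNIV. (of_real (s (coord_pos i)) * x $ i) *s u (coord_pos i))"
    proof (rule sum.cong)
      fix i :: 'n
      show "x $ i *s (A *v v (coord_pos i)) = (of_real (s (coord_pos i)) * x $ i) *s u (coord_pos i)"
        using pos[OF coord_pos_in[of i]] by (simp add: u_def)
    qed simp
    also have "\<dots> = ?L ** diag_matrix s *v x"
      by (simp add: matrix_vector_mul_assoc[symmetric] column_matrix_mv diag_mv)
    finally show "A ** ?V *v x = ?L ** diag_matrix s *v x" .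
  qed
  hence "A ** ?V ** adj ?V = ?L ** diag_matrix s ** adj ?V" by simp
  hence "A = ?L ** diag_matrix s ** adj ?V" using V by (simp add: matrix_mul_assoc[symmetric])
  hence "svd A ?L s (adj ?V)"
    unfolding svd_def using L V unitary_adj pos dec by blast
  thus thesis by (rule that)
qed

lemma
  assumes "svd (A :: 'k::real_or_complex ^ 'n ^ 'n) L s M"
  shows svd_unitary: "unitary L" "unitary M"
    and svd_eq: "A = L ** diag_matrix s ** M"
    and svd_pos: "i \<in> {1..CARD('n)} \<Longrightarrow> 0 < s i"
    and svd_mono: "\<lbrakk>i \<in> {1..CARD('n)}; l \<in> {1..CARD('n)}; i \<le> l\<rbrakk> \<Longrightarrow> s l \<le> s i"
  using assms unfolding svd_def by blast+

lemma norm_svd: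
  assumes "svd A L s M"
  shows "(norm (A *v x))\<^sup>2 = (\<Sum>i\<in>UNIV. (s (coord_pos i))\<^sup>2 * (norm ((M *v x) $ i))\<^sup>2)"
proof -
  have "A *v x = L *v (diag_matrix s *v (M *v x))"
    by (simp add: svd_eq[OF assms] matrix_vector_mul_assoc matrix_mul_assoc)
  hence "(norm (A *v x))\<^sup>2 = (norm (diag_matrix s *v (M *v x)))\<^sup>2"
    using svd_unitary[OF assms] by simp
  thus ?thesis by (simp add: norm_vec_sq diag_mv norm_mult power_mult_distrib)
qed

lemma svd_upper:
  assumes "svd A L s M" "0 \<le> c" "\<And>i. (M *v x) $ i \<noteq> 0 \<Longrightarrow> s (coord_pos i) \<le> c"
  shows "norm (A *v x) \<le> c * norm x"
proof (rule power2_le_imp_le)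
  have "(norm (A *v x))\<^sup>2 \<le> (\<Sum>i\<in>UNIV. c\<^sup>2 * (norm ((M *v x) $ i))\<^sup>2)"
    unfolding norm_svd[OF assms(1)]
  proof (rule sum_mono)
    fix i
    show "(s (coord_pos i))\<^sup>2 * (norm ((M *v x) $ i))\<^sup>2 \<le> c\<^sup>2 * (norm ((M *v x) $ i))\<^sup>2"
    proof (cases "(M *v x) $ i = 0")
      case False
      thus ?thesis using assms(3)[OF False] svd_pos[OF assms(1) coord_pos_in[of i]]
        by (intro mult_right_mono power_mono) auto
    qed simp
  qed
  also have "\<dots> = (c * norm (M *v x))\<^sup>2"
    by (simp add: norm_vec_sq power_mult_distrib sum_distrib_left)
  finally show "(norm (A *v x))\<^sup>2 \<le> (c * norm x)\<^sup>2" using svd_unitary[OF assms(1)] by simp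
qed (use assms in simp)

lemma svd_lower:
  assumes "svd A L s M" "0 \<le> c" "\<And>i. (M *v x) $ i \<noteq> 0 \<Longrightarrow> c \<le> s (coord_pos i)"
  shows "c * norm x \<le> norm (A *v x)"
proof (rule power2_le_imp_le)
  have "(c * norm x)\<^sup>2 = (\<Sum>i\<in>UNIV. c\<^sup>2 * (norm ((M *v x) $ i))\<^sup>2)"
    using norm_unitary[OF svd_unitary(2)[OF assms(1)], of x]
    by (simp add: norm_vec_sq[symmetric] power_mult_distrib sum_distrib_left[symmetric])
  also have "\<dots> \<le> (norm (A *v x))\<^sup>2"
    unfolding norm_svd[OF assms(1)]
  proof (rule sum_mono)
    fix i
    show "c\<^sup>2 * (norm ((M *v x) $ i))\<^sup>2 \<le> (s (coord_pos i))\<^sup>2 * (norm ((M *v x) $ i))\<^sup>2"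
    proof (cases "(M *v x) $ i = 0")
      case False
      thus ?thesis using assms(2) assms(3)[OF False]
        by (intro mult_right_mono power_mono) auto
    qed simp
  qed
  finally show "(c * norm x)\<^sup>2 \<le> (norm (A *v x))\<^sup>2" .
qed simp

text \<open>
  The argument of Courant and Fischer. The vectors that avoid the first \<open>j - 1\<close> singular directions of
  \<open>A\<close> and the last \<open>d - j\<close> of \<open>B\<close> are the kernel of \<open>d - 1\<close> linear forms, so one of
  them is nonzero; it is stretched at most by \<open>s j\<close> and at least by \<open>s' j\<close>.
\<close>

lemma svd_values_le:
  fixes A B :: "'k::real_or_complex ^ 'n ^ 'n"
  assumes A: "svd A L s M" and B: "svd B L' s' M'"
    and eq: "\<And>x. norm (A *v x) = norm (B *v x)" and j: "j \<in> {1..CARD('n)}"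
  shows "s' j \<le> s j"
proof -
  obtain l :: 'n where l: "coord_pos l = j" using coord_pos_surj[OF j] .
  define C :: "'k ^ 'n ^ 'n" where
    "C = (\<chi> i. if i = l then 0 else if coord_pos i < j then M $ i else M' $ i)"
  have "det C = 0" unfolding C_def by (rule det_row_0)
  hence "\<not> invertible C" by (simp add: invertible_det_nz)
  then obtain x where x: "C *v x = 0" "x \<noteq> 0"
    unfolding invertible_left_inverse matrix_left_invertible_ker by auto
  have Cx: "(\<Sum>k\<in>UNIV. C $ i $ k * x $ k) = 0" for i
    using x(1) by (simp add: vec_eq_iff matrix_vector_mult_def)
  have 1: "(M *v x) $ i = 0" if "coord_pos i < j" for i
  proof -
    have "C $ i = M $ i" using that l by (auto simp: C_def)
    thus ?thesis using Cx[of i] by (simp add: matrix_vector_mult_def)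
  qed
  have 2: "(M' *v x) $ i = 0" if "j < coord_pos i" for i
  proof -
    have "C $ i = M' $ i" using that l by (auto simp: C_def)
    thus ?thesis using Cx[of i] by (simp add: matrix_vector_mult_def)
  qed
  have "norm (A *v x) \<le> s j * norm x"
    by (rule svd_upper[OF A]) (use svd_pos[OF A j] svd_mono[OF A j coord_pos_in] 1 in \<open>auto simp:
        not_less[symmetric]\<close>)
  moreover have "s' j * norm x \<le> norm (B *v x)"
    by (rule svd_lower[OF B]) (use svd_pos[OF B j] svd_mono[OF B coord_pos_in j] 2 in \<open>auto simp:
        not_less[symmetric]\<close>)
  ultimately show ?thesis using x(2) eq[of x] by (metis mult_right_le_imp_le order_trans
      zero_less_norm_iff)
qed

lemma diag_matrix_cong:
  "(\<And>i. i \<in> {1..CARD('n)} \<Longrightarrow> s i = t i) \<Longrightarrow> diag_matrix s = (diag_matrix t :: 'k::real_or_complex ^ 'n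
      ^ 'n)"
  by (simp add: diag_matrix_def vec_eq_iff)

lemma mult_diag_component: "(A ** diag_matrix s) $ i $ j = A $ i $ j * of_real (s (coord_pos j))"
  for A :: "'k::real_or_complex ^ 'n ^ 'n"
proof -
  have "(A ** diag_matrix s) $ i $ j
      = (\<Sum>l\<in>UNIV. if l = j then A $ i $ j * of_real (s (coord_pos j)) else 0)"
    unfolding diag_matrix_def matrix_matrix_mult_def vec_lambda_beta by (rule sum.cong) auto
  thus ?thesis by simp
qed

text \<open>
  The unitary matrix \<open>T = adj L' ** L\<close> commutes with the diagonal matrix of the squared singular values.
  By the gap after position \<open>j\<close> its entries that link the first \<open>j\<close> coordinates with the others
  vanish, so \<open>T\<close> commutes with the coordinate projection.
\<close>

lemma svd_left_space_unique:
  fixes A B :: "'k::real_or_complex ^ 'n ^ 'n"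
  assumes A: "svd A L s M" and B: "svd B L' s' M'"
    and eq: "\<And>x. norm (A *v x) = norm (B *v x)" and eq': "A ** adj A = B ** adj B"
    and j: "0 < j" "j < CARD('n)" "s (Suc j) < s j"
  shows "L ** std_proj j ** adj L = L' ** std_proj j ** adj L'"
proof -
  note U = svd_unitary[OF A] svd_unitary[OF B]
  have ss: "s' i = s i" if "i \<in> {1..CARD('n)}" for i
    using svd_values_le[OF A B eq that] svd_values_le[OF B A eq[symmetric] that] by simp
  define T where "T = adj L' ** L"
  have "A ** adj A = L ** diag_matrix (\<lambda>i. s i * s i) ** adj L"
    unfolding svd_eq[OF A] diag_mm[symmetric]
    using U by (simp add: adj_mult adj_diag matrix_mul_assoc[symmetric])
  moreover have "B ** adj B = L' ** diag_matrix (\<lambda>i. s' i * s' i) ** adj L'"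
    unfolding svd_eq[OF B] diag_mm[symmetric]
    using U by (simp add: adj_mult adj_diag matrix_mul_assoc[symmetric])
  moreover have "diag_matrix (\<lambda>i. s' i * s' i) = (diag_matrix (\<lambda>i. s i * s i) :: 'k ^ 'n ^ 'n)"
    by (rule diag_matrix_cong) (simp add: ss)
  ultimately have "adj L' ** (L ** diag_matrix (\<lambda>i. s i * s i) ** adj L) ** L
      = adj L' ** (L' ** diag_matrix (\<lambda>i. s i * s i) ** adj L') ** L"
    using eq' by simp
  hence comm: "T ** diag_matrix (\<lambda>i. s i * s i) = diag_matrix (\<lambda>i. s i * s i) ** T"
    using U by (simp add: T_def matrix_mul_assoc[symmetric])
  have "T $ i $ k = 0" if ik: "(coord_pos i \<le> j) \<noteq> (coord_pos k \<le> j)" for i k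
  proof -
    have "T $ i $ k * of_real (s (coord_pos k) * s (coord_pos k))
        = of_real (s (coord_pos i) * s (coord_pos i)) * T $ i $ k"
      using arg_cong[OF comm, of "\<lambda>C. C $ i $ k"]
      unfolding mult_diag_component diag_matrix_mult_component .
    hence "(of_real (s (coord_pos k) * s (coord_pos k)) - of_real (s (coord_pos i) * s (coord_pos
        i))) * T $ i $ k = 0"
      by (simp add: algebra_simps)
    moreover have "s (coord_pos k) \<noteq> s (coord_pos i)"
    proof -
      have hi: "s j \<le> s (coord_pos a)" if "coord_pos a \<le> j" for a :: 'n
        using that j by (intro svd_mono[OF A]) auto
      have lo: "s (coord_pos a) \<le> s (Suc j)" if "\<not> coord_pos a \<le> j" for a :: 'n
        using that j by (intro svd_mono[OF A]) auto
      show ?thesis using hi[of i] hi[of k] lo[of i] lo[of k] ik j(3) by fastforce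
    qed
    moreover have "s (coord_pos i) > 0" "s (coord_pos k) > 0" by (rule svd_pos[OF A coord_pos_in])+
    ultimately show ?thesis
      unfolding of_real_diff[symmetric] mult_eq_0_iff of_real_eq_0_iff
      by (metis abs_of_pos abs_mult_self_eq diff_eq_diff_eq diff_self power2_eq_square
          power2_eq_iff_nonneg less_imp_le)
  qed
  hence comm': "std_proj j ** T = T ** std_proj j"
    unfolding vec_eq_iff mult_diag_component diag_matrix_mult_component by auto
  have "L' ** std_proj j ** adj L' = L' ** (std_proj j ** T) ** adj L"
    using U by (simp add: T_def matrix_mul_assoc[symmetric])
  also have "\<dots> = L ** std_proj j ** adj L"
    unfolding comm' using U by (simp add: T_def matrix_mul_assoc[symmetric])
  finally show ?thesis by simp
qed

text \<open>
  Inverting a matrix inverts its singular values and thus reverses their order.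
\<close>

definition coord_rev :: "'n::finite \<Rightarrow> 'n" where
  "coord_rev i = (SOME r. coord_pos r = Suc CARD('n) - coord_pos i)"

lemma coord_pos_rev [simp]: "coord_pos (coord_rev i) = Suc CARD('n) - coord_pos (i :: 'n::finite)"
proof -
  have "Suc CARD('n) - coord_pos i \<in> {1..CARD('n)}"
    using coord_pos_in[of i] unfolding atLeastAtMost_iff by linarith
  then obtain r :: 'n where "coord_pos r = Suc CARD('n) - coord_pos i" by (rule coord_pos_surj)
  thus ?thesis unfolding coord_rev_def by (rule someI)
qed

definition rev_matrix :: "'k::real_or_complex ^ 'n ^ 'n" where
  "rev_matrix = (\<chi> i k. if k = coord_rev i then 1 else 0)"

lemma coord_rev_rev [simp]: "coord_rev (coord_rev i) = i"
proof -
  have "coord_pos (coord_rev (coord_rev i)) = coord_pos i"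
    using coord_pos_in[of i] unfolding coord_pos_rev atLeastAtMost_iff by linarith
  thus ?thesis by (simp only: coord_pos_eq_iff)
qed

lemma rev_mult_component: "(rev_matrix ** A) $ i $ k = A $ coord_rev i $ k"
  for A :: "'k::real_or_complex ^ 'n ^ 'n"
proof -
  have "(rev_matrix ** A) $ i $ k = (\<Sum>l\<in>UNIV. if l = coord_rev i then A $ l $ k else 0)"
    unfolding rev_matrix_def matrix_matrix_mult_def vec_lambda_beta by (rule sum.cong) auto
  thus ?thesis by simp
qed

lemma adj_rev [simp]: "adj rev_matrix = rev_matrix"
  by (auto simp: adj_def rev_matrix_def vec_eq_iff)

lemma rev_diag_rev: "rev_matrix ** diag_matrix s ** rev_matrix
    = (diag_matrix (\<lambda>i. s (Suc CARD('n) - i)) :: 'k::real_or_complex ^ 'n ^ 'n)"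
  unfolding vec_eq_iff matrix_mul_assoc[symmetric] rev_mult_component diag_matrix_mult_component
  by (simp add: diag_matrix_def rev_matrix_def)

lemma unitary_rev: "unitary rev_matrix"
proof (rule unitaryI)
  show "adj rev_matrix ** rev_matrix = (mat 1 :: 'a ^ 'b ^ 'b)"
    unfolding vec_eq_iff adj_rev rev_mult_component by (simp add: mat_def rev_matrix_def)
qed

lemma svd_inverse:
  fixes A B :: "'k::real_or_complex ^ 'n ^ 'n"
  assumes A: "svd A L s M" and AB: "A ** B = mat 1"
  shows "svd B (adj M ** rev_matrix) (\<lambda>i. 1 / s (Suc CARD('n) - i)) (rev_matrix ** adj L)"
proof -
  note U = svd_unitary[OF A]
  have pos: "0 < s (Suc CARD('n) - i)" if "i \<in> {1..CARD('n)}" for i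
    using that by (intro svd_pos[OF A]) auto
  have dd: "diag_matrix s ** diag_matrix (\<lambda>i. 1 / s i) = (mat 1 :: 'k ^ 'n ^ 'n)"
  proof -
    have "s (coord_pos i) \<noteq> 0" for i :: 'n using svd_pos[OF A coord_pos_in[of i]] by simp
    thus ?thesis unfolding diag_mm by (simp add: diag_matrix_def mat_def vec_eq_iff)
  qed
  have "adj L ** A ** B = adj L" by (simp add: AB matrix_mul_assoc[symmetric])
  hence "diag_matrix s ** (M ** B) = adj L"
    unfolding svd_eq[OF A] using U by (simp add: matrix_mul_assoc[symmetric])
  hence "diag_matrix (\<lambda>i. 1 / s i) ** diag_matrix s ** (M ** B) = diag_matrix (\<lambda>i. 1 / s i) ** adj L"
    by (simp add: matrix_mul_assoc[symmetric])
  hence "M ** B = diag_matrix (\<lambda>i. 1 / s i) ** adj L"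
    using iffD1[OF matrix_left_right_inverse dd] by simp
  hence "adj M ** (M ** B) = adj M ** diag_matrix (\<lambda>i. 1 / s i) ** adj L" by (simp add: matrix_mul_assoc)
  hence B: "B = adj M ** diag_matrix (\<lambda>i. 1 / s i) ** adj L" using U by simp
  have "B = (adj M ** rev_matrix) ** (rev_matrix ** diag_matrix (\<lambda>i. 1 / s i) ** rev_matrix) **
      (rev_matrix ** adj L)"
  proof -
    have "rev_matrix ** (rev_matrix ** C) = C" for C :: "'k ^ 'n ^ 'n"
      using unitary_cancel(3)[OF unitary_rev, of C] by simp
    thus ?thesis unfolding B by (simp add: matrix_mul_assoc[symmetric])
  qed
  hence "B = (adj M ** rev_matrix) ** diag_matrix (\<lambda>i. 1 / s (Suc CARD('n) - i)) ** (rev_matrix **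
      adj L)"
    by (simp only: rev_diag_rev)
  moreover have "1 / s (Suc CARD('n) - l) \<le> 1 / s (Suc CARD('n) - i)"
    if "i \<in> {1..CARD('n)}" "l \<in> {1..CARD('n)}" "i \<le> l" for i l
    using that pos[of l] by (intro divide_left_mono svd_mono[OF A] mult_pos_pos pos) auto
  ultimately show ?thesis
    unfolding svd_def using U pos by (auto intro!: unitary_mult unitary_adj unitary_rev)
qed

section \<open>The Cartan projection and the contraction estimate\<close>

lemma mat_mult_component: "(mat c ** A) $ i $ j = c * A $ i $ j"
  for A :: "'k::real_or_complex ^ 'n ^ 'n"
proof -
  have "(mat c ** A) $ i $ j = (\<Sum>l\<in>UNIV. if i = l then c * A $ l $ j else 0)"
    unfolding mat_def matrix_matrix_mult_def vec_lambda_beta by (rule sum.cong) auto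
  thus ?thesis by simp
qed

lemma mult_mat_component: "(A ** mat c) $ i $ j = A $ i $ j * c"
  for A :: "'k::real_or_complex ^ 'n ^ 'n"
proof -
  have "(A ** mat c) $ i $ j = (\<Sum>l\<in>UNIV. if l = j then A $ i $ l * c else 0)"
    unfolding mat_def matrix_matrix_mult_def vec_lambda_beta by (rule sum.cong) auto
  thus ?thesis by simp
qed

lemma mat_commute: "mat c ** A = A ** mat c" for A :: "'k::real_or_complex ^ 'n ^ 'n"
  by (simp add: vec_eq_iff mat_mult_component mult_mat_component mult.commute)

lemma mat_mat: "mat a ** mat b = (mat (a * b) :: 'k::real_or_complex ^ 'n ^ 'n)"
  unfolding vec_eq_iff mat_mult_component by (simp add: mat_def)

lemma mat_mv: "mat c *v x = c *s x" for x :: "'k::real_or_complex ^ 'n"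
proof -
  have "(mat c *v x) $ i = (\<Sum>l\<in>UNIV. if i = l then c * x $ l else 0)" for i
    unfolding mat_def matrix_vector_mult_def vec_lambda_beta by (rule sum.cong) auto
  thus ?thesis by (simp add: vec_eq_iff)
qed

lemma invertible_mat: "c \<noteq> 0 \<Longrightarrow> invertible (mat c :: 'k::real_or_complex ^ 'n ^ 'n)"
  unfolding invertible_def by (rule exI[of _ "mat (1 / c)"]) (simp add: mat_mat)

lemma det_mat: "det (mat c :: 'k::real_or_complex ^ 'n ^ 'n) = c ^ CARD('n)"
  by (subst det_diagonal) (simp_all add: mat_def)

lemma group_GL: "group (GL :: ('k::real_or_complex ^ 'n ^ 'n) monoid)"
proof (rule groupI)
  fix A :: "'k ^ 'n ^ 'n" assume "A \<in> carrier GL"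
  then obtain B where "A ** B = mat 1" "B ** A = mat 1"
    by (auto simp: GL_def invertible_def)
  thus "\<exists>B\<in>carrier GL. B \<otimes>\<^bsub>GL\<^esub> A = \<one>\<^bsub>GL\<^esub>"
    by (intro bexI[of _ B]) (auto simp: GL_def invertible_def)
qed (auto simp: GL_def matrix_mul_assoc invertible_mult invertible_mat)

text \<open>
  Normality holds because scalar matrices are central.
\<close>

lemma scalar_matrices_normal:
  "normal scalar_matrices (GL :: ('k::real_or_complex ^ 'n ^ 'n) monoid)"
proof -
  interpret group "GL :: ('k ^ 'n ^ 'n) monoid" by (rule group_GL)
  have inv: "inv\<^bsub>GL\<^esub> (mat c) = (mat (1 / c) :: 'k ^ 'n ^ 'n)" if "c \<noteq> 0" for c
    by (rule inv_equality) (use that in \<open>auto simp: GL_def mat_mat invertible_mat\<close>)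
  show ?thesis
    unfolding normal_inv_iff
  proof (intro conjI ballI)
    show "subgroup scalar_matrices (GL :: ('k ^ 'n ^ 'n) monoid)"
    proof (rule subgroupI)
      show "scalar_matrices \<subseteq> carrier (GL :: ('k ^ 'n ^ 'n) monoid)"
        by (auto simp: scalar_matrices_def GL_def invertible_mat)
      show "scalar_matrices \<noteq> ({} :: ('k ^ 'n ^ 'n) set)"
        unfolding scalar_matrices_def using zero_neq_one[where 'a='k] by blast
    next
      fix a :: "'k ^ 'n ^ 'n" assume "a \<in> scalar_matrices"
      then obtain c where c: "a = mat c" "c \<noteq> 0" by (auto simp: scalar_matrices_def)
      show "inv\<^bsub>GL\<^esub> a \<in> scalar_matrices"
        unfolding c(1) inv[OF c(2)] scalar_matrices_def using c(2) by auto
    next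
      fix a b :: "'k ^ 'n ^ 'n" assume "a \<in> scalar_matrices" "b \<in> scalar_matrices"
      then obtain c d where "a = mat c" "c \<noteq> 0" "b = mat d" "d \<noteq> 0"
        by (auto simp: scalar_matrices_def)
      thus "a \<otimes>\<^bsub>GL\<^esub> b \<in> scalar_matrices"
        by (auto simp: scalar_matrices_def GL_def mat_mat intro!: exI[of _ "c * d"])
    qed
  next
    fix x h :: "'k ^ 'n ^ 'n" assume x: "x \<in> carrier GL" and h: "h \<in> scalar_matrices"
    then obtain c where c: "h = mat c" "c \<noteq> 0" by (auto simp: scalar_matrices_def)
    have hG: "h \<in> carrier GL" using c by (simp add: GL_def invertible_mat)
    have "x \<otimes>\<^bsub>GL\<^esub> h = h \<otimes>\<^bsub>GL\<^esub> x" by (simp add: GL_def c(1) mat_commute)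
    hence "x \<otimes>\<^bsub>GL\<^esub> h \<otimes>\<^bsub>GL\<^esub> inv\<^bsub>GL\<^esub> x = h" using x hG by (simp add: m_assoc)
    thus "x \<otimes>\<^bsub>GL\<^esub> h \<otimes>\<^bsub>GL\<^esub> inv\<^bsub>GL\<^esub> x \<in> scalar_matrices" using h by simp
  qed
qed

lemma group_PGL: "group (PGL :: ('k::real_or_complex ^ 'n ^ 'n) set monoid)"
  unfolding PGL_def by (rule normal.factorgroup_is_group[OF scalar_matrices_normal])

lemma PGL_carrierE:
  assumes "\<gamma> \<in> carrier (PGL :: ('k::real_or_complex ^ 'n ^ 'n) set monoid)"
  obtains A where "invertible A" "\<gamma> = {mat c ** A | c. c \<noteq> 0}"
proof -
  obtain A where A: "A \<in> carrier GL" "\<gamma> = scalar_matrices #>\<^bsub>GL\<^esub> A"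
    using assms by (auto simp: PGL_def FactGroup_def RCOSETS_def)
  moreover have "scalar_matrices #>\<^bsub>GL\<^esub> A = {mat c ** A | c. c \<noteq> 0}"
    unfolding r_coset_def scalar_matrices_def by (auto simp: GL_def)
  ultimately show thesis using that by (simp add: GL_def)
qed

lemma
  assumes \<gamma>: "\<gamma> \<in> carrier (PGL :: ('k::real_or_complex ^ 'n ^ 'n) set monoid)" and A: "A \<in> \<gamma>"
  shows PGL_lift_invertible: "invertible A"
    and PGL_lift_eq: "\<gamma> = {mat c ** A | c. c \<noteq> 0}"
proof -
  obtain B where B: "invertible B" "\<gamma> = {mat c ** B | c. c \<noteq> 0}" using PGL_carrierE[OF \<gamma>] .
  then obtain c where c: "A = mat c ** B" "c \<noteq> 0" using A by blast
  show "invertible A" using B c by (simp add: invertible_mult invertible_mat)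
  have "mat d ** B = mat (d / c) ** A" "mat d ** A = mat (d * c) ** B" for d
    using c by (simp_all add: matrix_mul_assoc mat_mat)
  thus "\<gamma> = {mat c ** A | c. c \<noteq> 0}"
    unfolding B(2) using c(2) by (metis divide_eq_0_iff mult_eq_0_iff)
qed

lemma PGL_unit_lift:
  assumes "\<gamma> \<in> carrier (PGL :: ('k::real_or_complex ^ 'n ^ 'n) set monoid)"
  obtains A where "A \<in> \<gamma>" "norm (det A) = 1"
proof -
  obtain A where A: "invertible A" "\<gamma> = {mat c ** A | c. c \<noteq> 0}" using PGL_carrierE[OF assms] .
  define n where "n = norm (det A)"
  have n: "n > 0" using A(1) by (simp add: n_def invertible_det_nz)
  define r where "r = n powr (- 1 / CARD('n))"
  have r: "r > 0" using n by (simp add: r_def)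
  have "r ^ CARD('n) = n powr (- 1)"
    using n by (simp add: r_def powr_realpow[symmetric] powr_powr)
  hence "r ^ CARD('n) * n = 1" using n by (simp add: powr_minus)
  hence "norm (det (mat (of_real r) ** A)) = 1"
    using r by (simp add: det_mul det_mat norm_mult norm_power n_def)
  moreover have "mat (of_real r) ** A \<in> \<gamma>" unfolding A(2) using r by auto
  ultimately show thesis using that by blast
qed

lemma PGL_inverse_lift:
  assumes \<gamma>: "\<gamma> \<in> carrier (PGL :: ('k::real_or_complex ^ 'n ^ 'n) set monoid)" and A: "A \<in> \<gamma>"
    and AB: "A ** B = mat 1"
  shows "B \<in> inv\<^bsub>PGL\<^esub> \<gamma>"
proof -
  interpret group "PGL :: ('k ^ 'n ^ 'n) set monoid" by (rule group_PGL)
  let ?\<delta> = "inv\<^bsub>PGL\<^esub> \<gamma>"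
  have \<delta>: "?\<delta> \<in> carrier PGL" using \<gamma> by simp
  obtain D where D: "D \<in> ?\<delta>" using PGL_unit_lift[OF \<delta>] by blast
  have "\<gamma> \<otimes>\<^bsub>PGL\<^esub> ?\<delta> = \<one>\<^bsub>PGL\<^esub>" using \<gamma> by simp
  moreover have "A ** D \<in> \<gamma> \<otimes>\<^bsub>PGL\<^esub> ?\<delta>"
    using A D by (auto simp: PGL_def FactGroup_def set_mult_def GL_def)
  ultimately obtain c where c: "A ** D = mat c" "c \<noteq> 0"
    by (auto simp: PGL_def FactGroup_def scalar_matrices_def)
  have BA: "B ** A = mat 1" using AB by (simp add: matrix_left_right_inverse)
  have "D = B ** A ** D" by (simp add: BA)
  also have "\<dots> = mat c ** B" using c by (simp add: matrix_mul_assoc[symmetric] mat_commute)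
  finally have "mat (1 / c) ** D = B" using c(2) by (simp add: matrix_mul_assoc mat_mat)
  moreover have "mat (1 / c) ** D \<in> ?\<delta>"
    using PGL_lift_eq[OF \<delta> D] c(2) by (metis (mono_tags, lifting) divide_eq_0_iff mem_Collect_eq
        zero_neq_one)
  ultimately show ?thesis by simp
qed

lemma pgl_svd_exists:
  assumes "\<gamma> \<in> carrier (PGL :: ('k::real_or_complex ^ 'n ^ 'n) set monoid)"
  obtains A L s M where "A \<in> \<gamma>" "norm (det A) = 1" "svd A L s M"
  using PGL_unit_lift[OF assms] PGL_lift_invertible[OF assms] svd_exists by metis

text \<open>
  Two lifts with determinant of modulus 1 differ by a scalar of modulus 1. The singular values and the
  left singular spaces do not see it.
\<close>

lemma PGL_unit_lifts:
  assumes \<gamma>: "\<gamma> \<in> carrier (PGL :: ('k::real_or_complex ^ 'n ^ 'n) set monoid)"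
    and A: "A \<in> \<gamma>" "norm (det A) = 1" and B: "B \<in> \<gamma>" "norm (det B) = 1"
  shows "norm (A *v x) = norm (B *v x)" "A ** adj A = B ** adj B"
proof -
  obtain c where c: "B = mat c ** A" "c \<noteq> 0" using PGL_lift_eq[OF \<gamma> A(1)] B(1) by blast
  have "norm c ^ CARD('n) = 1"
    using A(2) B(2) unfolding c(1) by (simp add: det_mul det_mat norm_mult norm_power)
  hence nc: "norm c = 1" using power_eq_1_iff[of "norm c" "CARD('n)"] by simp
  show "norm (A *v x) = norm (B *v x)"
    unfolding c(1) by (simp add: matrix_vector_mul_assoc[symmetric] mat_mv norm_scale nc)
  have "cnjg c * c = 1" using cnjg_mult_self'[of c] nc by simp
  have "B ** adj B = (mat c ** (A ** adj A)) ** mat (cnjg c)"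
    unfolding c(1) adj_mult adj_mat by (simp add: matrix_mul_assoc)
  also have "\<dots> = mat (cnjg c) ** (mat c ** (A ** adj A))" by (rule mat_commute[symmetric])
  also have "\<dots> = mat (cnjg c * c) ** (A ** adj A)" by (simp add: matrix_mul_assoc mat_mat)
  finally show "A ** adj A = B ** adj B" using \<open>cnjg c * c = 1\<close> by simp
qed

lemma sigma_eq:
  assumes \<gamma>: "\<gamma> \<in> carrier (PGL :: ('k::real_or_complex ^ 'n ^ 'n) set monoid)"
    and A: "A \<in> \<gamma>" "norm (det A) = 1" "svd A L s M" and j: "j \<in> {1..CARD('n)}"
  shows "sigma j \<gamma> = s j"
  unfolding sigma_def
proof (rule the_equality)
  show "\<exists>L s' M. pgl_svd \<gamma> L s' M \<and> s j = s' j" unfolding pgl_svd_def using A by blast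
next
  fix y assume "\<exists>L s M. pgl_svd \<gamma> L s M \<and> y = s j"
  then obtain B L' s' M' where B: "B \<in> \<gamma>" "norm (det B) = 1" "svd B L' s' M'" "y = s' j"
    unfolding pgl_svd_def by blast
  show "y = s j"
    using svd_values_le[OF A(3) B(3) _ j] svd_values_le[OF B(3) A(3) _ j]
      PGL_unit_lifts(1)[OF \<gamma> A(1,2) B(1,2)] B(4) by simp
qed

lemma alpha_kappa_eq:
  assumes \<gamma>: "\<gamma> \<in> carrier (PGL :: ('k::real_or_complex ^ 'n ^ 'n) set monoid)"
    and A: "A \<in> \<gamma>" "norm (det A) = 1" "svd A L s M" and j: "0 < j" "j < CARD('n)"
  shows "alpha_kappa j \<gamma> = ln (s j / s (Suc j))"
  unfolding alpha_kappa_def using sigma_eq[OF \<gamma> A, of j] sigma_eq[OF \<gamma> A, of "Suc j"] j by simp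

lemma U_space_eq:
  assumes \<gamma>: "\<gamma> \<in> carrier (PGL :: ('k::real_or_complex ^ 'n ^ 'n) set monoid)"
    and A: "A \<in> \<gamma>" "norm (det A) = 1" "svd A L s M"
    and j: "0 < j" "j < CARD('n)" "s (Suc j) < s j"
  shows "U_space j \<gamma> = (*v) L ` std_space j"
  unfolding U_space_def
proof (rule the_equality)
  show "\<exists>L' s M. pgl_svd \<gamma> L' s M \<and> (*v) L ` std_space j = (*v) L' ` std_space j"
    unfolding pgl_svd_def using A by blast
next
  fix V assume "\<exists>L s M. pgl_svd \<gamma> L s M \<and> V = (*v) L ` std_space j"
  then obtain B L' s' M' where B: "B \<in> \<gamma>" "norm (det B) = 1" "svd B L' s' M'" "V = (*v) L' ` std_space j"
    unfolding pgl_svd_def by blast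
  have "L ** std_proj j ** adj L = L' ** std_proj j ** adj L'"
    by (rule svd_left_space_unique[OF A(3) B(3) PGL_unit_lifts[OF \<gamma> A(1,2) B(1,2)] j])
  thus "V = (*v) L ` std_space j"
    using range_conj[OF svd_unitary(1)[OF A(3)], of "std_proj j"]
      range_conj[OF svd_unitary(1)[OF B(3)], of "std_proj j"] B(4)
    by (simp add: range_std_proj)
qed

text \<open>
  The matrix \<open>A\<close> maps the kernel of \<open>R\<close> to the range of \<open>P\<close> and stretches it at least by
  \<open>a\<close>, and stretches the range of \<open>R\<close> at most by \<open>b\<close>. The range of \<open>P\<close> is the
  attracting space and that of \<open>R\<close> the repelling one.
\<close>

definition gap_factors ::
    "'k::real_or_complex ^ 'n ^ 'n \<Rightarrow> 'k ^ 'n ^ 'n \<Rightarrow> 'k ^ 'n ^ 'n \<Rightarrow> real \<Rightarrow> real \<Rightarrow> bool" where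
  "gap_factors A P R a b \<longleftrightarrow> 0 < a \<and> 0 < b \<and> orth_proj R \<and> A ** (mat 1 - R) = P ** A \<and>
     (\<forall>x. R *v x = 0 \<longrightarrow> a * norm x \<le> norm (A *v x)) \<and>
     (\<forall>x. R *v x = x \<longrightarrow> norm (A *v x) \<le> b * norm x)"

text \<open>
  With \<open>A = L ** diag_matrix s ** M\<close>, the attracting space is spanned by the first \<open>j\<close> columns of
  \<open>L\<close>, and the repelling space by the last \<open>d - j\<close> columns of \<open>adj M\<close>. The latter is the
  attracting space of the inverse, since inversion reverses the order of the singular values.
\<close>

lemma cartan_data:
  assumes \<gamma>: "\<gamma> \<in> carrier (PGL :: ('k::real_or_complex ^ 'n ^ 'n) set monoid)"
    and j: "0 < j" "j < CARD('n)"
  shows "alpha_kappa (CARD('n) - j) (inv\<^bsub>PGL\<^esub> \<gamma>) = alpha_kappa j \<gamma>"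
    and "0 < alpha_kappa j \<gamma> \<Longrightarrow> U_space j \<gamma> \<in> Gr j \<and>
      (\<exists>A\<in>\<gamma>. \<exists>a. gap_factors A (proj_matrix (U_space j \<gamma>))
         (proj_matrix (U_space (CARD('n) - j) (inv\<^bsub>PGL\<^esub> \<gamma>))) a (a * exp (- alpha_kappa j \<gamma>)))"
proof -
  let ?d = "CARD('n)"
  interpret group "PGL :: ('k ^ 'n ^ 'n) set monoid" by (rule group_PGL)
  obtain A L s M where A: "A \<in> \<gamma>" "norm (det A) = 1" "svd A L s M" using pgl_svd_exists[OF \<gamma>] .
  note U = svd_unitary[OF A(3)]
  obtain B where AB: "A ** B = mat 1"
    using PGL_lift_invertible[OF \<gamma> A(1)] by (auto simp: invertible_def)
  let ?\<delta> = "inv\<^bsub>PGL\<^esub> \<gamma>"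
  have \<delta>: "?\<delta> \<in> carrier PGL" using \<gamma> by simp
  have B: "B \<in> ?\<delta>" by (rule PGL_inverse_lift[OF \<gamma> A(1) AB])
  have "det A * det B = 1" using arg_cong[OF AB, of det] by (simp add: det_mul)
  hence "norm (det A) * norm (det B) = 1" by (metis norm_mult norm_one)
  hence dB: "norm (det B) = 1" using A(2) by simp
  let ?s = "\<lambda>i. 1 / s (Suc ?d - i)"
  have svdB: "svd B (adj M ** rev_matrix) ?s (rev_matrix ** adj L)"
    by (rule svd_inverse[OF A(3) AB])
  have al: "alpha_kappa j \<gamma> = ln (s j / s (Suc j))" by (rule alpha_kappa_eq[OF \<gamma> A j])
  have j': "0 < ?d - j" "?d - j < ?d" using j by auto
  have e: "Suc ?d - (?d - j) = Suc j" "Suc ?d - Suc (?d - j) = j" using j by auto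
  show "alpha_kappa (?d - j) ?\<delta> = alpha_kappa j \<gamma>"
    unfolding alpha_kappa_eq[OF \<delta> B dB svdB j'] al e by simp
  assume pos: "0 < alpha_kappa j \<gamma>"
  have sp: "0 < s j" "0 < s (Suc j)" using j by (auto intro!: svd_pos[OF A(3)])
  have lt: "s (Suc j) < s j" using pos sp unfolding al by simp
  have Us: "U_space j \<gamma> = (*v) L ` std_space j" by (rule U_space_eq[OF \<gamma> A j lt])
  have P: "proj_matrix (U_space j \<gamma>) = L ** std_proj j ** adj L"
    unfolding Us by (rule proj_matrix_unitary_std[OF U(1)])
  have "1 / s (Suc ?d - Suc (?d - j)) < 1 / s (Suc ?d - (?d - j))"
    unfolding e using lt sp by (simp add: divide_strict_left_mono)
  from U_space_eq[OF \<delta> B dB svdB j' this]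
  have R1: "proj_matrix (U_space (?d - j) ?\<delta>)
      = (adj M ** rev_matrix) ** std_proj (?d - j) ** adj (adj M ** rev_matrix)"
    using proj_matrix_unitary_std[OF svd_unitary(1)[OF svdB]] by simp
  have dg: "diag_matrix (\<lambda>i. if Suc ?d - i \<le> ?d - j then 1 else 0) = (mat 1 - std_proj j :: 'k ^ 'n
      ^ 'n)"
  proof -
    have "(Suc ?d - coord_pos i \<le> ?d - j) = (\<not> coord_pos i \<le> j)" for i :: 'n
      using coord_pos_in[of i] j unfolding atLeastAtMost_iff by linarith
    thus ?thesis by (auto simp: diag_matrix_def mat_def vec_eq_iff)
  qed
  define R where "R = proj_matrix (U_space (?d - j) ?\<delta>)"
  have "R = adj M ** (rev_matrix ** std_proj (?d - j) ** rev_matrix) ** M"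
    unfolding R_def R1 by (simp add: adj_mult matrix_mul_assoc)
  hence R: "R = adj M ** (mat 1 - std_proj j) ** M"
    unfolding rev_diag_rev dg .
  have oR: "orth_proj R"
    unfolding R using orth_proj_conj[OF unitary_adj[OF U(2)] orth_proj_compl[OF orth_proj_std]] by simp
  have R': "mat 1 - R = adj M ** std_proj j ** M"
    unfolding R using U by (simp add: mm.diff_left mm.diff_right)
  have comm: "A ** (mat 1 - R) = L ** std_proj j ** adj L ** A"
  proof -
    have "diag_matrix s ** std_proj j = (std_proj j ** diag_matrix s :: 'k ^ 'n ^ 'n)"
      unfolding diag_mm by (rule diag_matrix_cong) simp
    hence "L ** (diag_matrix s ** std_proj j) ** M = L ** (std_proj j ** diag_matrix s) ** M" by simp
    thus ?thesis
      unfolding R' svd_eq[OF A(3)] using U by (simp add: matrix_mul_assoc[symmetric])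
  qed
  have Mx: "M *v (R *v x) = (mat 1 - std_proj j) *v (M *v x)" for x
    unfolding R using U by (simp add: matrix_vector_mul_assoc[symmetric])
  have Mx': "(M *v (R *v x)) $ i = (if coord_pos i \<le> j then 0 else (M *v x) $ i)" for x i
    unfolding Mx by (simp add: mv.diff_left diag_mv)
  have lo: "s j * norm x \<le> norm (A *v x)" if "R *v x = 0" for x
  proof (rule svd_lower[OF A(3)])
    fix i assume "(M *v x) $ i \<noteq> 0"
    hence "coord_pos i \<le> j" using Mx'[of x i] that by (auto split: if_splits)
    thus "s j \<le> s (coord_pos i)" using j by (intro svd_mono[OF A(3)]) auto
  qed (use sp in simp)
  have hi: "norm (A *v x) \<le> s (Suc j) * norm x" if "R *v x = x" for x
  proof (rule svd_upper[OF A(3)])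
    fix i assume "(M *v x) $ i \<noteq> 0"
    hence "\<not> coord_pos i \<le> j" using Mx'[of x i] that by (auto split: if_splits)
    thus "s (coord_pos i) \<le> s (Suc j)" using j by (intro svd_mono[OF A(3)]) auto
  qed (use sp in simp)
  have "s (Suc j) = s j * exp (- alpha_kappa j \<gamma>)"
    unfolding al using sp by (simp add: exp_minus)
  moreover have "U_space j \<gamma> \<in> Gr j"
    unfolding Us using j by (intro Gr_image unitary_inj U std_space_Gr) simp
  ultimately show "U_space j \<gamma> \<in> Gr j \<and>
      (\<exists>A\<in>\<gamma>. \<exists>a. gap_factors A (proj_matrix (U_space j \<gamma>))
         (proj_matrix (U_space (?d - j) ?\<delta>)) a (a * exp (- alpha_kappa j \<gamma>)))"
    unfolding gap_factors_def R_def[symmetric] P using A(1) sp oR comm lo hi by metis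
qed

lemma pgl_act_eq:
  assumes \<gamma>: "\<gamma> \<in> carrier (PGL :: ('k::real_or_complex ^ 'n ^ 'n) set monoid)" and A: "A \<in> \<gamma>"
    and V: "vec.subspace V"
  shows "pgl_act \<gamma> V = (*v) A ` V"
proof
  show "(*v) A ` V \<subseteq> pgl_act \<gamma> V" unfolding pgl_act_def using A by blast
  show "pgl_act \<gamma> V \<subseteq> (*v) A ` V"
  proof
    fix y assume "y \<in> pgl_act \<gamma> V"
    then obtain B v where B: "B \<in> \<gamma>" "v \<in> V" "y = B *v v" unfolding pgl_act_def by blast
    then obtain c where "B = mat c ** A" using PGL_lift_eq[OF \<gamma> A] by blast
    hence "y = A *v (c *s v)"
      using B by (simp add: matrix_vector_mul_assoc[symmetric] mat_mv vec.scale)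
    thus "y \<in> (*v) A ` V" using B(2) vec.subspace_scale[OF V] by blast
  qed
qed

lemma invertible_inj_mv: "invertible A \<Longrightarrow> inj ((*v) A)" for A :: "'k::real_or_complex ^ 'n ^ 'n"
proof (rule injI)
  fix x y assume A: "invertible A" and "A *v x = A *v y"
  hence "A *v (x - y) = 0" by (simp add: mv.diff_right)
  with A have "x - y = 0" by (rule invertible_inj)
  thus "x = y" by simp
qed

lemma pgl_act_Gr:
  assumes "\<gamma> \<in> carrier (PGL :: ('k::real_or_complex ^ 'n ^ 'n) set monoid)" "V \<in> Gr j"
  shows "pgl_act \<gamma> V \<in> Gr j"
proof -
  obtain A where A: "A \<in> \<gamma>" using PGL_unit_lift[OF assms(1)] by blast
  have "vec.subspace V" using assms(2) by (simp add: Gr_def)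
  thus ?thesis
    using pgl_act_eq[OF assms(1) A] Gr_image[OF invertible_inj_mv[OF PGL_lift_invertible[OF assms(1)
        A]] assms(2)]
    by simp
qed

lemma pgl_act_inverse:
  assumes \<gamma>: "\<gamma> \<in> carrier (PGL :: ('k::real_or_complex ^ 'n ^ 'n) set monoid)" and V: "V \<in> Gr j"
  shows "pgl_act (inv\<^bsub>PGL\<^esub> \<gamma>) (pgl_act \<gamma> V) = V"
proof -
  interpret group "PGL :: ('k ^ 'n ^ 'n) set monoid" by (rule group_PGL)
  obtain A where A: "A \<in> \<gamma>" using PGL_unit_lift[OF \<gamma>] by blast
  obtain B where B: "A ** B = mat 1" "B ** A = mat 1"
    using PGL_lift_invertible[OF \<gamma> A] by (auto simp: invertible_def)
  have "vec.subspace V" using V by (simp add: Gr_def)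
  moreover have "vec.subspace (pgl_act \<gamma> V)" using pgl_act_Gr[OF \<gamma> V] by (simp add: Gr_def)
  ultimately have "pgl_act (inv\<^bsub>PGL\<^esub> \<gamma>) (pgl_act \<gamma> V) = (*v) B ` (*v) A ` V"
    using pgl_act_eq[OF _ PGL_inverse_lift[OF \<gamma> A B(1)]] pgl_act_eq[OF \<gamma> A] \<gamma> by simp
  thus ?thesis by (simp add: image_image matrix_vector_mul_assoc B)
qed

text \<open>
  Let \<open>v\<close> be in \<open>V\<close>. The component of \<open>A *v v\<close> outside the attracting space is the image of
  the repelling component \<open>R *v v\<close>, hence of size at most \<open>b * norm v\<close>. The component inside has size
  at least \<open>a * \<epsilon> * norm v\<close>. Since \<open>b / a\<close> is \<open>exp (- \<alpha>)\<close>, the image of \<open>V\<close> lies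
  that close to the attracting space.
\<close>

lemma contraction:
  fixes V :: "('k::real_or_complex ^ 'n) set"
  assumes \<gamma>: "\<gamma> \<in> carrier PGL" and j: "0 < j" "j < CARD('n)" and pos: "0 < alpha_kappa j \<gamma>"
    and V: "V \<in> Gr j" and \<epsilon>: "0 < \<epsilon>"
    and tr: "\<And>v. v \<in> V \<Longrightarrow> \<epsilon> * norm v \<le> norm (v - proj_matrix (U_space (CARD('n) - j) (inv\<^bsub>PGL\<^esub> \<gamma>)) *v v)"
  shows "norm (proj_matrix (pgl_act \<gamma> V) - proj_matrix (U_space j \<gamma>))
    \<le> sqrt (2 * CARD('n)) / \<epsilon> * exp (- alpha_kappa j \<gamma>)"
proof -
  define P where "P = proj_matrix (U_space j \<gamma>)"
  define R where "R = proj_matrix (U_space (CARD('n) - j) (inv\<^bsub>PGL\<^esub> \<gamma>))"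
  define Q where "Q = proj_matrix (pgl_act \<gamma> V)"
  define t where "t = exp (- alpha_kappa j \<gamma>)"
  obtain A a b where A: "A \<in> \<gamma>" and ab: "0 < a" "0 < b" "b = a * t" and R: "orth_proj R"
    and comm: "A ** (mat 1 - R) = P ** A"
    and lo: "\<And>x. R *v x = 0 \<Longrightarrow> a * norm x \<le> norm (A *v x)"
    and hi: "\<And>x. R *v x = x \<Longrightarrow> norm (A *v x) \<le> b * norm x" and UG: "U_space j \<gamma> \<in> Gr j"
    using cartan_data(2)[OF \<gamma> j pos] unfolding gap_factors_def P_def R_def t_def by blast
  have P: "orth_proj P" "trace P = of_nat j"
    unfolding P_def using orth_proj_proj_matrix[OF UG] trace_proj_matrix[OF UG] .
  note VG = pgl_act_Gr[OF \<gamma> V]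
  have Q: "orth_proj Q" "trace Q = of_nat j"
    unfolding Q_def using orth_proj_proj_matrix[OF VG] trace_proj_matrix[OF VG] .
  have gV: "pgl_act \<gamma> V = (*v) A ` V" using pgl_act_eq[OF \<gamma> A] V by (simp add: Gr_def)
  have "norm ((Q - P ** Q) *v w) \<le> t / \<epsilon> * norm w" for w
  proof -
    have "Q *v w \<in> pgl_act \<gamma> V" using range_proj_matrix[OF VG] unfolding Q_def by blast
    then obtain v where v: "v \<in> V" "Q *v w = A *v v" unfolding gV by blast
    have PA: "P *v (A *v v) = A *v (v - R *v v)"
      using arg_cong[OF comm, of "\<lambda>C. C *v v"]
      by (simp add: matrix_vector_mul_assoc[symmetric] mv.diff_left)
    have "(Q - P ** Q) *v w = A *v v - P *v (A *v v)"
      by (simp add: mv.diff_left matrix_vector_mul_assoc[symmetric] v(2))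
    also have "\<dots> = A *v (R *v v)" unfolding PA by (simp add: mv.diff_right)
    also have "norm \<dots> \<le> b * norm (R *v v)" by (rule hi) (rule orth_proj_idem_mv[OF R])
    also have "\<dots> \<le> b * norm v" using norm_orth_proj_le[OF R] ab(2)
      by (intro mult_left_mono) simp_all
    also have "\<dots> \<le> b * (norm (v - R *v v) / \<epsilon>)"
      using tr[OF v(1)] ab(2) \<epsilon> unfolding R_def[symmetric]
      by (intro mult_left_mono) (simp_all add: pos_le_divide_eq mult.commute)
    also have "\<dots> = t / \<epsilon> * (a * norm (v - R *v v))" using ab by simp
    also have "\<dots> \<le> t / \<epsilon> * norm (A *v (v - R *v v))"
      using \<epsilon> by (intro mult_left_mono lo) (simp_all add: t_def mv.diff_right orth_proj_idem_mv[OF R])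
    also have "\<dots> = t / \<epsilon> * norm (P *v (Q *v w))" unfolding PA[symmetric] v(2) ..
    also have "\<dots> \<le> t / \<epsilon> * norm w"
      using norm_orth_proj_le[OF P(1), of "Q *v w"] norm_orth_proj_le[OF Q(1), of w] \<epsilon>
      by (intro mult_left_mono) (auto simp: t_def)
    finally show ?thesis .
  qed
  hence "norm (Q - P ** Q) \<le> sqrt CARD('n) * (t / \<epsilon>)"
    by (rule norm_le_of_mv) (use \<epsilon> in \<open>simp add: t_def\<close>)
  hence "(norm (Q - P ** Q))\<^sup>2 \<le> (sqrt CARD('n) * (t / \<epsilon>))\<^sup>2" by (rule power_mono) simp
  hence "(norm (Q - P))\<^sup>2 \<le> (sqrt (2 * CARD('n)) / \<epsilon> * t)\<^sup>2"
    unfolding norm_proj_diff[OF P(1) Q(1), unfolded P(2) Q(2), OF refl]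
    by (simp add: power_mult_distrib power_divide)
  thus ?thesis
    unfolding P_def[symmetric] Q_def[symmetric] t_def[symmetric]
    by (rule power2_le_imp_le) (use \<epsilon> in \<open>simp add: t_def\<close>)
qed

section \<open>Sets of Hausdorff measure zero\<close>

text \<open>
  The same \<open>\<epsilon>\<close> bounds the diameters and the total cost, so that null sets need a single parameter.
\<close>

definition small_cover ::
    "'a set \<Rightarrow> ('a \<Rightarrow> 'a \<Rightarrow> real) \<Rightarrow> real \<Rightarrow> 'a set \<Rightarrow> real \<Rightarrow> (nat \<Rightarrow> 'a set) \<Rightarrow> bool" where
  "small_cover X d s A \<epsilon> U \<longleftrightarrow> (\<forall>i. U i \<subseteq> X \<and> ediam d (U i) \<le> ennreal \<epsilon>) \<and> A \<subseteq> (\<Union>i. U i) \<and>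
     (\<Sum>i. ennreal (enn2real (ediam d (U i)) powr s)) \<le> ennreal \<epsilon>"

definition hausdorff_null :: "'a set \<Rightarrow> ('a \<Rightarrow> 'a \<Rightarrow> real) \<Rightarrow> real \<Rightarrow> 'a set \<Rightarrow> bool" where
  "hausdorff_null X d s A \<longleftrightarrow> (\<forall>\<epsilon>>0. \<exists>U. small_cover X d s A \<epsilon> U)"

lemma hausdorff_measure_zero_of_null:
  assumes "hausdorff_null X d s A" shows "hausdorff_measure X d s A = 0"
proof -
  let ?C = "\<lambda>\<epsilon>. {U :: nat \<Rightarrow> 'a set. (\<forall>i. U i \<subseteq> X \<and> ediam d (U i) \<le> ennreal \<epsilon>) \<and> A \<subseteq> (\<Union>i. U i)}"
  let ?v = "\<lambda>U. \<Sum>i. ennreal (enn2real (ediam d (U i)) powr s)"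
  have "(INF U\<in>?C \<epsilon>. ?v U) \<le> 0" if "\<epsilon> > 0" for \<epsilon> :: real
  proof (rule ennreal_le_epsilon)
    fix e :: real assume "0 < e"
    with that have m: "min \<epsilon> e > 0" by simp
    then obtain U :: "nat \<Rightarrow> 'a set" where U: "\<forall>i. U i \<subseteq> X \<and> ediam d (U i) \<le> ennreal (min \<epsilon> e)" "A \<subseteq>
        (\<Union>i. U i)"
      "?v U \<le> ennreal (min \<epsilon> e)"
      using assms[unfolded hausdorff_null_def small_cover_def, THEN spec, THEN mp, OF m]
      by (elim exE conjE)
    have le: "ennreal (min \<epsilon> e) \<le> ennreal \<epsilon>" "ennreal (min \<epsilon> e) \<le> ennreal e"
      by (simp_all add: ennreal_leI)
    have "U \<in> ?C \<epsilon>" using U(1,2) le(1) by (auto intro: order_trans)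
    hence "(INF U\<in>?C \<epsilon>. ?v U) \<le> ?v U" by (rule INF_lower)
    also have "\<dots> \<le> 0 + ennreal e" using U(3) le(2) by simp
    finally show "(INF U\<in>?C \<epsilon>. ?v U) \<le> 0 + ennreal e" .
  qed
  hence "hausdorff_measure X d s A \<le> 0"
    unfolding hausdorff_measure_def by (intro SUP_least) simp
  thus ?thesis by simp
qed

lemma hausdorff_dim_le_of_null:
  "0 < s \<Longrightarrow> hausdorff_null X d s A \<Longrightarrow> hausdorff_dim X d A \<le> ennreal s"
  unfolding hausdorff_dim_def by (rule INF_lower) (simp add: hausdorff_measure_zero_of_null)

lemma hausdorff_null_subset:
  "hausdorff_null X d s A \<Longrightarrow> B \<subseteq> A \<Longrightarrow> hausdorff_null X d s B"
  unfolding hausdorff_null_def small_cover_def by (meson order_trans)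

text \<open>
  The cover of the \<open>m\<close>-th set receives the budget \<open>\<epsilon> / 2 ^ (m + 1)\<close>.
\<close>

lemma hausdorff_null_UN:
  fixes A :: "nat \<Rightarrow> 'a set"
  assumes "\<And>m. hausdorff_null X d s (A m)"
  shows "hausdorff_null X d s (\<Union>m. A m)"
  unfolding hausdorff_null_def
proof (intro allI impI)
  fix \<epsilon> :: real assume \<epsilon>: "0 < \<epsilon>"
  define e where "e m = \<epsilon> * (1 / 2) ^ Suc m" for m :: nat
  have e: "e m > 0" "e m \<le> \<epsilon>" for m
  proof -
    show "e m > 0" using \<epsilon> by (simp add: e_def)
    have "(1 / 2 :: real) ^ Suc m \<le> 1" by (rule power_le_one) simp_all
    thus "e m \<le> \<epsilon>" using \<epsilon> unfolding e_def by (simp add: mult_left_le)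
  qed
  have "\<forall>m. \<exists>U. small_cover X d s (A m) (e m) U"
    by (intro allI assms[unfolded hausdorff_null_def, THEN spec, THEN mp] e(1))
  then obtain U :: "nat \<Rightarrow> nat \<Rightarrow> 'a set" where U: "\<And>m i. U m i \<subseteq> X" "\<And>m i. ediam d (U m i) \<le> ennreal
      (e m)"
      "\<And>m. A m \<subseteq> (\<Union>i. U m i)" "\<And>m. (\<Sum>i. ennreal (enn2real (ediam d (U m i)) powr s)) \<le> ennreal (e m)"
    unfolding small_cover_def by metis
  define W where "W i = (case prod_decode i of (m, n) \<Rightarrow> U m n)" for i
  have "(\<forall>i. W i \<subseteq> X \<and> ediam d (W i) \<le> ennreal \<epsilon>)"
    using U(1) order_trans[OF U(2) ennreal_leI[OF e(2)]] unfolding W_def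
    by (auto split: prod.split)
  moreover have "(\<Union>m. A m) \<subseteq> (\<Union>i. W i)"
  proof
    fix x assume "x \<in> (\<Union>m. A m)"
    then obtain m n where "x \<in> U m n" using U(3) by blast
    hence "x \<in> W (prod_encode (m, n))" by (simp add: W_def)
    thus "x \<in> (\<Union>i. W i)" by blast
  qed
  moreover have "(\<Sum>i. ennreal (enn2real (ediam d (W i)) powr s)) \<le> ennreal \<epsilon>"
  proof -
    have "(\<Sum>i. ennreal (enn2real (ediam d (W i)) powr s))
        = (\<Sum>i. (\<lambda>(m, n). ennreal (enn2real (ediam d (U m n)) powr s)) (prod_decode i))"
      by (simp add: W_def case_prod_beta)
    also have "\<dots> = (\<Sum>m. \<Sum>n. ennreal (enn2real (ediam d (U m n)) powr s))"
      by (rule suminf_ennreal_2dimen) simp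
    also have "\<dots> \<le> (\<Sum>m. ennreal (e m))" by (intro suminf_le U(4)) simp_all
    also have "\<dots> = ennreal (\<epsilon> * 1)"
      unfolding e_def using \<epsilon> by (intro suminf_ennreal_eq sums_mult power_half_series) simp
    finally show ?thesis by simp
  qed
  ultimately show "\<exists>U. small_cover X d s (\<Union>m. A m) \<epsilon> U" unfolding small_cover_def by blast
qed

lemma hausdorff_null_empty: "hausdorff_null X d s {}"
  unfolding hausdorff_null_def small_cover_def
  by (intro allI impI exI[of _ "\<lambda>_. {}"]) (simp add: ediam_def bot_ennreal)

lemma hausdorff_null_countable:
  assumes "countable A" "A \<subseteq> X" "\<And>x. x \<in> X \<Longrightarrow> d x x \<le> 0"
  shows "hausdorff_null X d s A"
proof (cases "A = {}")
  case True thus ?thesis by (simp add: hausdorff_null_empty)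
next
  case False
  have "hausdorff_null X d s {from_nat_into A m}" for m
  proof -
    have x: "from_nat_into A m \<in> X" using from_nat_into[OF False, of m] assms(2) by blast
    have "ediam d {from_nat_into A m} = 0"
      using assms(3)[OF x] by (simp add: ediam_def ennreal_neg)
    thus ?thesis
      unfolding hausdorff_null_def small_cover_def using x
      by (intro allI impI exI[of _ "\<lambda>_. {from_nat_into A m}"]) simp
  qed
  hence "hausdorff_null X d s (\<Union>m. {from_nat_into A m})" by (rule hausdorff_null_UN)
  moreover have "A \<subseteq> (\<Union>m. {from_nat_into A m})"
    using range_from_nat_into[OF False assms(1)] by auto
  ultimately show ?thesis by (rule hausdorff_null_subset)
qed

text \<open>
  The convergence half of the Borel-Cantelli lemma: points that lie in infinitely many of the sets are
  covered by any tail of the family, and the tails of a convergent series are small.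
\<close>

lemma hausdorff_null_limsup:
  fixes B :: "'i \<Rightarrow> 'a set"
  assumes s: "0 < s" and r: "\<And>i. i \<in> I \<Longrightarrow> 0 < r i" and sum: "(\<lambda>i. r i powr s) summable_on I"
    and BX: "\<And>i. B i \<subseteq> X" and fin: "finite {i\<in>I. \<not> ediam d (B i) \<le> ennreal (r i)}"
    and A: "\<And>x. x \<in> A \<Longrightarrow> infinite {i\<in>I. x \<in> B i}"
  shows "hausdorff_null X d s A"
  unfolding hausdorff_null_def
proof (intro allI impI)
  fix \<epsilon> :: real assume \<epsilon>: "0 < \<epsilon>"
  \<comment> \<open>The second bound also makes each single radius at most \<open>\<epsilon>\<close>.\<close>
  define \<delta> where "\<delta> = min \<epsilon> (\<epsilon> powr s)"
  have \<delta>: "\<delta> > 0" using \<epsilon> by (simp add: \<delta>_def)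
  obtain S where "((\<lambda>i. r i powr s) has_sum S) I" using sum by (auto simp: summable_on_def)
  hence "eventually (\<lambda>F. dist (\<Sum>i\<in>F. r i powr s) S < \<delta> / 2) (finite_subsets_at_top I)"
    unfolding has_sum_def using \<delta> by (intro tendstoD) simp_all
  then obtain F0 where F0: "finite F0" "F0 \<subseteq> I"
    "\<And>Y. \<lbrakk>finite Y; F0 \<subseteq> Y; Y \<subseteq> I\<rbrakk> \<Longrightarrow> dist (\<Sum>i\<in>Y. r i powr s) S < \<delta> / 2"
    unfolding eventually_finite_subsets_at_top by auto
  define F where "F = F0 \<union> {i\<in>I. \<not> ediam d (B i) \<le> ennreal (r i)}"
  define J where "J = I - F"
  have finF: "finite F" using F0(1) fin by (simp add: F_def)
  have diam: "ediam d (B i) \<le> ennreal (r i)" if "i \<in> J" for i using that by (auto simp: J_def F_def)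
  have small: "(\<Sum>i\<in>G. r i powr s) \<le> \<delta>" if "finite G" "G \<subseteq> J" for G
  proof -
    have "(\<Sum>i\<in>F0 \<union> G. r i powr s) = (\<Sum>i\<in>F0. r i powr s) + (\<Sum>i\<in>G. r i powr s)"
      by (rule sum.union_disjoint) (use F0(1) that in \<open>auto simp: J_def F_def\<close>)
    moreover have "dist (\<Sum>i\<in>F0 \<union> G. r i powr s) S < \<delta> / 2" "dist (\<Sum>i\<in>F0. r i powr s) S < \<delta> / 2"
      using F0(3)[of "F0 \<union> G"] F0(3)[of F0] F0(1,2) that by (auto simp: J_def)
    ultimately show ?thesis by (auto simp: dist_real_def abs_if split: if_splits)
  qed
  have r\<epsilon>: "r i \<le> \<epsilon>" if "i \<in> J" for i
  proof (rule ccontr)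
    assume "\<not> r i \<le> \<epsilon>"
    hence "\<epsilon> powr s < r i powr s" using \<epsilon> s by (intro powr_less_mono2) auto
    moreover have "r i powr s \<le> \<delta>" using small[of "{i}"] that by simp
    ultimately show False by (simp add: \<delta>_def)
  qed
  have "countable {i\<in>I. r i powr s \<noteq> 0}" by (rule summable_countable_real) fact
  moreover have "J \<subseteq> {i\<in>I. r i powr s \<noteq> 0}" using r by (force simp: J_def)
  ultimately have "countable J" by (rule countable_subset[rotated])
  define e where "e = to_nat_on J"
  have e: "inj_on e J" using \<open>countable J\<close> unfolding e_def by (rule inj_on_to_nat_on)
  \<comment> \<open>A union of at most one set: \<open>e\<close> is injective, and unused numbers get the empty set.\<close>
  define U where "U n = (\<Union>i\<in>{i\<in>J. e i = n}. B i)" for n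
  have Ue: "U (e i) = B i" if "i \<in> J" for i
    using that e unfolding U_def by (auto dest: inj_onD)
  have Un: "U n = {}" if "n \<notin> e ` J" for n using that unfolding U_def by auto
  have nil: "ediam d {} = 0" by (simp add: ediam_def bot_ennreal)
  have "\<forall>n. U n \<subseteq> X \<and> ediam d (U n) \<le> ennreal \<epsilon>"
  proof
    fix n
    show "U n \<subseteq> X \<and> ediam d (U n) \<le> ennreal \<epsilon>"
    proof (cases "n \<in> e ` J")
      case True
      then obtain i where i: "i \<in> J" "n = e i" by blast
      show ?thesis
        unfolding i(2) Ue[OF i(1)] using BX diam[OF i(1)] r\<epsilon>[OF i(1)]
        by (auto intro: order_trans ennreal_leI)
    qed (simp add: Un nil)
  qed
  moreover have "A \<subseteq> (\<Union>n. U n)"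
  proof
    fix x assume "x \<in> A"
    hence "infinite ({i\<in>I. x \<in> B i} - F)" using A finF by (simp add: Diff_infinite_finite)
    then obtain i where "i \<in> J" "x \<in> B i" unfolding J_def by (metis (no_types, lifting) Diff_iff
        finite.emptyI equals0I mem_Collect_eq)
    thus "x \<in> (\<Union>n. U n)" using Ue by blast
  qed
  moreover have "(\<Sum>n. ennreal (enn2real (ediam d (U n)) powr s)) \<le> ennreal \<epsilon>"
    unfolding suminf_eq_SUP
  proof (rule SUP_least)
    fix N :: nat
    let ?g = "\<lambda>n. ennreal (enn2real (ediam d (U n)) powr s)"
    define G where "G = {i\<in>J. e i < N}"
    have "finite G"
      by (rule inj_on_finite[of e _ "{..<N}"]) (use e in \<open>auto simp: G_def inj_on_def\<close>)
    have "sum ?g {..<N} = sum ?g (e ` G)"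
    proof (rule sum.mono_neutral_right)
      show "\<forall>n\<in>{..<N} - e ` G. ?g n = 0"
      proof
        fix n assume "n \<in> {..<N} - e ` G"
        hence "n \<notin> e ` J" by (auto simp: G_def)
        thus "?g n = 0" by (simp add: Un nil)
      qed
    qed (auto simp: G_def)
    also have "\<dots> = (\<Sum>i\<in>G. ?g (e i))"
      by (subst sum.reindex) (use e in \<open>auto simp: G_def inj_on_def\<close>)
    also have "\<dots> \<le> (\<Sum>i\<in>G. ennreal (r i powr s))"
    proof (rule sum_mono)
      fix i assume "i \<in> G"
      hence i: "i \<in> J" by (simp add: G_def)
      have "0 \<le> r i" using r[of i] i by (auto simp: J_def)
      hence "enn2real (ediam d (U (e i))) \<le> r i"
        using enn2real_mono[OF diam[OF i]] by (simp add: Ue[OF i])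
      thus "?g (e i) \<le> ennreal (r i powr s)"
        using s by (intro ennreal_leI powr_mono2) auto
    qed
    also have "\<dots> = ennreal (\<Sum>i\<in>G. r i powr s)" by (simp add: sum_ennreal)
    also have "\<dots> \<le> ennreal \<epsilon>"
      using small[OF \<open>finite G\<close>] by (intro ennreal_leI) (auto simp: G_def \<delta>_def)
    finally show "sum ?g {..<N} \<le> ennreal \<epsilon>" .
  qed
  ultimately show "\<exists>U. small_cover X d s A \<epsilon> U" unfolding small_cover_def by blast
qed

section \<open>Smooth paths of orthogonal projections\<close>

lemma has_vector_derivative_iff_quotient:
  "(f has_vector_derivative D) (at t) \<longleftrightarrow>
    ((\<lambda>s. (1 / (s - t)) *\<^sub>R (f s - f t)) \<longlongrightarrow> D) (at (t::real))"
proof -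
  have eq: "norm ((1 / norm (s - t)) *\<^sub>R (f s - (f t + (s - t) *\<^sub>R D)))
      = norm ((1 / (s - t)) *\<^sub>R (f s - f t) - D)" if "s \<noteq> t" for s
  proof -
    have "(1 / (s - t)) *\<^sub>R (f s - f t) - D = (1 / (s - t)) *\<^sub>R (f s - (f t + (s - t) *\<^sub>R D))"
      using that by (simp add: diff_diff_eq[symmetric] scaleR_diff_right[of _ "f s - f t"])
    thus ?thesis by simp
  qed
  have "(f has_vector_derivative D) (at t) \<longleftrightarrow>
      ((\<lambda>s. norm ((1 / norm (s - t)) *\<^sub>R (f s - (f t + (s - t) *\<^sub>R D)))) \<longlongrightarrow> 0) (at t)"
    unfolding has_vector_derivative_def has_derivative_at2 tendsto_norm_zero_iff
    by (simp add: bounded_linear_scaleR_left)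
  also have "\<dots> \<longleftrightarrow> ((\<lambda>s. norm ((1 / (s - t)) *\<^sub>R (f s - f t) - D)) \<longlongrightarrow> 0) (at t)"
    by (rule tendsto_cong) (use eq in \<open>simp add: eventually_at_filter\<close>)
  also have "\<dots> \<longleftrightarrow> ((\<lambda>s. (1 / (s - t)) *\<^sub>R (f s - f t)) \<longlongrightarrow> D) (at t)"
    unfolding tendsto_norm_zero_iff LIM_zero_iff ..
  finally show ?thesis .
qed

lemma matrix_inv_inverse:
  "invertible (A :: 'k::real_or_complex ^ 'n ^ 'n) \<Longrightarrow> A ** matrix_inv A = mat 1 \<and> matrix_inv A ** A =
      mat 1"
  unfolding matrix_inv_def invertible_def by (rule someI_ex)

lemma bounded_below_matrix_inv:
  fixes M :: "'k::real_or_complex ^ 'n ^ 'n"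
  assumes c: "0 < c" and low: "\<And>v. c * norm v \<le> norm (M *v v)"
  shows "M ** matrix_inv M = mat 1" "matrix_inv M ** M = mat 1"
    and "norm (matrix_inv M) \<le> sqrt CARD('n) / c"
proof -
  have "v = 0" if "M *v v = 0" for v using low[of v] c that by (simp add: mult_le_0_iff)
  hence "invertible M" by (simp add: invertible_left_inverse matrix_left_invertible_ker)
  from matrix_inv_inverse[OF this] show 1: "M ** matrix_inv M = mat 1" and "matrix_inv M ** M = mat
      1" by auto
  have "norm (matrix_inv M *v v) \<le> (1 / c) * norm v" for v
  proof -
    have "c * norm (matrix_inv M *v v) \<le> norm (M *v (matrix_inv M *v v))" by (rule low)
    also have "\<dots> = norm v" by (simp add: matrix_vector_mul_assoc 1)
    finally show ?thesis using c by (simp add: field_simps)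
  qed
  from norm_le_of_mv[OF this] show "norm (matrix_inv M) \<le> sqrt CARD('n) / c" using c by simp
qed

text \<open>
  A uniform lower bound for \<open>M\<close> near \<open>t\<close> bounds the inverses. Then the identity
  \<open>N s - N t = - N s (M s - M t) N t\<close> gives first the continuity and then the derivative of the
  inverse.
\<close>

lemma has_vector_derivative_matrix_inv:
  fixes M :: "real \<Rightarrow> 'k::real_or_complex ^ 'n ^ 'n"
  assumes M: "(M has_vector_derivative M') (at t)" and S: "open S" "t \<in> S" and c: "0 < c"
    and low: "\<And>s v. s \<in> S \<Longrightarrow> c * norm v \<le> norm (M s *v v)"
  shows "((\<lambda>s. matrix_inv (M s)) has_vector_derivative - (matrix_inv (M t) ** M' ** matrix_inv (M
      t))) (at t)"
proof -
  define N where "N s = matrix_inv (M s)" for s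
  have N: "M s ** N s = mat 1" "N s ** M s = mat 1" "norm (N s) \<le> sqrt CARD('n) / c" if "s \<in> S" for s
    unfolding N_def using bounded_below_matrix_inv[OF c low[OF that]] by auto
  have diff: "N s - N t = - (N s ** (M s - M t) ** N t)" if "s \<in> S" for s
  proof -
    have "N s ** (M s ** N t) = N t" "N s ** (M t ** N t) = N s"
      using N[OF that] N[OF S(2)] by (simp_all add: matrix_mul_assoc)
    thus ?thesis by (simp add: mm.diff_left mm.diff_right matrix_mul_assoc[symmetric])
  qed
  have nhd: "\<forall>\<^sub>F s in at t. s \<in> S" unfolding eventually_at_topological using S by blast
  have Mt: "(M \<longlongrightarrow> M t) (at t)"
    using has_vector_derivative_continuous[OF M] by (simp add: continuous_at)
  have q: "((\<lambda>s. (1 / (s - t)) *\<^sub>R (M s - M t)) \<longlongrightarrow> M') (at t)"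
    using M unfolding has_vector_derivative_iff_quotient .
  have Nt: "(N \<longlongrightarrow> N t) (at t)"
  proof -
    have "((\<lambda>s. (sqrt CARD('n) / c) * norm (M s - M t) * norm (N t)) \<longlongrightarrow> (sqrt CARD('n) / c) * norm (M
        t - M t) * norm (N t)) (at t)"
      by (intro tendsto_intros Mt)
    hence lim: "((\<lambda>s. (sqrt CARD('n) / c) * norm (M s - M t) * norm (N t)) \<longlongrightarrow> 0) (at t)" by simp
    have "((\<lambda>s. N s - N t) \<longlongrightarrow> 0) (at t)"
    proof (rule Lim_null_comparison[OF _ lim])
      show "\<forall>\<^sub>F s in at t. norm (N s - N t) \<le> (sqrt CARD('n) / c) * norm (M s - M t) * norm (N t)"
        using nhd
      proof (rule eventually_mono)
        fix s assume s: "s \<in> S"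
        have "norm (N s - N t) \<le> norm (N s) * norm (M s - M t) * norm (N t)"
          unfolding diff[OF s] norm_minus_cancel
          by (intro order_trans[OF norm_mm_le] mult_right_mono norm_mm_le) simp
        also have "\<dots> \<le> (sqrt CARD('n) / c) * norm (M s - M t) * norm (N t)"
          by (intro mult_right_mono N s) simp_all
        finally show "norm (N s - N t) \<le> (sqrt CARD('n) / c) * norm (M s - M t) * norm (N t)" .
      qed
    qed
    thus ?thesis by (simp add: LIM_zero_iff)
  qed
  have "((\<lambda>s. - (N s ** ((1 / (s - t)) *\<^sub>R (M s - M t)) ** N t)) \<longlongrightarrow> - (N t ** M' ** N t)) (at t)"
    by (intro tendsto_minus mm.tendsto Nt q tendsto_const)
  moreover have "\<forall>\<^sub>F s in at t. - (N s ** ((1 / (s - t)) *\<^sub>R (M s - M t)) ** N t) = (1 / (s - t))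
      *\<^sub>R (N s - N t)"
    using nhd
  proof (rule eventually_mono)
    fix s assume s: "s \<in> S"
    show "- (N s ** ((1 / (s - t)) *\<^sub>R (M s - M t)) ** N t) = (1 / (s - t)) *\<^sub>R (N s - N t)"
      unfolding diff[OF s] by (simp add: mat_scaleR_left mat_scaleR_right)
  qed
  ultimately show ?thesis
    unfolding has_vector_derivative_iff_quotient N_def[symmetric]
    by (rule Lim_transform_eventually)
qed

lemma norm_mm_mono: "norm A \<le> a \<Longrightarrow> norm B \<le> b \<Longrightarrow> norm (A ** B) \<le> a * b"
  for A :: "'k::real_or_complex ^ 'n ^ 'n" and B :: "'k ^ 'n ^ 'n"
  by (rule order_trans[OF norm_mm_le]) (rule mult_mono, auto intro: order_trans[OF norm_ge_zero])

lemma norm_mat_one: "norm (mat 1 :: 'k::real_or_complex ^ 'n ^ 'n) \<le> sqrt CARD('n)"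
  using norm_le_of_mv[of "mat 1 :: 'k ^ 'n ^ 'n" 1] by simp

lemma near_one_bounded_below:
  fixes X :: "'k::real_or_complex ^ 'n ^ 'n"
  assumes X: "norm X \<le> 1 / 4" and t: "\<bar>t\<bar> \<le> 2"
  shows "norm v / 2 \<le> norm ((mat 1 + t *\<^sub>R X) *v v)"
proof -
  have "norm ((t *\<^sub>R X) *v v) \<le> norm (t *\<^sub>R X) * norm v" by (rule norm_mv_le)
  also have "\<dots> \<le> (2 * (1 / 4)) * norm v"
    unfolding norm_scaleR by (intro mult_right_mono mult_mono X t) simp_all
  finally have "norm ((t *\<^sub>R X) *v v) \<le> norm v / 2" by simp
  moreover have "norm v \<le> norm (v + (t *\<^sub>R X) *v v) + norm ((t *\<^sub>R X) *v v)"
    using norm_triangle_ineq4[of "v + (t *\<^sub>R X) *v v" "(t *\<^sub>R X) *v v"] by simp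
  ultimately show ?thesis by (simp add: mv.add_left)
qed

text \<open>
  This is \<open>P ** adj A ** A ** P\<close> on the range of \<open>P\<close>, made invertible by the identity on the kernel.
\<close>

definition gram :: "'k::real_or_complex ^ 'n ^ 'n \<Rightarrow> 'k ^ 'n ^ 'n \<Rightarrow> 'k ^ 'n ^ 'n" where
  "gram A P = P ** adj A ** A ** P + (mat 1 - P)"

text \<open>
  For injective \<open>A\<close> this is the orthogonal projection onto the image under \<open>A\<close> of the range of
  \<open>P\<close>. The formula, a hermitian form of the normal equations, shows that it depends smoothly on
  \<open>A\<close>.
\<close>

definition image_proj :: "'k::real_or_complex ^ 'n ^ 'n \<Rightarrow> 'k ^ 'n ^ 'n \<Rightarrow> 'k ^ 'n ^ 'n" where
  "image_proj A P = A ** P ** matrix_inv (gram A P) ** P ** adj A"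

lemma gram_bounded_below:
  fixes A P :: "'k::real_or_complex ^ 'n ^ 'n"
  assumes P: "orth_proj P" and A: "\<And>v. norm v / 2 \<le> norm (A *v v)"
  shows "(1 / 4) * norm v \<le> norm (gram A P *v v)"
proof -
  have "v \<bullet> (gram A P *v v) = v \<bullet> (P *v (adj A *v (A *v (P *v v)))) + v \<bullet> (v - P *v v)"
    by (simp add: gram_def mv.add_left mv.diff_left matrix_vector_mul_assoc[symmetric] inner_add_right)
  also have "v \<bullet> (P *v (adj A *v (A *v (P *v v)))) = (A *v (P *v v)) \<bullet> (A *v (P *v v))"
    by (simp add: inner_adj[of A] inner_adj[of P] orth_proj_adj[OF P])
  also have "v \<bullet> (v - P *v v) = (norm (v - P *v v))\<^sup>2"
  proof -
    have "(P *v v) \<bullet> (v - P *v v) = 0"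
      by (simp add: inner_adj orth_proj_adj[OF P] mv.diff_right orth_proj_idem_mv[OF P])
    thus ?thesis by (simp add: power2_norm_eq_inner inner_diff_left)
  qed
  also have "(A *v (P *v v)) \<bullet> (A *v (P *v v)) = (norm (A *v (P *v v)))\<^sup>2" by (simp add:
      power2_norm_eq_inner)
  finally have eq: "v \<bullet> (gram A P *v v) = (norm (A *v (P *v v)))\<^sup>2 + (norm (v - P *v v))\<^sup>2" .
  have "(norm (P *v v) / 2)\<^sup>2 \<le> (norm (A *v (P *v v)))\<^sup>2" by (intro power_mono A) simp
  hence "(norm (P *v v))\<^sup>2 / 4 \<le> (norm (A *v (P *v v)))\<^sup>2" by (simp add: power_divide)
  hence "(1 / 4) * (norm v)\<^sup>2 \<le> v \<bullet> (gram A P *v v)"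
  proof -
    have aux: "(1 / 4) * (a + b) \<le> c + b" if "a / 4 \<le> c" "0 \<le> b" for a b c :: real
      using that by simp
    assume "(norm (P *v v))\<^sup>2 / 4 \<le> (norm (A *v (P *v v)))\<^sup>2"
    thus ?thesis unfolding eq norm_orth_proj_pyth[OF P, of v] by (rule aux) simp
  qed
  also have "\<dots> \<le> norm v * norm (gram A P *v v)" by (rule norm_cauchy_schwarz)
  finally have "norm v * ((1 / 4) * norm v) \<le> norm v * norm (gram A P *v v)"
    by (simp add: power2_eq_square)
  thus ?thesis by (cases "v = 0") simp_all
qed

lemma image_proj:
  fixes A P :: "'k::real_or_complex ^ 'n ^ 'n"
  assumes P: "orth_proj P" and A: "\<And>v. norm v / 2 \<le> norm (A *v v)"
  shows "orth_proj (image_proj A P)" "range ((*v) (image_proj A P)) = (*v) A ` range ((*v) P)"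
proof -
  define M where "M = gram A P"
  define N where "N = matrix_inv M"
  have MN: "M ** N = mat 1" and NM: "N ** M = mat 1"
    unfolding M_def N_def by (rule bounded_below_matrix_inv[OF _ gram_bounded_below[OF P A]], simp)+
  note s = orth_proj_adj[OF P] orth_proj_idem[OF P] orth_proj_idem2[OF P]
  have adjM: "adj M = M" by (simp add: M_def gram_def adj_add adj_diff adj_mult s matrix_mul_assoc)
  have "adj N ** M = mat 1" using arg_cong[OF MN, of adj] by (simp add: adj_mult adjM)
  hence "adj N ** M ** N = N" by simp
  hence adjN: "adj N = N" by (simp add: matrix_mul_assoc[symmetric] MN)
  have MP: "M ** P = P ** adj A ** A ** P"
    by (simp add: M_def gram_def mm.add_left mm.diff_left s matrix_mul_assoc[symmetric])
  have c: "image_proj A P = A ** P ** N ** P ** adj A" by (simp add: image_proj_def N_def M_def)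
  have cAP: "image_proj A P ** A ** P = A ** P"
  proof -
    have "image_proj A P ** A ** P = A ** P ** N ** (P ** adj A ** A ** P)"
      by (simp add: c matrix_mul_assoc)
    also have "\<dots> = A ** P ** (N ** M) ** P" unfolding MP[symmetric] by (simp add: matrix_mul_assoc)
    also have "\<dots> = A ** P" by (simp add: NM s matrix_mul_assoc[symmetric])
    finally show ?thesis .
  qed
  show "orth_proj (image_proj A P)"
    unfolding orth_proj_def
  proof
    show "adj (image_proj A P) = image_proj A P"
      by (simp add: c adj_mult adjN s matrix_mul_assoc)
    have "image_proj A P ** image_proj A P = image_proj A P ** A ** P ** N ** P ** adj A"
      by (simp add: c matrix_mul_assoc)
    thus "image_proj A P ** image_proj A P = image_proj A P" unfolding cAP by (simp add: c)
  qed
  show "range ((*v) (image_proj A P)) = (*v) A ` range ((*v) P)"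
  proof
    show "range ((*v) (image_proj A P)) \<subseteq> (*v) A ` range ((*v) P)"
      by (auto simp: c matrix_vector_mul_assoc[symmetric])
    show "(*v) A ` range ((*v) P) \<subseteq> range ((*v) (image_proj A P))"
    proof safe
      fix x
      have "A *v (P *v x) = image_proj A P *v (A *v (P *v x))"
        using arg_cong[OF cAP, of "\<lambda>C. C *v x"] by (simp add: matrix_vector_mul_assoc[symmetric])
      thus "A *v (P *v x) \<in> range ((*v) (image_proj A P))" by (metis rangeI)
    qed
  qed
qed

lemma path_speed_constant:
  "x * q * (4 * q) * q * (2 * q)
      + 2 * q * q * (4 * q * (q * x * (2 * q) * q + q * (2 * q) * x * q) * (4 * q)) * q * (2 * q)
      + 2 * q * q * (4 * q) * q * x = (16 * q ^ 4 + 256 * q ^ 9) * (x :: real)"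
proof -
  have e: "q ^ 4 = q*q*q*q" "q ^ 9 = q*q*q*q*q*q*q*q*q" by (simp_all add: eval_nat_numeral)
  show ?thesis unfolding e by (simp add: algebra_simps)
qed

text \<open>
  The derivative of every factor of the projection is a bounded multiple of \<open>X\<close>, since the Gram matrices
  stay uniformly invertible on a neighbourhood of the unit interval.
\<close>

lemma image_proj_path:
  fixes P X :: "'k::real_or_complex ^ 'n ^ 'n"
  defines "q \<equiv> sqrt CARD('n)"
  assumes P: "orth_proj P" and X: "norm X \<le> 1 / 4"
  obtains D where "\<And>t. t \<in> {0..1} \<Longrightarrow>
      ((\<lambda>t. image_proj (mat 1 + t *\<^sub>R X) P) has_vector_derivative D t) (at t) \<and>
      norm (D t) \<le> (16 * q ^ 4 + 256 * q ^ 9) * norm X"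
    "continuous_on {0..1} D"
proof -
  \<comment> \<open>Two-sided derivatives at 0 and 1 require an open interval around the unit interval.\<close>
  define S where "S = {-1<..<(2::real)}"
  have S: "open S" by (simp add: S_def)
  define A where "A t = mat 1 + t *\<^sub>R X" for t :: real
  define M where "M t = gram (A t) P" for t
  define N where "N t = matrix_inv (M t)" for t
  define M' where "M' t = P ** adj X ** A t ** P + P ** adj (A t) ** X ** P" for t
  define N' where "N' t = - (N t ** M' t ** N t)" for t
  define D where "D t = X ** P ** N t ** P ** adj (A t) + A t ** P ** N' t ** P ** adj (A t)
    + A t ** P ** N t ** P ** adj X" for t
  have Alow: "norm v / 2 \<le> norm (A t *v v)" if "t \<in> S" for t v
    unfolding A_def by (rule near_one_bounded_below[OF X]) (use that in \<open>auto simp: S_def\<close>)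
  have Mlow: "(1 / 4) * norm v \<le> norm (M t *v v)" if "t \<in> S" for t v
    unfolding M_def by (rule gram_bounded_below[OF P Alow[OF that]])
  have dA: "(A has_vector_derivative X) (at t)" for t
    unfolding A_def by (auto intro!: derivative_eq_intros)
  have dA': "((\<lambda>t. adj (A t)) has_vector_derivative adj X) (at t)" for t
    by (rule bounded_linear.has_vector_derivative[OF bounded_linear_adj dA])
  note dm = mm.has_vector_derivative
  have dM: "(M has_vector_derivative M' t) (at t)" for t
  proof -
    have "((\<lambda>t. P ** adj (A t) ** A t ** P + (mat 1 - P)) has_vector_derivative
        (P ** adj (A t) ** A t ** 0 + (P ** adj (A t) ** X + (P ** adj X + 0 ** adj (A t)) ** A t)
            ** P) + 0) (at t)"
      by (intro has_vector_derivative_add dm dA dA' has_vector_derivative_const)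
    moreover have "(P ** adj (A t) ** A t ** 0 + (P ** adj (A t) ** X + (P ** adj X + 0 ** adj (A
        t)) ** A t) ** P) + 0 = M' t"
      by (simp add: M'_def mm.zero_left mm.zero_right mm.add_left add.commute)
    ultimately show ?thesis unfolding M_def gram_def by simp
  qed
  have dN: "(N has_vector_derivative N' t) (at t)" if "t \<in> S" for t
    unfolding N_def N'_def
    by (rule has_vector_derivative_matrix_inv[OF dM S that _ Mlow]) simp_all
  have dc: "((\<lambda>t. image_proj (A t) P) has_vector_derivative D t) (at t)" if "t \<in> S" for t
  proof -
    have "((\<lambda>t. A t ** P ** N t ** P ** adj (A t)) has_vector_derivative
        (A t ** P ** N t ** P ** adj X +
          (A t ** P ** N t ** 0 + (A t ** P ** N' t + (A t ** 0 + X ** P) ** N t) ** P) ** adj (A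
              t))) (at t)"
      by (intro dm dA dA' dN that has_vector_derivative_const)
    moreover have "A t ** P ** N t ** P ** adj X +
          (A t ** P ** N t ** 0 + (A t ** P ** N' t + (A t ** 0 + X ** P) ** N t) ** P) ** adj (A t)
              = D t"
      by (simp add: D_def mm.zero_right mm.add_left algebra_simps)
    ultimately show ?thesis unfolding image_proj_def N_def M_def by simp
  qed
  have q: "1 \<le> q" unfolding q_def by simp
  have nP: "norm P \<le> q" unfolding q_def by (rule norm_orth_proj[OF P])
  have nA: "norm (A t) \<le> 2 * q" if "t \<in> {0..1}" for t
  proof -
    have "norm (A t) \<le> q + norm (t *\<^sub>R X)"
      unfolding A_def q_def using norm_triangle_ineq[of "mat 1" "t *\<^sub>R X"] norm_mat_one[where 'k='k
          and 'n='n] by linarith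
    moreover have "norm (t *\<^sub>R X) \<le> 1 * (1/4)"
      unfolding norm_scaleR by (intro mult_mono X) (use that in auto)
    ultimately show ?thesis using q by linarith
  qed
  have nA': "norm (adj (A t)) \<le> 2 * q" if "t \<in> {0..1}" for t using nA[OF that] by simp
  have inS: "t \<in> S" if "t \<in> {0..1}" for t using that by (auto simp: S_def)
  have nN: "norm (N t) \<le> 4 * q" if "t \<in> {0..1}" for t
    using bounded_below_matrix_inv(3)[OF _ Mlow[OF inS[OF that]]] by (simp add: N_def q_def)
  define x where "x = norm X"
  have nX: "norm X \<le> x" "norm (adj X) \<le> x" by (simp_all add: x_def)
  have nM': "norm (M' t) \<le> q * x * (2 * q) * q + q * (2 * q) * x * q" if "t \<in> {0..1}" for t
    unfolding M'_def using that
    by (intro order_trans[OF norm_triangle_ineq] add_mono norm_mm_mono nP nX nA nA')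
  have nN': "norm (N' t) \<le> 4 * q * (q * x * (2 * q) * q + q * (2 * q) * x * q) * (4 * q)" if "t \<in>
      {0..1}" for t
    unfolding N'_def norm_minus_cancel using that by (intro norm_mm_mono nN nM')
  have nD: "norm (D t) \<le> (16 * q ^ 4 + 256 * q ^ 9) * norm X" if "t \<in> {0..1}" for t
  proof -
    have "norm (D t) \<le> x * q * (4 * q) * q * (2 * q)
        + 2 * q * q * (4 * q * (q * x * (2 * q) * q + q * (2 * q) * x * q) * (4 * q)) * q * (2 * q)
        + 2 * q * q * (4 * q) * q * x"
      unfolding D_def using that
      by (intro order_trans[OF norm_triangle_ineq] add_mono norm_mm_mono nP nX nA nA' nN nN')
    also have "\<dots> = (16 * q ^ 4 + 256 * q ^ 9) * x"
      by (rule path_speed_constant)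
    finally show ?thesis by (simp add: x_def)
  qed
  have cA: "continuous_on {0..1} A" "continuous_on {0..1} (\<lambda>t. adj (A t))" "continuous_on {0..1} N"
    by (rule continuous_on_vector_derivative[OF has_vector_derivative_at_within[OF dA]]
        continuous_on_vector_derivative[OF has_vector_derivative_at_within[OF dA']]
        continuous_on_vector_derivative[OF has_vector_derivative_at_within[OF dN[OF inS]]], assumption?)+
  have "continuous_on {0..1} D"
    unfolding D_def N'_def M'_def by (intro continuous_intros mm.continuous_on cA)
  moreover have "((\<lambda>t. image_proj (mat 1 + t *\<^sub>R X) P) has_vector_derivative D t) (at t) \<and>
      norm (D t) \<le> (16 * q ^ 4 + 256 * q ^ 9) * norm X" if "t \<in> {0..1}" for t
    using dc[OF inS[OF that]] nD[OF that] by (simp add: A_def)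
  ultimately show thesis using that by blast
qed

text \<open>
  Two commuting projections have four joint spectral projections. The intertwiner maps each of those of
  \<open>(P, R)\<close> to the corresponding one of \<open>(Q, S)\<close>. Components of a flag have commuting projections
  whichever of the two contains the other, so this treats both inclusions in the same way.
\<close>

definition intertwiner :: "'k::real_or_complex ^ 'n ^ 'n \<Rightarrow> 'k ^ 'n ^ 'n \<Rightarrow> 'k ^ 'n ^ 'n \<Rightarrow> 'k ^ 'n ^
    'n \<Rightarrow> 'k ^ 'n ^ 'n" where
  "intertwiner P R Q S = Q ** S ** (P ** R) + Q ** (mat 1 - S) ** (P ** (mat 1 - R))
     + (mat 1 - Q) ** S ** ((mat 1 - P) ** R) + (mat 1 - Q) ** (mat 1 - S) ** ((mat 1 - P) ** (mat 1
         - R))"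

lemma left_commute_mm: "P ** R = R ** P \<Longrightarrow> R ** (P ** A) = P ** (R ** A)"
  for P R A :: "'k::real_or_complex ^ 'n ^ 'n"
  by (simp add: matrix_mul_assoc)

lemma orth_proj_blocks:
  assumes P: "orth_proj P" and R: "orth_proj R" and PR: "P ** R = R ** P"
  shows "P ** R ** P = P ** R" "P ** R ** R = P ** R"
    "P ** (P ** R) = P ** R" "R ** (P ** R) = P ** R"
    "(mat 1 - P) ** R ** P = 0" "P ** ((mat 1 - P) ** R) = 0"
    "P ** (mat 1 - R) ** R = 0" "R ** (P ** (mat 1 - R)) = 0"
  using P R PR[symmetric] left_commute_mm[OF PR]
  by (simp_all add: orth_proj_idem orth_proj_idem2 mm.diff_left mm.diff_right
      matrix_mul_assoc[symmetric])

text \<open>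
  Multiplying a joint spectral projection by \<open>P\<close> or \<open>R\<close> either fixes or kills it, in the same
  pattern for both pairs.
\<close>

lemma intertwiner:
  assumes P: "orth_proj P" and R: "orth_proj R" and Q: "orth_proj Q" and S: "orth_proj S"
    and PR: "P ** R = R ** P" and QS: "Q ** S = S ** Q"
  shows "intertwiner P R Q S ** P = Q ** intertwiner P R Q S"
    and "intertwiner P R Q S ** R = S ** intertwiner P R Q S"
    and "intertwiner P R P R = mat 1"
proof -
  have compl: "a ** (mat 1 - b) = (mat 1 - b) ** a" "(mat 1 - a) ** b = b ** (mat 1 - a)"
    "(mat 1 - a) ** (mat 1 - b) = (mat 1 - b) ** (mat 1 - a)"
    if "a ** b = b ** a" for a b :: "'a ^ 'b ^ 'b"
    using that by (simp_all add: mm.diff_left mm.diff_right)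
  have blocks: "a ** b ** a = a ** b" "a ** b ** b = a ** b"
     "a ** (mat 1 - b) ** a = a ** (mat 1 - b)" "a ** (mat 1 - b) ** b = 0"
     "(mat 1 - a) ** b ** a = 0" "(mat 1 - a) ** b ** b = (mat 1 - a) ** b"
     "(mat 1 - a) ** (mat 1 - b) ** a = 0" "(mat 1 - a) ** (mat 1 - b) ** b = 0"
     "a ** (a ** b) = a ** b" "b ** (a ** b) = a ** b"
     "a ** (a ** (mat 1 - b)) = a ** (mat 1 - b)" "b ** (a ** (mat 1 - b)) = 0"
     "a ** ((mat 1 - a) ** b) = 0" "b ** ((mat 1 - a) ** b) = (mat 1 - a) ** b"
     "a ** ((mat 1 - a) ** (mat 1 - b)) = 0" "b ** ((mat 1 - a) ** (mat 1 - b)) = 0"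
    if a: "orth_proj a" and b: "orth_proj b" and ab: "a ** b = b ** a" for a b :: "'a ^ 'b ^ 'b"
    using orth_proj_blocks[OF a b ab] orth_proj_blocks[OF a orth_proj_compl[OF b] compl(1)[OF ab]]
      orth_proj_blocks[OF orth_proj_compl[OF a] b compl(2)[OF ab]]
    by simp_all
  define E1 E2 E3 E4 where E: "E1 = P ** R" "E2 = P ** (mat 1 - R)" "E3 = (mat 1 - P) ** R"
    "E4 = (mat 1 - P) ** (mat 1 - R)"
  define F1 F2 F3 F4 where F: "F1 = Q ** S" "F2 = Q ** (mat 1 - S)" "F3 = (mat 1 - Q) ** S"
    "F4 = (mat 1 - Q) ** (mat 1 - S)"
  have G: "intertwiner P R Q S = F1 ** E1 + F2 ** E2 + F3 ** E3 + F4 ** E4"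
    by (simp add: intertwiner_def E F)
  note e = blocks(1-8)[OF P R PR, folded E] and f = blocks(9-16)[OF Q S QS, folded F]
  have f': "Q ** (F1 ** A) = F1 ** A" "S ** (F1 ** A) = F1 ** A"
    "Q ** (F2 ** A) = F2 ** A" "S ** (F2 ** A) = 0" "Q ** (F3 ** A) = 0" "S ** (F3 ** A) = F3 ** A"
    "Q ** (F4 ** A) = 0" "S ** (F4 ** A) = 0" for A
    by (simp_all add: matrix_mul_assoc f)
  show "intertwiner P R Q S ** P = Q ** intertwiner P R Q S"
    and "intertwiner P R Q S ** R = S ** intertwiner P R Q S"
    unfolding G by (simp_all add: mm.add_left mm.add_right f' e matrix_mul_assoc[symmetric])
  have idem: "E1 ** E1 = E1" "E2 ** E2 = E2" "E3 ** E3 = E3" "E4 ** E4 = E4"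
  proof -
    have "E1 ** E1 = E1 ** P ** R" "E2 ** E2 = E2 ** P ** (mat 1 - R)"
      "E3 ** E3 = E3 ** (mat 1 - P) ** R" "E4 ** E4 = E4 ** (mat 1 - P) ** (mat 1 - R)"
      by (simp_all only: E matrix_mul_assoc)
    thus "E1 ** E1 = E1" "E2 ** E2 = E2" "E3 ** E3 = E3" "E4 ** E4 = E4"
      by (simp_all add: e mm.diff_right)
  qed
  have "intertwiner P R P R = E1 ** E1 + E2 ** E2 + E3 ** E3 + E4 ** E4"
    by (simp add: intertwiner_def E)
  also have "\<dots> = (E1 + E2) + (E3 + E4)" by (simp add: idem)
  also have "E1 + E2 = P" by (simp add: E mm.diff_right)
  also have "E3 + E4 = mat 1 - P" by (simp add: E mm.diff_right)
  finally show "intertwiner P R P R = mat 1" by simp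
qed

lemma norm_intertwiner:
  fixes P R Q S :: "'k::real_or_complex ^ 'n ^ 'n"
  assumes P: "orth_proj P" and R: "orth_proj R" and Q: "orth_proj Q" and S: "orth_proj S"
    and PR: "P ** R = R ** P"
  shows "norm (intertwiner P R Q S - mat 1)
    \<le> 4 * sqrt CARD('n) ^ 3 * (norm (Q - P) + norm (S - R))"
proof -
  define q where "q = sqrt CARD('n)"
  have block: "norm (c ** d ** (a ** b) - a ** b ** (a ** b)) \<le> q ^ 3 * (norm (c - a) + norm (d - b))"
    if "orth_proj a" "orth_proj b" "orth_proj c" "orth_proj d" for a b c d :: "'k ^ 'n ^ 'n"
  proof -
    have n: "norm a \<le> q" "norm b \<le> q" "norm d \<le> q"
      using that norm_orth_proj unfolding q_def by blast+
    have "c ** d ** (a ** b) - a ** b ** (a ** b) = ((c - a) ** d + a ** (d - b)) ** (a ** b)"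
      by (simp add: mm.diff_left mm.diff_right mm.add_left)
    also have "norm \<dots> \<le> (norm (c - a) * q + q * norm (d - b)) * (q * q)"
      by (intro norm_mm_mono order_trans[OF norm_triangle_ineq] add_mono n order_refl)
    also have "\<dots> = q ^ 3 * (norm (c - a) + norm (d - b))"
      by (simp add: algebra_simps power3_eq_cube)
    finally show ?thesis .
  qed
  have c: "norm ((mat 1 - Q) - (mat 1 - P)) = norm (Q - P)" "norm ((mat 1 - S) - (mat 1 - R)) = norm
      (S - R)"
    using norm_minus_commute[of P Q] norm_minus_commute[of R S] by simp_all
  note o = P R Q S orth_proj_compl[OF P] orth_proj_compl[OF R] orth_proj_compl[OF Q]
      orth_proj_compl[OF S]
  let ?e = "q ^ 3 * (norm (Q - P) + norm (S - R))"
  let ?E = "\<lambda>a b c d. c ** d ** (a ** b) :: 'k ^ 'n ^ 'n"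
  let ?\<Delta> = "\<lambda>a b c d. ?E a b c d - ?E a b a b"
  have t: "norm (?\<Delta> P R Q S) \<le> ?e" "norm (?\<Delta> P (mat 1 - R) Q (mat 1 - S)) \<le> ?e"
    "norm (?\<Delta> (mat 1 - P) R (mat 1 - Q) S) \<le> ?e"
    "norm (?\<Delta> (mat 1 - P) (mat 1 - R) (mat 1 - Q) (mat 1 - S)) \<le> ?e"
    using block[of P R Q S] block[of P "mat 1 - R" Q "mat 1 - S"] block[of "mat 1 - P" R "mat 1 - Q" S]
      block[of "mat 1 - P" "mat 1 - R" "mat 1 - Q" "mat 1 - S"] o unfolding c by blast+
  have "intertwiner P R Q S - mat 1 = intertwiner P R Q S - intertwiner P R P R"
    using intertwiner(3)[OF P R P R PR PR] by simp
  also have "\<dots> = ?\<Delta> P R Q S + ?\<Delta> P (mat 1 - R) Q (mat 1 - S) + ?\<Delta> (mat 1 - P) R (mat 1 - Q) S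
      + ?\<Delta> (mat 1 - P) (mat 1 - R) (mat 1 - Q) (mat 1 - S)"
    unfolding intertwiner_def by (simp only: add_diff_add)
  also have "norm \<dots> \<le> ?e + ?e + ?e + ?e"
    by (intro order_trans[OF norm_triangle_ineq] add_mono t)
  finally show ?thesis by (simp add: q_def)
qed

section \<open>Comparison of Riemannian and Euclidean distances\<close>

lemma bilinear_expand:
  fixes u v :: "'e::euclidean_space"
  assumes "bilinear h"
  shows "h u v = (\<Sum>i\<in>Basis. \<Sum>j\<in>Basis. (u \<bullet> i) * (v \<bullet> j) * (h i j :: real))"
proof -
  have "h u v = h (\<Sum>i\<in>Basis. (u \<bullet> i) *\<^sub>R i) (\<Sum>j\<in>Basis. (v \<bullet> j) *\<^sub>R j)"
    by (simp add: euclidean_representation)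
  also have "\<dots> = (\<Sum>(i, j)\<in>Basis \<times> Basis. (u \<bullet> i) * (v \<bullet> j) * h i j)"
    unfolding bilinear_sum[OF assms] by (simp add: bilinear_lmul[OF assms] bilinear_rmul[OF assms]
        mult_ac)
  also have "\<dots> = (\<Sum>i\<in>Basis. \<Sum>j\<in>Basis. (u \<bullet> i) * (v \<bullet> j) * h i j)"
    by (simp add: sum.cartesian_product)
  finally show ?thesis .
qed

lemma riemannian_metric_continuous:
  assumes "riemannian_metric N g" shows "continuous_on N (\<lambda>p. g p u v)"
proof -
  obtain S where "N \<subseteq> S" "\<forall>u v m. Ck_on m S (\<lambda>p. g p u v)"
    using assms unfolding riemannian_metric_def by blast
  hence "Ck_on 0 S (\<lambda>p. g p u v)" by blast
  thus ?thesis using \<open>N \<subseteq> S\<close> by (auto intro: continuous_on_subset)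
qed

text \<open>
  On a compact set the finitely many coefficients of the metric in a basis are bounded.
\<close>

lemma riemannian_metric_bounded:
  assumes N: "compact N" and g: "riemannian_metric N g"
  obtains K where "0 \<le> K" "\<And>p u. p \<in> N \<Longrightarrow> g p u u \<le> K * (norm u)\<^sup>2"
proof -
  have "\<exists>k. \<forall>p\<in>N. \<bar>g p i j\<bar> \<le> k" for i j
  proof -
    have "bounded ((\<lambda>p. g p i j) ` N)"
      by (intro compact_imp_bounded compact_continuous_image riemannian_metric_continuous g N)
    thus ?thesis unfolding bounded_iff by auto
  qed
  then obtain k where k: "\<And>i j p. p \<in> N \<Longrightarrow> \<bar>g p i j\<bar> \<le> k i j" by metis
  define K where "K = (\<Sum>i\<in>Basis. \<Sum>j\<in>Basis. \<bar>k i j\<bar>)"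
  have "g p u u \<le> K * (norm u)\<^sup>2" if p: "p \<in> N" for p u
  proof -
    have "bilinear (g p)" using g p unfolding riemannian_metric_def by blast
    hence "g p u u = (\<Sum>i\<in>Basis. \<Sum>j\<in>Basis. (u \<bullet> i) * (u \<bullet> j) * g p i j)" by (rule bilinear_expand)
    also have "\<dots> \<le> (\<Sum>i\<in>Basis. \<Sum>j\<in>Basis. \<bar>k i j\<bar> * (norm u)\<^sup>2)"
    proof (intro sum_mono)
      fix i j :: 'a assume ij: "i \<in> Basis" "j \<in> Basis"
      have "(u \<bullet> i) * (u \<bullet> j) * g p i j \<le> \<bar>u \<bullet> i\<bar> * \<bar>u \<bullet> j\<bar> * \<bar>g p i j\<bar>"
        by (metis abs_ge_self abs_mult)
      also have "\<dots> \<le> norm u * norm u * \<bar>k i j\<bar>"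
        using k[OF p, of i j] Basis_le_norm[OF ij(1), of u] Basis_le_norm[OF ij(2), of u]
        by (intro mult_mono) auto
      finally show "(u \<bullet> i) * (u \<bullet> j) * g p i j \<le> \<bar>k i j\<bar> * (norm u)\<^sup>2"
        by (simp add: power2_eq_square mult_ac)
    qed
    also have "\<dots> = K * (norm u)\<^sup>2" by (simp add: K_def sum_distrib_right)
    finally show ?thesis .
  qed
  moreover have "0 \<le> K" unfolding K_def by (intro sum_nonneg) simp
  ultimately show thesis using that by blast
qed

text \<open>
  A curve of Euclidean speed at most \<open>B\<close> has Riemannian length at most \<open>K * B\<close>.
\<close>

definition speed_bounds_dist :: "'e::euclidean_space set \<Rightarrow> ('e \<Rightarrow> 'e \<Rightarrow> 'e \<Rightarrow> real) \<Rightarrow> real \<Rightarrow> bool" where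
  "speed_bounds_dist N g K \<longleftrightarrow> 0 \<le> K \<and> (\<forall>c D B.
     (\<forall>t\<in>{0..1}. c t \<in> N \<and> (c has_vector_derivative D t) (at t) \<and> norm (D t) \<le> B) \<and>
     continuous_on {0..1} D \<longrightarrow> riemannian_dist N g (c 0) (c 1) \<le> K * B)"

lemma speed_bounds_distD:
  assumes "speed_bounds_dist N g K"
    and "\<And>t. t \<in> {0..1} \<Longrightarrow> c t \<in> N \<and> (c has_vector_derivative D t) (at t) \<and> norm (D t) \<le> B"
    and "continuous_on {0..1} D" "c 0 = p" "c 1 = q"
  shows "riemannian_dist N g p q \<le> K * B"
proof -
  have "riemannian_dist N g (c 0) (c 1) \<le> K * B"
    by (rule assms(1)[unfolded speed_bounds_dist_def, THEN conjunct2,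
        THEN spec[of _ c], THEN spec[of _ D], THEN spec[of _ B], THEN mp])
      (use assms(2,3) in blast)
  thus ?thesis by (simp only: assms(4,5))
qed

lemma speed_bounds_dist_exists:
  assumes N: "compact N" and g: "riemannian_metric N g"
  obtains K where "speed_bounds_dist N g K"
proof -
  obtain K0 where K0: "0 \<le> K0" "\<And>p u. p \<in> N \<Longrightarrow> g p u u \<le> K0 * (norm u)\<^sup>2"
    using riemannian_metric_bounded[OF N g] by blast
  have gpos: "0 \<le> g p u u" if "p \<in> N" for p u
  proof (cases "u = 0")
    case True
    have "bilinear (g p)" using g that unfolding riemannian_metric_def by blast
    thus ?thesis using True by (simp add: bilinear_lzero)
  next
    case False thus ?thesis using g that unfolding riemannian_metric_def by (meson less_imp_le)
  qed
  have "speed_bounds_dist N g (sqrt K0)"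
    unfolding speed_bounds_dist_def
  proof (intro conjI allI impI)
    show "0 \<le> sqrt K0" using K0 by simp
    fix c D B
    assume *: "(\<forall>t\<in>{0..1}. c t \<in> N \<and> (c has_vector_derivative D t) (at t) \<and> norm (D t) \<le> B) \<and>
      continuous_on {0..1} D"
    have c: "c t \<in> N \<and> (c has_vector_derivative D t) (at t) \<and> norm (D t) \<le> B" if "t \<in> {0..1}" for t
      using * that by blast
    have D: "continuous_on {0..1} D" using * by blast
    let ?L = "{integral {0..1} (riemannian_speed g c') | c'.
       valid_path c' \<and> path_image c' \<subseteq> N \<and> pathstart c' = c 0 \<and> pathfinish c' = c 1 \<and>
       riemannian_speed g c' integrable_on {0..1}}"
    have "bdd_below ?L"
    proof (rule bdd_belowI)
      fix l assume "l \<in> ?L"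
      then obtain c' where c': "l = integral {0..1} (riemannian_speed g c')" "path_image c' \<subseteq> N"
        "riemannian_speed g c' integrable_on {0..1}" by blast
      show "0 \<le> l" unfolding c'(1)
      proof (rule integral_nonneg[OF c'(3)])
        fix t :: real assume "t \<in> {0..1}"
        hence "c' t \<in> N" using c'(2) by (auto simp: path_image_def)
        thus "0 \<le> riemannian_speed g c' t" unfolding riemannian_speed_def by (simp add: gpos)
      qed
    qed
    have sp: "riemannian_speed g c t = sqrt (g (c t) (D t) (D t))" if "t \<in> {0..1}" for t
      unfolding riemannian_speed_def using vector_derivative_at[of c "D t" t] c[OF that] by simp
    have cc: "continuous_on {0..1} c"
      using c by (intro continuous_on_vector_derivative[of _ _ D]) (blast intro:
          has_vector_derivative_at_within)
    have cont: "continuous_on {0..1} (\<lambda>t. \<Sum>i\<in>Basis. \<Sum>j\<in>Basis. (D t \<bullet> i) * (D t \<bullet> j) * g (c t) i j)"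
      by (intro continuous_intros D continuous_on_compose2[OF riemannian_metric_continuous[OF g] cc])
        (use c in blast)
    have eq: "g (c t) (D t) (D t) = (\<Sum>i\<in>Basis. \<Sum>j\<in>Basis. (D t \<bullet> i) * (D t \<bullet> j) * g (c t) i j)"
      if "t \<in> {0..1}" for t
      by (rule bilinear_expand) (use g c[OF that] in \<open>auto simp: riemannian_metric_def\<close>)
    have "continuous_on {0..1} (\<lambda>t. g (c t) (D t) (D t))"
      by (rule iffD2[OF continuous_on_cong[OF refl eq] cont])
    hence "continuous_on {0..1} (\<lambda>t. sqrt (g (c t) (D t) (D t)))" by (rule continuous_on_real_sqrt)
    hence "continuous_on {0..1} (riemannian_speed g c)"
      by (rule continuous_on_eq) (simp add: sp)
    hence int: "riemannian_speed g c integrable_on {0..1}" by (rule integrable_continuous_interval)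
    have "c C1_differentiable_on {0..1}"
      unfolding C1_differentiable_on_def using c D by blast
    hence "valid_path c" unfolding valid_path_def by (rule C1_differentiable_imp_piecewise)
    moreover have "path_image c \<subseteq> N" using c by (auto simp: path_image_def)
    ultimately have "integral {0..1} (riemannian_speed g c) \<in> ?L"
      using int by (auto simp: pathstart_def pathfinish_def)
    hence "riemannian_dist N g (c 0) (c 1) \<le> integral {0..1} (riemannian_speed g c)"
      unfolding riemannian_dist_def using \<open>bdd_below ?L\<close> by (rule cInf_lower)
    also have "\<dots> \<le> integral {0..1} (\<lambda>t::real. sqrt K0 * B)"
    proof (rule integral_le[OF int])
      fix t :: real assume t: "t \<in> {0..1}"
      have "0 \<le> norm (D t)" "norm (D t) \<le> B" using c[OF t] by auto
      hence "sqrt (g (c t) (D t) (D t)) \<le> sqrt (K0 * B\<^sup>2)"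
        using K0(2)[of "c t" "D t"] c[OF t] K0(1)
        by (intro real_sqrt_le_mono) (meson mult_left_mono order_trans power_mono)
      also have "\<dots> = sqrt K0 * B"
        using order_trans[OF norm_ge_zero \<open>norm (D t) \<le> B\<close>] by (simp add: real_sqrt_mult)
      finally show "riemannian_speed g c t \<le> sqrt K0 * B" unfolding sp[OF t] .
    qed (intro integrable_continuous_interval continuous_on_const)
    also have "\<dots> = sqrt K0 * B" by simp
    finally show "riemannian_dist N g (c 0) (c 1) \<le> sqrt K0 * B" .
  qed
  thus thesis by (rule that)
qed

lemma riemannian_dist_self:
  assumes "compact N" "riemannian_metric N g" "p \<in> N"
  shows "riemannian_dist N g p p \<le> 0"
proof -
  obtain K where "speed_bounds_dist N g K" using speed_bounds_dist_exists[OF assms(1,2)] .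
  from speed_bounds_distD[OF this, of "\<lambda>_. p" "\<lambda>_. 0" 0 p p] show ?thesis
    using assms(3) by (simp add: has_vector_derivative_const)
qed

lemma proj_matrix_image_Gr:
  "proj_matrix ` Gr j = {P :: 'k::real_or_complex ^ 'n ^ 'n. adj P = P \<and> P ** P = P \<and> trace P =
      of_nat j}"
proof safe
  fix V :: "('k ^ 'n) set" assume "V \<in> Gr j"
  from orth_proj_proj_matrix[OF this] trace_proj_matrix[OF this]
  show "adj (proj_matrix V) = proj_matrix V" "proj_matrix V ** proj_matrix V = proj_matrix V"
    "trace (proj_matrix V) = of_nat j" by (simp_all add: orth_proj_def)
next
  fix P :: "'k ^ 'n ^ 'n" assume "adj P = P" "P ** P = P" "trace P = of_nat j"
  hence P: "orth_proj P" "trace P = of_nat j" by (auto simp: orth_proj_def)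
  show "P \<in> proj_matrix ` Gr j"
    using orth_proj_range_Gr[OF P] by (metis imageI)
qed

lemma compact_Gr: "compact (proj_matrix ` (Gr j :: ('k::real_or_complex ^ 'n) set set))"
proof -
  have "closed (proj_matrix ` (Gr j :: ('k ^ 'n) set set))"
    unfolding proj_matrix_image_Gr trace_def
    by (intro closed_Collect_conj closed_Collect_eq continuous_intros mm.continuous_on
        linear_continuous_on bounded_linear_adj)
  moreover have "bounded (proj_matrix ` (Gr j :: ('k ^ 'n) set set))"
    by (rule boundedI[of _ "sqrt CARD('n)"])
      (auto intro!: norm_orth_proj[OF orth_proj_proj_matrix])
  ultimately show ?thesis by (simp add: compact_eq_bounded_closed)
qed

lemma Gr_subset_iff:
  assumes V: "V \<in> Gr i" and W: "W \<in> Gr j"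
  shows "V \<subseteq> W \<longleftrightarrow> proj_matrix W ** proj_matrix V = proj_matrix V"
proof
  assume VW: "V \<subseteq> W"
  show "proj_matrix W ** proj_matrix V = proj_matrix V"
  proof (rule matrix_eqI)
    fix x
    have "proj_matrix V *v x \<in> W" using range_proj_matrix[OF V] VW by blast
    thus "proj_matrix W ** proj_matrix V *v x = proj_matrix V *v x"
      using proj_matrix_mv_iff[OF W] by (simp add: matrix_vector_mul_assoc[symmetric])
  qed
next
  assume eq: "proj_matrix W ** proj_matrix V = proj_matrix V"
  show "V \<subseteq> W"
  proof
    fix x assume "x \<in> V"
    hence "proj_matrix V *v x = x" using proj_matrix_mv_iff[OF V] by blast
    hence "proj_matrix W *v x = x" using arg_cong[OF eq, of "\<lambda>C. C *v x"]
      by (simp add: matrix_vector_mul_assoc[symmetric])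
    thus "x \<in> W" using proj_matrix_mv_iff[OF W] by blast
  qed
qed

lemma flag_embedding_image_Flags:
  "flag_embedding ` (Flags k :: ('k::real_or_complex, 'n::finite) flag set) =
    (proj_matrix ` Gr k \<times> proj_matrix ` Gr (CARD('n) - k)) \<inter>
    {z. snd z ** fst z = fst z \<or> fst z ** snd z = snd z}"
proof (intro equalityI subsetI)
  fix z :: "('k ^ 'n ^ 'n) \<times> ('k ^ 'n ^ 'n)" assume "z \<in> flag_embedding ` Flags k"
  then obtain V W where z: "z = (proj_matrix V, proj_matrix W)"
    and VW: "V \<in> Gr k" "W \<in> Gr (CARD('n) - k)" "V \<subseteq> W \<or> W \<subseteq> V"
    by (auto simp: Flags_def flag_embedding_def)
  thus "z \<in> (proj_matrix ` Gr k \<times> proj_matrix ` Gr (CARD('n) - k)) \<inter>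
      {z. snd z ** fst z = fst z \<or> fst z ** snd z = snd z}"
    using Gr_subset_iff[OF VW(1,2)] Gr_subset_iff[OF VW(2,1)] by auto
next
  fix z :: "('k ^ 'n ^ 'n) \<times> ('k ^ 'n ^ 'n)"
  assume "z \<in> (proj_matrix ` Gr k \<times> proj_matrix ` Gr (CARD('n) - k)) \<inter>
      {z. snd z ** fst z = fst z \<or> fst z ** snd z = snd z}"
  then obtain V W where z: "z = (proj_matrix V, proj_matrix W)"
    and VW: "V \<in> Gr k" "W \<in> Gr (CARD('n) - k)"
    and "proj_matrix W ** proj_matrix V = proj_matrix V \<or> proj_matrix V ** proj_matrix W = proj_matrix W"
    by auto
  hence "(V, W) \<in> Flags k"
    using Gr_subset_iff[OF VW(1,2)] Gr_subset_iff[OF VW(2,1)] by (auto simp: Flags_def)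
  thus "z \<in> flag_embedding ` Flags k"
    by (rule rev_image_eqI) (simp add: flag_embedding_def z)
qed

text \<open>
  Compactness provides limits of sequences of flags and uniform bounds for Riemannian metrics.
\<close>

lemma compact_Flags: "compact (flag_embedding ` (Flags k :: ('k::real_or_complex, 'n::finite) flag set))"
  unfolding flag_embedding_image_Flags
  by (intro compact_Int_closed compact_Times compact_Gr closed_Collect_disj closed_Collect_eq
      mm.continuous_on continuous_intros)

text \<open>
  At time 1 the path \<open>1 + t X\<close> reaches the intertwiner \<open>G\<close>, and \<open>G ** P = Q ** G\<close> with \<open>G\<close>
  invertible says that \<open>G\<close> maps the range of \<open>P\<close> onto the range of \<open>Q\<close>.
\<close>

lemma intertwining_path:
  fixes P R Q S :: "'k::real_or_complex ^ 'n ^ 'n"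
  assumes P: "orth_proj P" and R: "orth_proj R" and Q: "orth_proj Q" and S: "orth_proj S"
    and PR: "P ** R = R ** P" and QS: "Q ** S = S ** Q"
  defines "X \<equiv> intertwiner P R Q S - mat 1"
  assumes X: "norm X \<le> 1 / 4"
  shows "image_proj (mat 1 + 0 *\<^sub>R X) P = P" "image_proj (mat 1 + 1 *\<^sub>R X) P = Q"
    "image_proj (mat 1 + 0 *\<^sub>R X) R = R" "image_proj (mat 1 + 1 *\<^sub>R X) R = S"
proof -
  have low: "norm v / 2 \<le> norm ((mat 1 + t *\<^sub>R X) *v v)" if "t \<in> {0..1}" for t v
    by (rule near_one_bounded_below[OF X]) (use that in auto)
  have start: "image_proj (mat 1 + 0 *\<^sub>R X) Z = Z" if Z: "orth_proj Z" for Z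
    by (rule orth_proj_unique) (use image_proj[OF Z low[of 0]] Z in \<open>simp_all add: image_image\<close>)
  define G where "G = intertwiner P R Q S"
  have G: "mat 1 + 1 *\<^sub>R X = G" by (simp add: X_def G_def)
  have Glow: "norm v / 2 \<le> norm (G *v v)" for v using low[of 1 v] unfolding G by simp
  have "1/2 * norm v \<le> norm (G *v v)" for v using Glow[of v] by simp
  from bounded_below_matrix_inv(1)[OF _ this] have surj: "G *v (matrix_inv G *v y) = y" for y
    by (simp add: matrix_vector_mul_assoc)
  have finish: "image_proj (mat 1 + 1 *\<^sub>R X) Z = Z'"
    if Z: "orth_proj Z" "orth_proj Z'" and GZ: "G ** Z = Z' ** G" for Z Z'
    unfolding G
  proof (rule orth_proj_unique)
    show "orth_proj (image_proj G Z)" by (rule image_proj(1)[OF Z(1) Glow])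
    have GZ': "G *v (Z *v x) = Z' *v (G *v x)" for x
      using arg_cong[OF GZ, of "\<lambda>C. C *v x"] by (simp add: matrix_vector_mul_assoc)
    have "(*v) G ` range ((*v) Z) = range ((*v) Z')"
    proof
      show "(*v) G ` range ((*v) Z) \<subseteq> range ((*v) Z')" by (auto simp: GZ')
      show "range ((*v) Z') \<subseteq> (*v) G ` range ((*v) Z)"
      proof safe
        fix y
        have "Z' *v y = G *v (Z *v (matrix_inv G *v y))" by (simp add: GZ' surj)
        thus "Z' *v y \<in> (*v) G ` range ((*v) Z)" by blast
      qed
    qed
    thus "range ((*v) (image_proj G Z)) = range ((*v) Z')"
      using image_proj(2)[OF Z(1) Glow] by simp
  qed (rule Z(2))
  note GG = intertwiner(1,2)[OF P R Q S PR QS, folded G_def]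
  show "image_proj (mat 1 + 0 *\<^sub>R X) P = P" "image_proj (mat 1 + 0 *\<^sub>R X) R = R"
    by (rule start, fact)+
  show "image_proj (mat 1 + 1 *\<^sub>R X) P = Q" by (rule finish[OF P Q GG(1)])
  show "image_proj (mat 1 + 1 *\<^sub>R X) R = S" by (rule finish[OF R S GG(2)])
qed

lemma image_proj_near_one:
  fixes X :: "'k::real_or_complex ^ 'n ^ 'n"
  assumes X: "norm X \<le> 1 / 4" and t: "t \<in> {0..1}" and V: "V \<in> Gr j"
  shows "(*v) (mat 1 + t *\<^sub>R X) ` V \<in> Gr j"
    and "image_proj (mat 1 + t *\<^sub>R X) (proj_matrix V) = proj_matrix ((*v) (mat 1 + t *\<^sub>R X) ` V)"
proof -
  let ?A = "mat 1 + t *\<^sub>R X"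
  have low: "norm v / 2 \<le> norm (?A *v v)" for v
    by (rule near_one_bounded_below[OF X]) (use t in auto)
  have "inj ((*v) ?A)"
  proof (rule injI)
    fix x y assume "?A *v x = ?A *v y"
    hence "?A *v (x - y) = 0" by (simp add: mv.diff_right)
    thus "x = y" using low[of "x - y"] by simp
  qed
  thus "(*v) ?A ` V \<in> Gr j" using V by (rule Gr_image)
  show "image_proj ?A (proj_matrix V) = proj_matrix ((*v) ?A ` V)"
    using image_proj[OF orth_proj_proj_matrix[OF V] low] range_proj_matrix[OF V]
    by (intro proj_matrix_eqI[symmetric]) simp_all
qed

lemma Flags_commute:
  assumes "F \<in> Flags k"
  shows "proj_matrix (fst F) ** proj_matrix (snd F) = proj_matrix (snd F) ** proj_matrix (fst F)"
proof -
  have VW: "fst F \<in> Gr k" "snd F \<in> Gr (CARD('b) - k)" "fst F \<subseteq> snd F \<or> snd F \<subseteq> fst F"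
    using assms by (auto simp: Flags_def)
  have a: "adj (proj_matrix (fst F)) = proj_matrix (fst F)" "adj (proj_matrix (snd F)) = proj_matrix
      (snd F)"
    by (rule orth_proj_adj[OF orth_proj_proj_matrix], fact)+
  from VW(3) show ?thesis
  proof
    assume "fst F \<subseteq> snd F"
    hence e: "proj_matrix (snd F) ** proj_matrix (fst F) = proj_matrix (fst F)"
      using Gr_subset_iff[OF VW(1,2)] by simp
    from arg_cong[OF this, of adj] show ?thesis unfolding adj_mult a by (simp add: e)
  next
    assume "snd F \<subseteq> fst F"
    hence e: "proj_matrix (fst F) ** proj_matrix (snd F) = proj_matrix (snd F)"
      using Gr_subset_iff[OF VW(2,1)] by simp
    from arg_cong[OF this, of adj] show ?thesis unfolding adj_mult a by (simp add: e)
  qed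
qed

text \<open>
  Only this direction of the comparison with the Euclidean distance is needed to transfer small covers.
\<close>

definition dominated_near :: "'x set \<Rightarrow> ('x \<Rightarrow> 'e::real_normed_vector) \<Rightarrow> ('x \<Rightarrow> 'x \<Rightarrow> real) \<Rightarrow> bool" where
  "dominated_near Z \<iota> d \<longleftrightarrow> (\<exists>C>0. \<exists>\<rho>>0. \<forall>x\<in>Z. \<forall>y\<in>Z. norm (\<iota> x - \<iota> y) < \<rho> \<longrightarrow> d x y \<le> C * norm (\<iota> x - \<iota> y))"

text \<open>
  The curve \<open>c\<close> of projections follows the subspaces \<open>A t V\<close> from \<open>V\<close> to \<open>V'\<close>, with velocity
  \<open>D\<close>.
\<close>

definition subspace_path ::
    "(real \<Rightarrow> 'k::real_or_complex ^ 'n ^ 'n) \<Rightarrow> ('k ^ 'n) set \<Rightarrow> ('k ^ 'n) set \<Rightarrow> real \<Rightarrow>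
      (real \<Rightarrow> 'k ^ 'n ^ 'n) \<Rightarrow> (real \<Rightarrow> 'k ^ 'n ^ 'n) \<Rightarrow> bool" where
  "subspace_path A V V' B c D \<longleftrightarrow>
     c 0 = proj_matrix V \<and> c 1 = proj_matrix V' \<and> continuous_on {0..1} D \<and>
     (\<forall>t\<in>{0..1}. c t = proj_matrix ((*v) (A t) ` V) \<and> (c has_vector_derivative D t) (at t) \<and> norm (D
         t) \<le> B)"

text \<open>
  Nearby pairs have an intertwiner near the identity. The segment from the identity to it consists of invertible
  matrices \<open>A t\<close>, which move both subspaces simultaneously and so preserve the inclusion between them.
\<close>

lemma connecting_path:
  fixes V V' W W' :: "('k::real_or_complex ^ 'n) set"
  defines "q \<equiv> sqrt CARD('n)"
  assumes V: "V \<in> Gr i" "V' \<in> Gr i" and W: "W \<in> Gr j" "W' \<in> Gr j"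
    and comm: "proj_matrix V ** proj_matrix W = proj_matrix W ** proj_matrix V"
      "proj_matrix V' ** proj_matrix W' = proj_matrix W' ** proj_matrix V'"
    and near: "norm (proj_matrix V - proj_matrix V') \<le> \<delta>" "norm (proj_matrix W - proj_matrix W') \<le> \<delta>"
      "\<delta> < 1 / (32 * q ^ 3)"
  obtains A c1 D1 c2 D2 where "\<forall>t\<in>{0..1}. \<forall>l. \<forall>Z\<in>Gr l. (*v) (A t) ` Z \<in> Gr l"
    "subspace_path A V V' ((16 * q ^ 4 + 256 * q ^ 9) * (8 * q ^ 3) * \<delta>) c1 D1"
    "subspace_path A W W' ((16 * q ^ 4 + 256 * q ^ 9) * (8 * q ^ 3) * \<delta>) c2 D2"
proof -
  define P R Q S where d: "P = proj_matrix V" "R = proj_matrix W" "Q = proj_matrix V'" "S =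
      proj_matrix W'"
  have o: "orth_proj P" "orth_proj R" "orth_proj Q" "orth_proj S"
    unfolding d by (rule orth_proj_proj_matrix, fact)+
  define L where "L = 16 * q ^ 4 + 256 * q ^ 9"
  have q: "1 \<le> q" unfolding q_def by simp
  have L: "0 \<le> L" using q by (simp add: L_def)
  define X where "X = intertwiner P R Q S - mat 1"
  have "4 * q ^ 3 * (norm (Q - P) + norm (S - R)) \<le> 4 * q ^ 3 * (\<delta> + \<delta>)"
    using q near(1,2) unfolding d norm_minus_commute[of _ "proj_matrix V"] norm_minus_commute[of _
        "proj_matrix W"]
    by (intro mult_left_mono add_mono) auto
  from order_trans[OF norm_intertwiner[OF o comm(1)[folded d], folded q_def X_def] this]
  have nX: "norm X \<le> 8 * q ^ 3 * \<delta>" by simp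
  moreover have "8 * q ^ 3 * \<delta> \<le> 1 / 4"
    using near(3) q by (simp add: field_simps)
  ultimately have X: "norm X \<le> 1 / 4" by simp
  let ?A = "\<lambda>t. mat 1 + t *\<^sub>R X"
  have LX: "L * norm X \<le> L * (8 * q ^ 3) * \<delta>"
    using mult_left_mono[OF nX L] by (simp add: mult.assoc)
  obtain D1 where D1: "\<And>t. t \<in> {0..1} \<Longrightarrow>
      ((\<lambda>t. image_proj (?A t) P) has_vector_derivative D1 t) (at t) \<and> norm (D1 t) \<le> L * norm X"
    "continuous_on {0..1} D1"
    using image_proj_path[OF o(1) X] unfolding q_def[symmetric] L_def[symmetric] by blast
  obtain D2 where D2: "\<And>t. t \<in> {0..1} \<Longrightarrow>
      ((\<lambda>t. image_proj (?A t) R) has_vector_derivative D2 t) (at t) \<and> norm (D2 t) \<le> L * norm X"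
    "continuous_on {0..1} D2"
    using image_proj_path[OF o(2) X] unfolding q_def[symmetric] L_def[symmetric] by blast
  note ends = intertwining_path[OF o comm[folded d], folded X_def, OF X]
  show thesis
  proof (rule that)
    show "\<forall>t\<in>{0..1}. \<forall>l. \<forall>Z\<in>Gr l. (*v) (?A t) ` Z \<in> Gr l"
      using image_proj_near_one(1)[OF X] by blast
    show "subspace_path ?A V V' ((16 * q ^ 4 + 256 * q ^ 9) * (8 * q ^ 3) * \<delta>) (\<lambda>t. image_proj (?A
        t) P) D1"
      unfolding subspace_path_def L_def[symmetric]
    proof (intro conjI ballI D1(2))
      fix t :: real assume t: "t \<in> {0..1}"
      show "image_proj (?A t) P = proj_matrix ((*v) (?A t) ` V)"
        unfolding d by (rule image_proj_near_one(2)[OF X t V(1)])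
      show "((\<lambda>t. image_proj (?A t) P) has_vector_derivative D1 t) (at t)" "norm (D1 t) \<le> L * (8 * q
          ^ 3) * \<delta>"
        using D1(1)[OF t] LX by auto
    qed (use ends in \<open>simp_all add: d\<close>)
    show "subspace_path ?A W W' ((16 * q ^ 4 + 256 * q ^ 9) * (8 * q ^ 3) * \<delta>) (\<lambda>t. image_proj (?A
        t) R) D2"
      unfolding subspace_path_def L_def[symmetric]
    proof (intro conjI ballI D2(2))
      fix t :: real assume t: "t \<in> {0..1}"
      show "image_proj (?A t) R = proj_matrix ((*v) (?A t) ` W)"
        unfolding d by (rule image_proj_near_one(2)[OF X t W(1)])
      show "((\<lambda>t. image_proj (?A t) R) has_vector_derivative D2 t) (at t)" "norm (D2 t) \<le> L * (8 * q
          ^ 3) * \<delta>"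
        using D2(1)[OF t] LX by auto
    qed (use ends in \<open>simp_all add: d\<close>)
  qed
qed

lemma dominated_nearI:
  assumes "0 \<le> C" "0 < \<rho>"
    and "\<And>x y. \<lbrakk>x \<in> Z; y \<in> Z; norm (\<iota> x - \<iota> y) < \<rho>\<rbrakk> \<Longrightarrow> d x y \<le> C * norm (\<iota> x - \<iota> y)"
  shows "dominated_near Z \<iota> d"
proof -
  have "d x y \<le> (C + 1) * norm (\<iota> x - \<iota> y)" if "x \<in> Z" "y \<in> Z" "norm (\<iota> x - \<iota> y) < \<rho>" for x y
    using assms(3)[OF that] by (rule order_trans) (intro mult_right_mono; simp)
  thus ?thesis unfolding dominated_near_def using assms(1,2) by (intro exI[of _ "C + 1"] conjI
      exI[of _ \<rho>]) auto
qed

lemma dominated_near_Flags: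
  fixes g :: "('k::real_or_complex ^ 'n ^ 'n) \<times> ('k ^ 'n ^ 'n) \<Rightarrow> _"
  assumes g: "riemannian_metric (flag_embedding ` (Flags k :: ('k, 'n::finite) flag set)) g"
  shows "dominated_near (Flags k) flag_embedding
    (\<lambda>x y. riemannian_dist (flag_embedding ` (Flags k :: ('k, 'n) flag set)) g (flag_embedding x)
        (flag_embedding y))"
proof -
  let ?N = "flag_embedding ` (Flags k :: ('k, 'n) flag set)"
  obtain K where K: "speed_bounds_dist ?N g K" using speed_bounds_dist_exists[OF compact_Flags g] .
  define q where "q = sqrt CARD('n)"
  define L where "L = (16 * q ^ 4 + 256 * q ^ 9) * (8 * q ^ 3)"
  have q: "1 \<le> q" unfolding q_def by simp
  show ?thesis
  proof (rule dominated_nearI)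
    show "0 \<le> K * (2 * L)" using K q by (simp add: speed_bounds_dist_def L_def)
    show "0 < 1 / (32 * q ^ 3)" using q by simp
    fix F G :: "('k, 'n) flag"
    assume F: "F \<in> Flags k" and G: "G \<in> Flags k"
      and near: "norm (flag_embedding F - flag_embedding G) < 1 / (32 * q ^ 3)"
    define \<delta> where "\<delta> = norm (flag_embedding F - flag_embedding G)"
    have FF: "fst F \<in> Gr k" "snd F \<in> Gr (CARD('n) - k)" "fst F \<subseteq> snd F \<or> snd F \<subseteq> fst F"
      and GG: "fst G \<in> Gr k" "snd G \<in> Gr (CARD('n) - k)"
      using F G by (auto simp: Flags_def)
    have "norm (proj_matrix (fst F) - proj_matrix (fst G)) \<le> \<delta>"
      "norm (proj_matrix (snd F) - proj_matrix (snd G)) \<le> \<delta>"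
      by (simp_all add: \<delta>_def flag_embedding_def norm_fst_le norm_snd_le)
    then obtain A c1 D1 c2 D2 where A: "\<forall>t\<in>{0..1}. \<forall>l. \<forall>Z\<in>Gr l. (*v) (A t) ` Z \<in> Gr l"
      and c: "subspace_path A (fst F) (fst G) (L * \<delta>) c1 D1" "subspace_path A (snd F) (snd G) (L *
          \<delta>) c2 D2"
      using connecting_path[OF FF(1) GG(1) FF(2) GG(2) Flags_commute[OF F] Flags_commute[OF G] _ _
        near[folded \<delta>_def, unfolded q_def], folded q_def, folded L_def] by blast
    note c1 = c(1)[unfolded subspace_path_def] and c2 = c(2)[unfolded subspace_path_def]
    have "riemannian_dist ?N g (flag_embedding F) (flag_embedding G) \<le> K * (2 * L * \<delta>)"
    proof (rule speed_bounds_distD[OF K, of "\<lambda>t. (c1 t, c2 t)" "\<lambda>t. (D1 t, D2 t)"])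
      fix t :: real assume t: "t \<in> {0..1}"
      have "((*v) (A t) ` fst F, (*v) (A t) ` snd F) \<in> Flags k"
        unfolding Flags_def using A t FF by (auto simp: image_mono)
      moreover have "(c1 t, c2 t) = flag_embedding ((*v) (A t) ` fst F, (*v) (A t) ` snd F)"
        using c1 c2 t by (simp add: flag_embedding_def)
      ultimately have "(c1 t, c2 t) \<in> ?N" by (rule rev_image_eqI)
      moreover have "((\<lambda>t. (c1 t, c2 t)) has_vector_derivative (D1 t, D2 t)) (at t)"
        using c1 c2 t by (intro has_vector_derivative_Pair) auto
      moreover have "norm (D1 t, D2 t) \<le> 2 * L * \<delta>"
      proof -
        have "norm (D1 t) \<le> L * \<delta>" "norm (D2 t) \<le> L * \<delta>" using c1 c2 t by auto
        thus ?thesis using norm_Pair_le[of "D1 t" "D2 t"] by linarith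
      qed
      ultimately show "(c1 t, c2 t) \<in> ?N \<and>
          ((\<lambda>t. (c1 t, c2 t)) has_vector_derivative (D1 t, D2 t)) (at t) \<and>
          norm (D1 t, D2 t) \<le> 2 * L * \<delta>" by blast
    qed (use c1 c2 in \<open>auto intro!: continuous_on_Pair simp: flag_embedding_def\<close>)
    thus "riemannian_dist ?N g (flag_embedding F) (flag_embedding G)
        \<le> K * (2 * L) * norm (flag_embedding F - flag_embedding G)"
      by (simp add: \<delta>_def mult.assoc)
  qed
qed

lemma dominated_near_Gr:
  fixes g :: "'k::real_or_complex ^ 'n ^ 'n \<Rightarrow> _"
  assumes g: "riemannian_metric (proj_matrix ` (Gr k :: ('k ^ 'n) set set)) g"
  shows "dominated_near (Gr k) proj_matrix
    (\<lambda>x y. riemannian_dist (proj_matrix ` (Gr k :: ('k ^ 'n) set set)) g (proj_matrix x)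
        (proj_matrix y))"
proof -
  let ?N = "proj_matrix ` (Gr k :: ('k ^ 'n) set set)"
  obtain K where K: "speed_bounds_dist ?N g K" using speed_bounds_dist_exists[OF compact_Gr g] .
  define q where "q = sqrt CARD('n)"
  define L where "L = (16 * q ^ 4 + 256 * q ^ 9) * (8 * q ^ 3)"
  have q: "1 \<le> q" unfolding q_def by simp
  show ?thesis
  proof (rule dominated_nearI)
    show "0 \<le> K * L" using K q by (simp add: speed_bounds_dist_def L_def)
    show "0 < 1 / (32 * q ^ 3)" using q by simp
    fix V V' :: "('k ^ 'n) set"
    assume V: "V \<in> Gr k" "V' \<in> Gr k" and near: "norm (proj_matrix V - proj_matrix V') < 1 / (32 * q ^ 3)"
    let ?\<delta> = "norm (proj_matrix V - proj_matrix V')"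
    obtain A c D c' D' where A: "\<forall>t\<in>{0..1}. \<forall>l. \<forall>Z\<in>Gr l. (*v) (A t) ` Z \<in> Gr l"
      and c: "subspace_path A V V' (L * ?\<delta>) c D" and "subspace_path A V V' (L * ?\<delta>) c' D'"
      by (rule connecting_path[OF V V refl refl order_refl order_refl near[unfolded q_def], folded
          q_def, folded L_def])
    note cD = c[unfolded subspace_path_def]
    have "riemannian_dist ?N g (proj_matrix V) (proj_matrix V') \<le> K * (L * norm (proj_matrix V -
        proj_matrix V'))"
      by (rule speed_bounds_distD[OF K, of c D]) (use cD A V(1) in auto)
    thus "riemannian_dist ?N g (proj_matrix V) (proj_matrix V')
        \<le> K * L * norm (proj_matrix V - proj_matrix V')" by (simp add: mult.assoc)
  qed
qed

section \<open>Conical limit points and attracting flags\<close>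

text \<open>
  By compactness of the unit sphere, the angle between two transverse subspaces is positive; it varies
  continuously with the subspaces.
\<close>

lemma transverse_uniform:
  fixes P Q :: "nat \<Rightarrow> 'k::real_or_complex ^ 'n ^ 'n"
  assumes Q: "Q \<longlonglongrightarrow> Q'" "\<forall>\<^sub>F n in sequentially. orth_proj (Q n)"
    and P: "P \<longlonglongrightarrow> P'" and P': "orth_proj P'" and tr: "range ((*v) Q') \<inter> range ((*v) P') = {0}"
  obtains \<epsilon> where "0 < \<epsilon>"
    "\<forall>\<^sub>F n in sequentially. \<forall>v \<in> range ((*v) (Q n)). \<epsilon> * norm v \<le> norm (v - P n *v v)"
proof -
  have sub: "subspace (range ((*v) Q'))"
    by (rule linear_subspace_image[OF bounded_linear.linear[OF mv.bounded_linear_right]]) simp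
  have inj: "\<forall>x\<in>range ((*v) Q'). x - P' *v x = 0 \<longrightarrow> x = 0"
  proof (intro ballI impI)
    fix x assume "x \<in> range ((*v) Q')" "x - P' *v x = 0"
    hence "x \<in> range ((*v) Q') \<inter> range ((*v) P')" by (auto intro: range_eqI[of _ _ x])
    thus "x = 0" using tr by blast
  qed
  have bl: "bounded_linear (\<lambda>x. x - P' *v x)"
    by (intro bounded_linear_sub bounded_linear_ident mv.bounded_linear_right)
  from injective_imp_isometric[OF closed_subspace[OF sub] sub bl inj]
  obtain e where e: "e > 0" "\<And>x. x \<in> range ((*v) Q') \<Longrightarrow> e * norm x \<le> norm (x - P' *v x)"
    by blast
  \<comment> \<open>Chosen so that the three errors of size \<open>\<eta>\<close> and the loss \<open>e * \<eta>\<close> cost half of \<open>e\<close>.\<close>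
  define \<eta> where "\<eta> = (e / 2) / (e + 3)"
  have "e + 3 \<noteq> 0" using e(1) by simp
  from iffD1[OF nonzero_eq_divide_eq[OF this] \<eta>_def] have "e - e * \<eta> - 3 * \<eta> = e / 2"
    by (simp add: algebra_simps)
  moreover have "\<eta> > 0" using e(1) by (simp add: \<eta>_def)
  ultimately have \<eta>: "\<eta> > 0" "e - e * \<eta> - 3 * \<eta> = e / 2" by auto
  have "\<forall>\<^sub>F n in sequentially. norm (Q n - Q') < \<eta>" "\<forall>\<^sub>F n in sequentially. norm (P n - P') < \<eta>"
    using Q(1) P \<eta>(1) by (auto simp: tendsto_iff dist_norm)
  with Q(2) have "\<forall>\<^sub>F n in sequentially. \<forall>v \<in> range ((*v) (Q n)). e / 2 * norm v \<le> norm (v - P n *v v)"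
  proof eventually_elim
    case (elim n)
    show ?case
    proof
      fix v assume "v \<in> range ((*v) (Q n))"
      hence v: "Q n *v v = v" using range_orth_proj_iff[OF elim(1)] by blast
      define w where "w = Q' *v v"
      have 1: "norm (v - w) \<le> \<eta> * norm v"
      proof -
        have "v - w = (Q n - Q') *v v" by (simp add: w_def mv.diff_left v)
        also have "norm \<dots> \<le> norm (Q n - Q') * norm v" by (rule norm_mv_le)
        also have "\<dots> \<le> \<eta> * norm v" by (rule mult_right_mono) (use elim(2) in simp_all)
        finally show ?thesis .
      qed
      have 2: "norm ((P n - P') *v v) \<le> \<eta> * norm v"
        by (rule order_trans[OF norm_mv_le mult_right_mono]) (use elim(3) in simp_all)
      have 3: "norm (P' *v (v - w)) \<le> \<eta> * norm v" using norm_orth_proj_le[OF P', of "v - w"] 1 by simp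
      have 4: "e * norm w \<le> norm (w - P' *v w)" by (rule e(2)) (simp add: w_def)
      have "norm v \<le> norm w + norm (v - w)" using norm_triangle_ineq[of w "v - w"] by simp
      hence "norm v - \<eta> * norm v \<le> norm w" using 1 by simp
      hence "e * (norm v - \<eta> * norm v) \<le> e * norm w" using e(1) by simp
      also note 4
      also have "norm (w - P' *v w) \<le> norm (v - P n *v v) + norm (v - w) + norm ((P n - P') *v v) +
          norm (P' *v (v - w))"
      proof -
        have eq: "w - P' *v w = (v - P n *v v) - (v - w) + (P n - P') *v v + P' *v (v - w)"
          by (simp add: mv.diff_left mv.diff_right)
        show ?thesis
          unfolding eq using norm_triangle_ineq[of "(v - P n *v v) - (v - w) + (P n - P') *v v" "P'
              *v (v - w)"]
            norm_triangle_ineq[of "(v - P n *v v) - (v - w)" "(P n - P') *v v"]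
            norm_triangle_ineq4[of "v - P n *v v" "v - w"] by linarith
      qed
      finally have "e * (norm v - \<eta> * norm v) - 3 * (\<eta> * norm v) \<le> norm (v - P n *v v)"
        using 1 2 3 by linarith
      moreover have "e * (norm v - \<eta> * norm v) - 3 * (\<eta> * norm v) = (e - e * \<eta> - 3 * \<eta>) * norm v"
        by (simp add: algebra_simps)
      ultimately show "e / 2 * norm v \<le> norm (v - P n *v v)" unfolding \<eta>(2) by simp
    qed
  qed
  thus thesis using that[of "e / 2"] e(1) by simp
qed

text \<open>
  The repelling spaces converge to a subspace transverse to the limit of the \<open>W n\<close>, so contraction applies
  with one \<open>\<epsilon>\<close> for almost all \<open>n\<close>.
\<close>

lemma uniform_contraction:
  fixes \<beta> :: "nat \<Rightarrow> ('k::real_or_complex ^ 'n ^ 'n) set"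
  assumes \<beta>: "\<And>n. \<beta> n \<in> carrier PGL" and j: "0 < j" "j < CARD('n)"
    and div: "filterlim (\<lambda>n. alpha_kappa j (\<beta> n)) at_top sequentially"
    and W: "\<And>n. W n \<in> Gr j" "(\<lambda>n. proj_matrix (W n)) \<longlonglongrightarrow> proj_matrix A" "A \<in> Gr j"
    and R: "(\<lambda>n. proj_matrix (U_space (CARD('n) - j) (inv\<^bsub>PGL\<^esub> (\<beta> n)))) \<longlonglongrightarrow> proj_matrix B"
      "B \<in> Gr (CARD('n) - j)"
    and tr: "A \<inter> B = {0}"
  obtains C where "0 < C" "\<forall>\<^sub>F n in sequentially. norm (proj_matrix (pgl_act (\<beta> n) (W n)) -
      proj_matrix (U_space j (\<beta> n)))
      \<le> C * exp (- alpha_kappa j (\<beta> n))"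
proof -
  obtain \<epsilon> where \<epsilon>: "0 < \<epsilon>" and ev: "\<forall>\<^sub>F n in sequentially. \<forall>v \<in> range ((*v) (proj_matrix (W n))).
      \<epsilon> * norm v \<le> norm (v - proj_matrix (U_space (CARD('n) - j) (inv\<^bsub>PGL\<^esub> (\<beta> n))) *v v)"
  proof -
    have "\<forall>\<^sub>F n in sequentially. orth_proj (proj_matrix (W n))"
      by (intro always_eventually allI orth_proj_proj_matrix[OF W(1)])
    moreover have "range ((*v) (proj_matrix A)) \<inter> range ((*v) (proj_matrix B)) = {0}"
      unfolding range_proj_matrix[OF W(3)] range_proj_matrix[OF R(2)] by (rule tr)
    ultimately show thesis
      using transverse_uniform[OF W(2) _ R(1) orth_proj_proj_matrix[OF R(2)]] that by blast
  qed
  have pos: "\<forall>\<^sub>F n in sequentially. 0 < alpha_kappa j (\<beta> n)"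
    using div by (simp add: filterlim_at_top_dense)
  show thesis
  proof
    show "0 < sqrt (2 * CARD('n)) / \<epsilon>" using \<epsilon> by simp
    show "\<forall>\<^sub>F n in sequentially. norm (proj_matrix (pgl_act (\<beta> n) (W n)) - proj_matrix (U_space j (\<beta> n)))
      \<le> sqrt (2 * CARD('n)) / \<epsilon> * exp (- alpha_kappa j (\<beta> n))"
      using ev pos
    proof eventually_elim
      case (elim n)
      show ?case
        by (rule contraction[OF \<beta> j elim(2) W(1) \<epsilon>]) (use elim(1) range_proj_matrix[OF W(1)] in auto)
    qed
  qed
qed

text \<open>
  The images of a fixed transverse subspace and the attracting spaces approach each other, so they have the same
  limit.
\<close>

lemma attracting_limit:
  fixes \<gamma> :: "nat \<Rightarrow> ('k::real_or_complex ^ 'n ^ 'n) set"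
  assumes \<gamma>: "\<And>n. \<gamma> n \<in> carrier PGL" and j: "0 < j" "j < CARD('n)"
    and div: "filterlim (\<lambda>n. alpha_kappa j (\<gamma> n)) at_top sequentially"
    and V: "V \<in> Gr j"
    and R: "(\<lambda>n. proj_matrix (U_space (CARD('n) - j) (inv\<^bsub>PGL\<^esub> (\<gamma> n)))) \<longlonglongrightarrow> proj_matrix X"
      "X \<in> Gr (CARD('n) - j)"
    and tr: "V \<inter> X = {0}"
    and lim: "(\<lambda>n. proj_matrix (pgl_act (\<gamma> n) V)) \<longlonglongrightarrow> l"
  shows "(\<lambda>n. proj_matrix (U_space j (\<gamma> n))) \<longlonglongrightarrow> l"
proof -
  obtain C where C: "\<forall>\<^sub>F n in sequentially. norm (proj_matrix (pgl_act (\<gamma> n) V) - proj_matrix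
      (U_space j (\<gamma> n)))
      \<le> C * exp (- alpha_kappa j (\<gamma> n))"
    using uniform_contraction[OF \<gamma> j div V tendsto_const V R tr] by blast
  have "((\<lambda>n. exp (- alpha_kappa j (\<gamma> n))) \<longlongrightarrow> 0) sequentially"
    by (rule filterlim_compose[OF exp_at_bot]) (use div in \<open>simp add: filterlim_uminus_at_bot\<close>)
  hence "((\<lambda>n. C * exp (- alpha_kappa j (\<gamma> n))) \<longlongrightarrow> 0) sequentially" by (rule tendsto_mult_right_zero)
  hence "(\<lambda>n. proj_matrix (pgl_act (\<gamma> n) V) - proj_matrix (U_space j (\<gamma> n))) \<longlonglongrightarrow> 0"
    by (rule Lim_null_comparison[OF C])
  from tendsto_diff[OF lim this] show ?thesis by simp
qed

lemma U_space_mono: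
  assumes \<gamma>: "\<gamma> \<in> carrier (PGL :: ('k::real_or_complex ^ 'n ^ 'n) set monoid)"
    and ij: "0 < i" "i \<le> j" "j < CARD('n)" and pos: "0 < alpha_kappa i \<gamma>" "0 < alpha_kappa j \<gamma>"
  shows "U_space i \<gamma> \<subseteq> U_space j \<gamma>"
proof -
  obtain A L s M where A: "A \<in> \<gamma>" "norm (det A) = 1" "svd A L s M" using pgl_svd_exists[OF \<gamma>] .
  have U: "U_space m \<gamma> = (*v) L ` std_space m" if m: "0 < m" "m < CARD('n)" "0 < alpha_kappa m \<gamma>" for m
  proof (rule U_space_eq[OF \<gamma> A m(1,2)])
    have "0 < s m" "0 < s (Suc m)" using m by (auto intro!: svd_pos[OF A(3)])
    thus "s (Suc m) < s m" using m(3) unfolding alpha_kappa_eq[OF \<gamma> A m(1,2)] by simp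
  qed
  have "std_space i \<subseteq> (std_space j :: ('k ^ 'n) set)" using ij by (auto simp: std_space_eq)
  thus ?thesis using U[of i] U[of j] ij pos by (simp add: image_mono)
qed

lemma U_flag_in_Flags:
  assumes \<gamma>: "\<gamma> \<in> carrier (PGL :: ('k::real_or_complex ^ 'n ^ 'n) set monoid)"
    and k: "0 < k" "k < CARD('n)" and pos: "0 < alpha_kappa k \<gamma>" "0 < alpha_kappa (CARD('n) - k) \<gamma>"
  shows "U_flag k \<gamma> \<in> Flags k"
proof -
  have "U_space k \<gamma> \<in> Gr k" "U_space (CARD('n) - k) \<gamma> \<in> Gr (CARD('n) - k)"
    using cartan_data(2)[OF \<gamma> _ _ pos(1)] cartan_data(2)[OF \<gamma> _ _ pos(2)] k by auto
  moreover have "U_space k \<gamma> \<subseteq> U_space (CARD('n) - k) \<gamma> \<or> U_space (CARD('n) - k) \<gamma> \<subseteq> U_space k \<gamma>"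
    using U_space_mono[OF \<gamma>, of k "CARD('n) - k"] U_space_mono[OF \<gamma>, of "CARD('n) - k" k] k pos
    by (cases "k \<le> CARD('n) - k") auto
  ultimately show ?thesis by (simp add: U_flag_def Flags_def)
qed

lemma tendsto_flag_iff:
  "flag_tendsto F G \<longleftrightarrow> (\<lambda>n. proj_matrix (fst (F n))) \<longlonglongrightarrow> proj_matrix (fst G) \<and>
     (\<lambda>n. proj_matrix (snd (F n))) \<longlonglongrightarrow> proj_matrix (snd G)"
proof -
  have "((\<lambda>n. (a n, b n)) \<longlonglongrightarrow> (x, y)) \<longleftrightarrow> a \<longlonglongrightarrow> x \<and> b \<longlonglongrightarrow> y"
    for a b :: "nat \<Rightarrow> 'a ^ 'b ^ 'b" and x y
    using tendsto_fst[of "\<lambda>n. (a n, b n)" "(x, y)"] tendsto_snd[of "\<lambda>n. (a n, b n)" "(x, y)"]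
      tendsto_Pair[of a x _ b y] by auto
  thus ?thesis by (simp add: flag_tendsto_def flag_embedding_def)
qed

lemma flag_tendsto_subseq:
  "flag_tendsto F G \<Longrightarrow> strict_mono r \<Longrightarrow> flag_tendsto (\<lambda>n. F (r n)) G"
  unfolding flag_tendsto_def by (drule LIMSEQ_subseq_LIMSEQ, assumption) (simp add: comp_def)

lemma transverse_subgroup:
  assumes "transverse_group k \<Gamma>"
  shows "subgroup \<Gamma> PGL" "\<gamma> \<in> \<Gamma> \<Longrightarrow> \<gamma> \<in> carrier PGL" "\<gamma> \<in> \<Gamma> \<Longrightarrow> inv\<^bsub>PGL\<^esub> \<gamma> \<in> \<Gamma>"
    "\<gamma> \<in> \<Gamma> \<Longrightarrow> inv\<^bsub>PGL\<^esub> (inv\<^bsub>PGL\<^esub> \<gamma>) = \<gamma>"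
  using assms subgroup.mem_carrier[of \<Gamma> PGL] subgroup.m_inv_closed[of \<Gamma> PGL]
    group.inv_inv[OF group_PGL] by (auto simp: transverse_group_def)

text \<open>
  The group elements whose attracting flag is within \<open>m exp (- \<alpha>)\<close> of \<open>x\<close> in both components.
\<close>

definition near_centres ::
    "nat \<Rightarrow> ('k::real_or_complex ^ 'n ^ 'n) set set \<Rightarrow> nat \<Rightarrow> ('k, 'n) flag \<Rightarrow> ('k ^ 'n ^ 'n) set set" where
  "near_centres k \<Gamma> m x = {\<beta>\<in>\<Gamma>.
     norm (proj_matrix (fst x) - proj_matrix (U_space k \<beta>)) \<le> m * exp (- alpha_kappa k \<beta>) \<and>
     norm (proj_matrix (snd x) - proj_matrix (U_space (CARD('n) - k) \<beta>))
       \<le> m * exp (- alpha_kappa (CARD('n) - k) \<beta>)}"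

text \<open>
  Let \<open>\<gamma> n\<close> be the sequence of the conical point \<open>x\<close>, with limits \<open>a\<close> for \<open>x\<close>
  and \<open>b\<close> for all other points, and let \<open>\<beta> n\<close> be its inverses. Along a subsequence the attracting
  flags of \<open>\<beta> n\<close> converge to some \<open>x'\<close> in the limit set. A limit point \<open>y\<close> other than \<open>x\<close>
  and \<open>x'\<close> is transverse to \<open>x'\<close>, which identifies \<open>b\<close> as the limit of the attracting flags of
  \<open>\<gamma> n\<close>; these are the repelling flags of \<open>\<beta> n\<close>. As \<open>a\<close> is transverse to \<open>b\<close>, the
  flags \<open>\<gamma> n x\<close> are uniformly transverse to them, and contraction by \<open>\<beta> n\<close> brings \<open>x\<close>
  close to the attracting flag of \<open>\<beta> n\<close>.
\<close>

lemma conical_near_centres: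
  fixes \<Gamma> :: "('k::real_or_complex ^ 'n ^ 'n) set set"
  assumes \<Gamma>: "transverse_group k \<Gamma>" and k: "0 < k" "k < CARD('n)"
    and x: "x \<in> conical_limit_set k \<Gamma>" and inf: "infinite (limit_set k \<Gamma>)"
  obtains m where "infinite (near_centres k \<Gamma> m x)"
proof -
  let ?d = "CARD('n)"
  note sg = transverse_subgroup[OF \<Gamma>]
  have pd: "P_divergent k \<Gamma>" "P_divergent (?d - k) \<Gamma>" and ts: "transverse_subset (limit_set k \<Gamma>)"
    using \<Gamma> by (auto simp: transverse_group_def)
  have k': "0 < ?d - k" "?d - k < ?d" "?d - (?d - k) = k" using k by auto
  obtain a b \<gamma> where xL: "x \<in> limit_set k \<Gamma>" and ab: "a \<in> limit_set k \<Gamma>" "b \<in> limit_set k \<Gamma>" "a \<noteq> b"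
    and \<gamma>: "inj (\<gamma> :: nat \<Rightarrow> _)" "range \<gamma> \<subseteq> \<Gamma>"
    and xa: "flag_tendsto (\<lambda>n. flag_act (\<gamma> n) x) a"
    and yb: "\<And>y. y \<in> limit_set k \<Gamma> - {x} \<Longrightarrow> flag_tendsto (\<lambda>n. flag_act (\<gamma> n) y) b"
    using x unfolding conical_limit_set_def by blast
  have LF: "F \<in> Flags k" if "F \<in> limit_set k \<Gamma>" for F using that by (simp add: limit_set_def)
  have FG: "fst F \<in> Gr k \<and> snd F \<in> Gr (?d - k)" if "F \<in> Flags k" for F :: "('k, 'n) flag"
    using that by (auto simp: Flags_def)
  define \<beta> where "\<beta> n = inv\<^bsub>PGL\<^esub> (\<gamma> n)" for n
  have \<gamma>\<Gamma>: "\<gamma> n \<in> \<Gamma>" for n using \<gamma>(2) by blast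
  have \<beta>\<Gamma>: "\<beta> n \<in> \<Gamma>" for n unfolding \<beta>_def by (rule sg(3)[OF \<gamma>\<Gamma>])
  have \<gamma>\<beta>: "inv\<^bsub>PGL\<^esub> (\<beta> n) = \<gamma> n" for n unfolding \<beta>_def by (rule sg(4)[OF \<gamma>\<Gamma>])
  have \<beta>inj: "inj \<beta>" by (metis (no_types) \<gamma>(1) \<gamma>\<beta> injD injI)
  have \<beta>div: "filterlim (\<lambda>n. alpha_kappa k (\<beta> n)) at_top sequentially"
      "filterlim (\<lambda>n. alpha_kappa (?d - k) (\<beta> n)) at_top sequentially"
    using pd \<beta>inj \<beta>\<Gamma> unfolding P_divergent_def by auto
  have \<gamma>div: "filterlim (\<lambda>n. alpha_kappa k (\<gamma> n)) at_top sequentially"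
      "filterlim (\<lambda>n. alpha_kappa (?d - k) (\<gamma> n)) at_top sequentially"
    using pd \<gamma> unfolding P_divergent_def by auto
  \<comment> \<open>The default value \<open>x\<close> matters only for the finitely many \<open>n\<close> without a spectral gap.\<close>
  define f where "f n = flag_embedding (if U_flag k (\<beta> n) \<in> Flags k then U_flag k (\<beta> n) else x)" for n
  have "\<forall>n. f n \<in> flag_embedding ` Flags k" unfolding f_def using LF[OF xL] by simp
  then obtain l r where l: "l \<in> flag_embedding ` Flags k" and r: "strict_mono (r :: nat \<Rightarrow> nat)" "(f
      \<circ> r) \<longlonglongrightarrow> l"
    using compact_Flags[of k, where 'k='k and 'n='n] unfolding compact_eq_seq_compact_metric
        seq_compact_def by metis
  then obtain x' where x': "x' \<in> Flags k" "l = flag_embedding x'" by blast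
  have sub: "filterlim (\<lambda>n. h (r n)) F sequentially" if "filterlim h F sequentially" for h :: "nat \<Rightarrow>
      'z" and F
    using filterlim_compose[OF that filterlim_subseq[OF r(1)]] .
  have fl: "flag_tendsto (\<lambda>n. U_flag k (\<beta> (r n))) x'"
  proof -
    have "\<forall>\<^sub>F n in sequentially. 0 < alpha_kappa k (\<beta> n)" "\<forall>\<^sub>F n in sequentially. 0 < alpha_kappa
        (?d - k) (\<beta> n)"
      using \<beta>div by (simp_all add: filterlim_at_top_dense)
    hence "\<forall>\<^sub>F n in sequentially. f n = flag_embedding (U_flag k (\<beta> n))"
      by eventually_elim (simp add: f_def U_flag_in_Flags[OF sg(2)[OF \<beta>\<Gamma>] k])
    hence "\<forall>\<^sub>F n in sequentially. f (r n) = flag_embedding (U_flag k (\<beta> (r n)))"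
      by (rule eventually_subseq[OF r(1)])
    thus ?thesis
      using r(2) unfolding flag_tendsto_def x'(2) comp_def by (rule Lim_transform_eventually[rotated])
  qed
  have rinj: "inj (\<lambda>n. \<beta> (r n))"
    using injD[OF \<beta>inj] strict_mono_eq[OF r(1)] by (intro injI) blast
  have x'L: "x' \<in> limit_set k \<Gamma>"
    unfolding limit_set_def
    by (intro CollectI conjI x'(1) exI[of _ "\<lambda>n. \<beta> (r n)"] rinj fl) (use \<beta>\<Gamma> in auto)
  have "infinite (limit_set k \<Gamma> - {x, x'})" using inf by simp
  from infinite_imp_nonempty[OF this]
  obtain y where y: "y \<in> limit_set k \<Gamma>" "y \<noteq> x" "y \<noteq> x'" by auto
  have tr: "fst F \<inter> snd G = {0} \<and> snd F \<inter> fst G = {0}"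
    if "F \<in> limit_set k \<Gamma>" "G \<in> limit_set k \<Gamma>" "F \<noteq> G" for F G
    using ts that unfolding transverse_subset_def transverse_subspaces_def by blast
  have yF: "fst y \<in> Gr k" "snd y \<in> Gr (?d - k)" and x'F: "fst x' \<in> Gr k" "snd x' \<in> Gr (?d - k)"
    and xF: "fst x \<in> Gr k" "snd x \<in> Gr (?d - k)" and aF: "fst a \<in> Gr k" "snd a \<in> Gr (?d - k)"
    and bF: "fst b \<in> Gr k" "snd b \<in> Gr (?d - k)"
    using FG LF y(1) x'L xL ab by blast+
  have \<gamma>r: "\<gamma> (r n) \<in> carrier PGL" and \<beta>r: "\<beta> (r n) \<in> carrier PGL" for n using sg(2) \<gamma>\<Gamma> \<beta>\<Gamma> by blast+
  have "flag_tendsto (\<lambda>n. flag_act (\<gamma> (r n)) y) b"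
    using yb y by (intro flag_tendsto_subseq[OF _ r(1)]) blast
  hence yb': "(\<lambda>n. proj_matrix (pgl_act (\<gamma> (r n)) (fst y))) \<longlonglongrightarrow> proj_matrix (fst b)"
      "(\<lambda>n. proj_matrix (pgl_act (\<gamma> (r n)) (snd y))) \<longlonglongrightarrow> proj_matrix (snd b)"
    unfolding tendsto_flag_iff flag_act_def fst_conv snd_conv by blast+
  have xa': "(\<lambda>n. proj_matrix (pgl_act (\<gamma> (r n)) (fst x))) \<longlonglongrightarrow> proj_matrix (fst a)"
      "(\<lambda>n. proj_matrix (pgl_act (\<gamma> (r n)) (snd x))) \<longlonglongrightarrow> proj_matrix (snd a)"
    using flag_tendsto_subseq[OF xa r(1)] unfolding tendsto_flag_iff flag_act_def fst_conv snd_conv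
        by blast+
  have fl': "(\<lambda>n. proj_matrix (U_space k (\<beta> (r n)))) \<longlonglongrightarrow> proj_matrix (fst x')"
      "(\<lambda>n. proj_matrix (U_space (?d - k) (\<beta> (r n)))) \<longlonglongrightarrow> proj_matrix (snd x')"
    using fl unfolding tendsto_flag_iff U_flag_def fst_conv snd_conv by blast+
  have b1: "(\<lambda>n. proj_matrix (U_space k (\<gamma> (r n)))) \<longlonglongrightarrow> proj_matrix (fst b)"
    by (rule attracting_limit[OF \<gamma>r k sub[OF \<gamma>div(1)] yF(1) fl'(2)[unfolded \<beta>_def] x'F(2) _ yb'(1)])
      (use tr[OF y(1) x'L y(3)] in blast)
  have b2: "(\<lambda>n. proj_matrix (U_space (?d - k) (\<gamma> (r n)))) \<longlonglongrightarrow> proj_matrix (snd b)"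
    by (rule attracting_limit[OF \<gamma>r k'(1,2) sub[OF \<gamma>div(2)] yF(2), of "fst x'"])
      (use tr[OF y(1) x'L y(3)] fl'(1) yb'(2) x'F in \<open>simp_all add: k'(3) \<beta>_def\<close>)
  have tr1: "fst a \<inter> snd b = {0}" and tr2: "snd a \<inter> fst b = {0}" using tr[OF ab] by auto
  obtain C1 where "0 < C1" and C1: "\<forall>\<^sub>F n in sequentially. norm (proj_matrix (pgl_act (\<beta> (r n))
      (pgl_act (\<gamma> (r n)) (fst x)))
      - proj_matrix (U_space k (\<beta> (r n)))) \<le> C1 * exp (- alpha_kappa k (\<beta> (r n)))"
    using uniform_contraction[OF \<beta>r k sub[OF \<beta>div(1)] pgl_act_Gr[OF \<gamma>r xF(1)] xa'(1) aF(1), unfolded \<gamma>\<beta>,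
        OF b2 bF(2) tr1] .
  obtain C2 where "0 < C2" and C2: "\<forall>\<^sub>F n in sequentially. norm (proj_matrix (pgl_act (\<beta> (r n))
      (pgl_act (\<gamma> (r n)) (snd x)))
      - proj_matrix (U_space (?d - k) (\<beta> (r n)))) \<le> C2 * exp (- alpha_kappa (?d - k) (\<beta> (r n)))"
    using uniform_contraction[OF \<beta>r k'(1,2) sub[OF \<beta>div(2)] pgl_act_Gr[OF \<gamma>r xF(2)] xa'(2) aF(2),
        unfolded \<gamma>\<beta> k'(3),
        OF b1 bF(1) tr2] .
  have ret: "pgl_act (\<beta> (r n)) (pgl_act (\<gamma> (r n)) (fst x)) = fst x" "pgl_act (\<beta> (r n)) (pgl_act (\<gamma>
      (r n)) (snd x)) = snd x" for n
    unfolding \<beta>_def using pgl_act_inverse[OF \<gamma>r xF(1)] pgl_act_inverse[OF \<gamma>r xF(2)] by auto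
  define m where "m = nat \<lceil>max C1 C2\<rceil>"
  have m: "C1 \<le> real m" "C2 \<le> real m" unfolding m_def by linarith+
  let ?S = "near_centres k \<Gamma> m x"
  have "\<forall>\<^sub>F n in sequentially. \<beta> (r n) \<in> ?S"
    using C1 C2
  proof eventually_elim
    case (elim n)
    have h: "C1 * exp (- alpha_kappa k (\<beta> (r n))) \<le> m * exp (- alpha_kappa k (\<beta> (r n)))"
      "C2 * exp (- alpha_kappa (?d - k) (\<beta> (r n))) \<le> m * exp (- alpha_kappa (?d - k) (\<beta> (r n)))"
      using m by (intro mult_right_mono; simp)+
    show ?case
      using order_trans[OF elim(1) h(1)] order_trans[OF elim(2) h(2)] \<beta>\<Gamma>
      unfolding ret near_centres_def by blast
  qed
  then obtain n0 where n0: "\<And>n. n \<ge> n0 \<Longrightarrow> \<beta> (r n) \<in> ?S" unfolding eventually_sequentially by blast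
  have "infinite ((\<lambda>n. \<beta> (r n)) ` {n0..})"
    using finite_imageD[OF _ inj_on_subset[OF rinj], of "{n0..}"] infinite_Ici[of n0] by blast
  moreover have "(\<lambda>n. \<beta> (r n)) ` {n0..} \<subseteq> ?S" using n0 by blast
  ultimately have "infinite ?S" using finite_subset by blast
  thus thesis by (rule that)
qed

lemma P_divergent_finite:
  assumes "P_divergent j \<Gamma>" shows "finite {\<gamma>\<in>\<Gamma>. alpha_kappa j \<gamma> \<le> c}"
proof (rule ccontr)
  assume "infinite {\<gamma>\<in>\<Gamma>. alpha_kappa j \<gamma> \<le> c}"
  then obtain f :: "nat \<Rightarrow> _" where f: "inj f" "range f \<subseteq> {\<gamma>\<in>\<Gamma>. alpha_kappa j \<gamma> \<le> c}"
    using infinite_countable_subset by blast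
  hence "filterlim (\<lambda>n. alpha_kappa j (f n)) at_top sequentially"
    using assms unfolding P_divergent_def by blast
  hence "\<forall>\<^sub>F n in sequentially. c < alpha_kappa j (f n)" by (simp add: filterlim_at_top_dense)
  then obtain n where "c < alpha_kappa j (f n)" unfolding eventually_sequentially by blast
  moreover have "alpha_kappa j (f n) \<le> c" using f(2) by blast
  ultimately show False by simp
qed

section \<open>The dimension bound\<close>

text \<open>
  For fixed \<open>m\<close>, the points that are \<open>m * r i\<close>-close to infinitely many centres form a limsup set of
  balls. Domination turns the Euclidean radii into bounds for the diameters with respect to \<open>d\<close>.
\<close>

lemma hausdorff_null_of_centres:
  fixes \<iota> :: "'x \<Rightarrow> 'e::real_normed_vector" and ctr :: "'i \<Rightarrow> 'e"
  assumes dom: "dominated_near Z \<iota> d" and AZ: "A \<subseteq> Z" and s: "0 < s"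
    and r: "\<And>i. i \<in> I \<Longrightarrow> 0 < r i" and sum: "(\<lambda>i. r i powr s) summable_on I"
    and fin: "\<And>T. 0 < T \<Longrightarrow> finite {i\<in>I. T \<le> r i}"
    and cov: "\<And>x. x \<in> A \<Longrightarrow> \<exists>m::nat. infinite {i\<in>I. norm (\<iota> x - ctr i) \<le> m * r i}"
  shows "hausdorff_null Z d s A"
proof -
  obtain C \<rho> where C: "0 < C" "0 < \<rho>" "\<And>x y. \<lbrakk>x \<in> Z; y \<in> Z; norm (\<iota> x - \<iota> y) < \<rho>\<rbrakk> \<Longrightarrow> d x y \<le> C * norm
      (\<iota> x - \<iota> y)"
    using dom unfolding dominated_near_def by blast
  have "hausdorff_null Z d s {x\<in>A. infinite {i\<in>I. norm (\<iota> x - ctr i) \<le> m * r i}}" for m :: nat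
  proof -
    define c where "c = C * (2 * (m + 1))"
    have c: "c > 0" using C(1) by (simp add: c_def)
    define B where "B i = {x\<in>Z. norm (\<iota> x - ctr i) \<le> m * r i}" for i
    have diam: "ediam d (B i) \<le> ennreal (c * r i)" if i: "i \<in> I" and small: "r i < \<rho> / (2 * (m +
        1))" for i
      unfolding ediam_def
    proof (intro SUP_least ennreal_leI)
      fix x y assume xy: "x \<in> B i" "y \<in> B i"
      have "norm (\<iota> x - \<iota> y) \<le> norm (\<iota> x - ctr i) + norm (\<iota> y - ctr i)"
        using norm_triangle_ineq4[of "\<iota> x - ctr i" "\<iota> y - ctr i"] by simp
      also have "\<dots> \<le> m * r i + m * r i" using xy by (intro add_mono) (auto simp: B_def)
      also have "\<dots> \<le> 2 * (m + 1) * r i" using r[OF i] by (simp add: algebra_simps)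
      finally have le: "norm (\<iota> x - \<iota> y) \<le> 2 * (m + 1) * r i" .
      also have "\<dots> < \<rho>" using small by (simp add: field_simps)
      finally have "d x y \<le> C * norm (\<iota> x - \<iota> y)" using xy by (intro C(3)) (auto simp: B_def)
      also have "\<dots> \<le> C * (2 * (m + 1) * r i)" using le C(1) by (intro mult_left_mono) auto
      finally show "d x y \<le> c * r i" by (simp add: c_def mult.assoc)
    qed
    show ?thesis
    proof (rule hausdorff_null_limsup[where I = I and r = "\<lambda>i. c * r i" and B = B, OF s])
      show "(\<lambda>i. (c * r i) powr s) summable_on I"
      proof (rule summable_on_cong[THEN iffD2])
        show "(\<lambda>i. c powr s * r i powr s) summable_on I" by (rule summable_on_cmult_right[OF sum])
        fix i assume "i \<in> I"
        thus "(c * r i) powr s = c powr s * r i powr s" using r[of i] c by (simp add: powr_mult)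
      qed
      show "finite {i \<in> I. \<not> ediam d (B i) \<le> ennreal (c * r i)}"
      proof (rule finite_subset)
        show "finite {i\<in>I. \<rho> / (2 * (m + 1)) \<le> r i}" using C(2) by (intro fin) simp
        show "{i \<in> I. \<not> ediam d (B i) \<le> ennreal (c * r i)} \<subseteq> {i\<in>I. \<rho> / (2 * (m + 1)) \<le> r i}"
          using diam by (auto simp: not_less[symmetric])
      qed
      show "B i \<subseteq> Z" for i by (auto simp: B_def)
      show "0 < c * r i" if "i \<in> I" for i using r[OF that] c by simp
      show "infinite {i\<in>I. x \<in> B i}" if "x \<in> {x\<in>A. infinite {i\<in>I. norm (\<iota> x - ctr i) \<le> m * r i}}" for x
        using that AZ by (auto simp: B_def)
    qed
  qed
  hence "hausdorff_null Z d s (\<Union>m::nat. {x\<in>A. infinite {i\<in>I. norm (\<iota> x - ctr i) \<le> m * r i}})"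
    by (rule hausdorff_null_UN)
  thus ?thesis by (rule hausdorff_null_subset) (use cov in blast)
qed

text \<open>
  The size, up to a constant, of the ball of flags around the attracting flag of \<open>\<beta>\<close>: the two components
  contribute the two summands.
\<close>

definition gap_scale :: "nat \<Rightarrow> ('k::real_or_complex ^ 'n ^ 'n) set \<Rightarrow> real" where
  "gap_scale k \<beta> = exp (- alpha_kappa k \<beta>) + exp (- alpha_kappa (CARD('n) - k) \<beta>)"

lemma gap_scale_pos: "0 < gap_scale k \<beta>"
  by (simp add: gap_scale_def add_pos_pos)

lemma alpha_kappa_inverse:
  assumes \<Gamma>: "transverse_group k \<Gamma>" and k: "0 < k" "k < CARD('n)" and "\<beta> \<in> \<Gamma>"
  shows "alpha_kappa (CARD('n) - k) \<beta> = alpha_kappa k (inv\<^bsub>PGL\<^esub> (\<beta> :: ('k::real_or_complex ^ 'n ^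
      'n) set))"
  using cartan_data(1)[OF transverse_subgroup(2)[OF \<Gamma>] k, of "inv\<^bsub>PGL\<^esub> \<beta>"]
    transverse_subgroup(3,4)[OF \<Gamma> \<open>\<beta> \<in> \<Gamma>\<close>] by simp

lemma powr_add_le:
  assumes "0 \<le> a" "0 \<le> b" "0 \<le> s"
  shows "(a + b) powr s \<le> 2 powr s * (a powr s + b powr (s :: real))"
proof -
  have "(a + b) powr s \<le> (2 * max a b) powr s" using assms by (intro powr_mono2) auto
  also have "\<dots> = 2 powr s * max a b powr s" using assms by (simp add: powr_mult)
  also have "\<dots> \<le> 2 powr s * (a powr s + b powr s)" by (intro mult_left_mono) (auto simp: max_def)
  finally show ?thesis .
qed

text \<open>
  The root \<open>\<alpha>\<^sub>d\<^sub>-\<^sub>k\<close> of an element is \<open>\<alpha>\<^sub>k\<close> of its inverse, and inversion permutes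
  \<open>\<Gamma>\<close>. So the second component costs as much as the first.
\<close>

lemma gap_scale_summable:
  fixes \<Gamma> :: "('k::real_or_complex ^ 'n ^ 'n) set set"
  assumes \<Gamma>: "transverse_group k \<Gamma>" and k: "0 < k" "k < CARD('n)" and s: "0 < s"
    and sum: "(\<lambda>\<gamma>. exp (- s * alpha_kappa k \<gamma>)) summable_on \<Gamma>"
  shows "(\<lambda>\<beta>. gap_scale k \<beta> powr s) summable_on \<Gamma>"
proof -
  note sg = transverse_subgroup[OF \<Gamma>]
  have "bij_betw (\<lambda>\<gamma>. inv\<^bsub>PGL\<^esub> \<gamma>) \<Gamma> \<Gamma>"
    by (rule bij_betw_byWitness[where f' = "\<lambda>\<gamma>. inv\<^bsub>PGL\<^esub> \<gamma>"]) (use sg(3,4) in auto)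
  hence "(\<lambda>\<gamma>. exp (- s * alpha_kappa k (inv\<^bsub>PGL\<^esub> \<gamma>))) summable_on \<Gamma>"
    using sum summable_on_reindex_bij_betw[of "\<lambda>\<gamma>. inv\<^bsub>PGL\<^esub> \<gamma>" \<Gamma> \<Gamma> "\<lambda>\<gamma>. exp (- s * alpha_kappa k
        \<gamma>)"] by simp
  hence "(\<lambda>\<gamma>. 2 powr s * (exp (- s * alpha_kappa k \<gamma>) + exp (- s * alpha_kappa k (inv\<^bsub>PGL\<^esub> \<gamma>))))
      summable_on \<Gamma>"
    by (intro summable_on_cmult_right summable_on_add sum)
  thus ?thesis
  proof (rule summable_on_comparison_test)
    fix \<beta> assume "\<beta> \<in> \<Gamma>"
    have "gap_scale k \<beta> powr s \<le> 2 powr s * (exp (- alpha_kappa k \<beta>) powr s + exp (- alpha_kappa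
        (CARD('n) - k) \<beta>) powr s)"
      unfolding gap_scale_def by (rule powr_add_le) (use s in auto)
    thus "gap_scale k \<beta> powr s \<le> 2 powr s * (exp (- s * alpha_kappa k \<beta>) + exp (- s * alpha_kappa k
        (inv\<^bsub>PGL\<^esub> \<beta>)))"
      unfolding alpha_kappa_inverse[OF \<Gamma> k \<open>\<beta> \<in> \<Gamma>\<close>] by (simp add: exp_powr_real mult.commute)
  qed simp
qed

lemma gap_scale_finite:
  fixes \<Gamma> :: "('k::real_or_complex ^ 'n ^ 'n) set set"
  assumes \<Gamma>: "transverse_group k \<Gamma>" and T: "0 < T"
  shows "finite {\<beta>\<in>\<Gamma>. T \<le> gap_scale k \<beta>}"
proof (rule finite_subset)
  show "finite ({\<beta>\<in>\<Gamma>. alpha_kappa k \<beta> \<le> - ln (T / 2)} \<union> {\<beta>\<in>\<Gamma>. alpha_kappa (CARD('n) - k) \<beta> \<le> - ln (T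
      / 2)})"
    using \<Gamma> by (simp add: P_divergent_finite transverse_group_def)
  have small: "exp (- a) < T / 2" if "\<not> a \<le> - ln (T / 2)" for a
  proof -
    have "exp (- a) < exp (ln (T / 2))" using that by simp
    thus ?thesis using T by simp
  qed
  show "{\<beta>\<in>\<Gamma>. T \<le> gap_scale k \<beta>} \<subseteq> {\<beta>\<in>\<Gamma>. alpha_kappa k \<beta> \<le> - ln (T / 2)} \<union> {\<beta>\<in>\<Gamma>. alpha_kappa
      (CARD('n) - k) \<beta> \<le> - ln (T / 2)}"
  proof
    fix \<beta> assume "\<beta> \<in> {\<beta>\<in>\<Gamma>. T \<le> gap_scale k \<beta>}"
    thus "\<beta> \<in> {\<beta>\<in>\<Gamma>. alpha_kappa k \<beta> \<le> - ln (T / 2)} \<union> {\<beta>\<in>\<Gamma>. alpha_kappa (CARD('n) - k) \<beta> \<le> - ln (T / 2)}"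
      using small[of "alpha_kappa k \<beta>"] small[of "alpha_kappa (CARD('n) - k) \<beta>"]
      by (fastforce simp: gap_scale_def)
  qed
qed

text \<open>
  The map \<open>\<pi>\<close> is the identity on flags or the projection to the first component; both bounds of the
  theorem come from the same balls. If the limit set is finite, then so is the conical limit set. If the series
  converges at \<open>s = 0\<close>, then \<open>\<Gamma>\<close> is finite and the series converges for all \<open>s\<close>.
\<close>

lemma hausdorff_dim_le_critical_exponent:
  fixes \<Gamma> :: "('k::real_or_complex ^ 'n ^ 'n) set set" and \<iota> :: "'x \<Rightarrow> 'e::real_normed_vector"
  assumes \<Gamma>: "transverse_group k \<Gamma>" and k: "0 < k" "k < CARD('n)"
    and dom: "dominated_near Z \<iota> d" and self: "\<And>z. z \<in> Z \<Longrightarrow> d z z \<le> 0"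
    and \<pi>: "\<pi> ` limit_set k \<Gamma> \<subseteq> Z"
    and ctr: "\<And>x \<beta>. norm (\<iota> (\<pi> x) - ctr \<beta>) \<le> norm (proj_matrix (fst x) - proj_matrix (U_space k \<beta>))
        + norm (proj_matrix (snd x) - proj_matrix (U_space (CARD('n) - k) \<beta>))"
  shows "hausdorff_dim Z d (\<pi> ` conical_limit_set k \<Gamma>) \<le> critical_exponent k \<Gamma>"
proof -
  have AZ: "\<pi> ` conical_limit_set k \<Gamma> \<subseteq> Z" using \<pi> by (auto simp: conical_limit_set_def)
  have pos: "hausdorff_dim Z d (\<pi> ` conical_limit_set k \<Gamma>) \<le> ennreal s"
    if s: "0 < s" and sum: "(\<lambda>\<gamma>. exp (- s * alpha_kappa k \<gamma>)) summable_on \<Gamma>" for s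
  proof (rule hausdorff_dim_le_of_null[OF s], cases "finite (limit_set k \<Gamma>)")
    case True
    hence "finite (conical_limit_set k \<Gamma>)" by (rule rev_finite_subset) (auto simp: conical_limit_set_def)
    thus "hausdorff_null Z d s (\<pi> ` conical_limit_set k \<Gamma>)"
      by (intro hausdorff_null_countable AZ self countable_finite finite_imageI)
  next
    case False
    show "hausdorff_null Z d s (\<pi> ` conical_limit_set k \<Gamma>)"
    proof (rule hausdorff_null_of_centres[where ctr = ctr, OF dom AZ s gap_scale_pos
        gap_scale_summable[OF \<Gamma> k s sum] gap_scale_finite[OF \<Gamma>]])
      fix z assume "z \<in> \<pi> ` conical_limit_set k \<Gamma>"
      then obtain x where x: "x \<in> conical_limit_set k \<Gamma>" "z = \<pi> x" by blast
      obtain m where m: "infinite (near_centres k \<Gamma> m x)"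
        using conical_near_centres[OF \<Gamma> k x(1) False] .
      have "infinite {\<beta>\<in>\<Gamma>. norm (\<iota> z - ctr \<beta>) \<le> m * gap_scale k \<beta>}"
      proof (rule infinite_super[OF _ m], rule subsetI)
        fix \<beta> assume \<beta>: "\<beta> \<in> near_centres k \<Gamma> m x"
        have "norm (\<iota> z - ctr \<beta>) \<le> m * gap_scale k \<beta>"
          unfolding x(2) gap_scale_def distrib_left
          by (rule order_trans[OF ctr add_mono]) (use \<beta> in \<open>auto simp: near_centres_def\<close>)
        thus "\<beta> \<in> {\<beta>\<in>\<Gamma>. norm (\<iota> z - ctr \<beta>) \<le> m * gap_scale k \<beta>}"
          using \<beta> by (simp add: near_centres_def)
      qed
      thus "\<exists>m::nat. infinite {\<beta>\<in>\<Gamma>. norm (\<iota> z - ctr \<beta>) \<le> m * gap_scale k \<beta>}" by blast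
    qed
  qed
  show ?thesis
    unfolding critical_exponent_def
  proof (rule INF_greatest)
    fix s assume "s \<in> {s. 0 \<le> s \<and> (\<lambda>\<gamma>. exp (- s * alpha_kappa k \<gamma>)) summable_on \<Gamma>}"
    hence s: "0 \<le> s" and sum: "(\<lambda>\<gamma>. exp (- s * alpha_kappa k \<gamma>)) summable_on \<Gamma>" by auto
    show "hausdorff_dim Z d (\<pi> ` conical_limit_set k \<Gamma>) \<le> ennreal s"
    proof (cases "s = 0")
      case False thus ?thesis using pos sum s by simp
    next
      case True
      hence "(\<lambda>_. 1 :: real) summable_on \<Gamma>" using sum by simp
      hence "finite \<Gamma>" using infsum_diverge_constant[of \<Gamma> "1::real"] by auto
      show ?thesis
      proof (rule ennreal_le_epsilon)
        fix e :: real assume "0 < e"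
        hence "hausdorff_dim Z d (\<pi> ` conical_limit_set k \<Gamma>) \<le> ennreal e"
          by (rule pos) (use \<open>finite \<Gamma>\<close> in simp)
        thus "hausdorff_dim Z d (\<pi> ` conical_limit_set k \<Gamma>) \<le> ennreal s + ennreal e" using True by simp
      qed
    qed
  qed
qed

lemma conical_dimension_bounds:
  fixes \<Gamma> :: "('k::real_or_complex ^ 'n ^ 'n) set set"
  assumes \<Gamma>: "transverse_group k \<Gamma>" and k: "0 < k" "k < CARD('n::finite)"
  shows "riemannian_metric (flag_embedding ` (Flags k :: ('k, 'n) flag set)) g \<Longrightarrow>
      riemannian_hausdorff_dim flag_embedding (Flags k) g (conical_limit_set k \<Gamma>) \<le>
          critical_exponent k \<Gamma>"
    and "riemannian_metric (proj_matrix ` (Gr k :: ('k ^ 'n) set set)) h \<Longrightarrow>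
      riemannian_hausdorff_dim proj_matrix (Gr k) h (fst ` conical_limit_set k \<Gamma>) \<le>
          critical_exponent k \<Gamma>"
proof -
  assume g: "riemannian_metric (flag_embedding ` (Flags k :: ('k, 'n) flag set)) g"
  have "hausdorff_dim (Flags k) (\<lambda>x y. riemannian_dist (flag_embedding ` (Flags k :: ('k, 'n) flag
      set)) g (flag_embedding x) (flag_embedding y))
      ((\<lambda>x. x) ` conical_limit_set k \<Gamma>) \<le> critical_exponent k \<Gamma>"
  proof (rule hausdorff_dim_le_critical_exponent[OF \<Gamma> k dominated_near_Flags[OF g],
        where ctr = "\<lambda>\<beta>. (proj_matrix (U_space k \<beta>), proj_matrix (U_space (CARD('n) - k) \<beta>))"])
    show "riemannian_dist (flag_embedding ` Flags k) g (flag_embedding z) (flag_embedding z) \<le> 0"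
      if "z \<in> Flags k" for z :: "('k, 'n) flag"
      by (rule riemannian_dist_self[OF compact_Flags g]) (use that in blast)
    show "(\<lambda>x. x) ` limit_set k \<Gamma> \<subseteq> Flags k" by (auto simp: limit_set_def)
    show "norm (flag_embedding x - (proj_matrix (U_space k \<beta>), proj_matrix (U_space (CARD('n) - k) \<beta>)))
        \<le> norm (proj_matrix (fst x) - proj_matrix (U_space k \<beta>)) + norm (proj_matrix (snd x) -
            proj_matrix (U_space (CARD('n) - k) \<beta>))"
      for x and \<beta> :: "('k ^ 'n ^ 'n) set"
      by (simp add: flag_embedding_def norm_Pair_le)
  qed
  thus "riemannian_hausdorff_dim flag_embedding (Flags k) g (conical_limit_set k \<Gamma>) \<le>
      critical_exponent k \<Gamma>"
    by (simp add: riemannian_hausdorff_dim_def)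
next
  assume h: "riemannian_metric (proj_matrix ` (Gr k :: ('k ^ 'n) set set)) h"
  show "riemannian_hausdorff_dim proj_matrix (Gr k) h (fst ` conical_limit_set k \<Gamma>) \<le>
      critical_exponent k \<Gamma>"
    unfolding riemannian_hausdorff_dim_def
  proof (rule hausdorff_dim_le_critical_exponent[OF \<Gamma> k dominated_near_Gr[OF h],
        where ctr = "\<lambda>\<beta>. proj_matrix (U_space k \<beta>)"])
    show "riemannian_dist (proj_matrix ` Gr k) h (proj_matrix z) (proj_matrix z) \<le> 0"
      if "z \<in> Gr k" for z :: "('k ^ 'n) set"
      by (rule riemannian_dist_self[OF compact_Gr h]) (use that in blast)
    show "fst ` limit_set k \<Gamma> \<subseteq> Gr k" by (auto simp: limit_set_def Flags_def)
  qed simp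
qed

theorem theorem1p3:
  fixes k :: nat
  assumes "0 < k" and "k < CARD('n::finite)"
  shows
    "(\<forall>\<Gamma> :: (real ^ 'n ^ 'n) set set. transverse_group k \<Gamma> \<longrightarrow>
        (\<forall>g. riemannian_metric (flag_embedding ` (Flags k :: (real, 'n) flag set)) g \<longrightarrow>
           riemannian_hausdorff_dim flag_embedding (Flags k) g (conical_limit_set k \<Gamma>)
             \<le> critical_exponent k \<Gamma>) \<and>
        (\<forall>g. riemannian_metric (proj_matrix ` (Gr k :: (real ^ 'n) set set)) g \<longrightarrow>
           riemannian_hausdorff_dim proj_matrix (Gr k) g (fst ` conical_limit_set k \<Gamma>)
             \<le> critical_exponent k \<Gamma>)) \<and>
     (\<forall>\<Gamma> :: (complex ^ 'n ^ 'n) set set. transverse_group k \<Gamma> \<longrightarrow>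
        (\<forall>g. riemannian_metric (flag_embedding ` (Flags k :: (complex, 'n) flag set)) g \<longrightarrow>
           riemannian_hausdorff_dim flag_embedding (Flags k) g (conical_limit_set k \<Gamma>)
             \<le> critical_exponent k \<Gamma>) \<and>
        (\<forall>g. riemannian_metric (proj_matrix ` (Gr k :: (complex ^ 'n) set set)) g \<longrightarrow>
           riemannian_hausdorff_dim proj_matrix (Gr k) g (fst ` conical_limit_set k \<Gamma>)
             \<le> critical_exponent k \<Gamma>))"
  using conical_dimension_bounds[OF _ assms, where 'k = real] conical_dimension_bounds[OF _ assms, where 'k = complex]
  by (intro conjI allI impI) simp_all

end
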